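(* Let $q\in\mathbb{C}$ with $0<|q|<1$ and let $\omega$ be a primitive third root of unity. Then $$q^{-2}\psi(q^9)+\frac{\omega \phi(\omega q)-\omega^2\phi(\omega^2 q)}{\omega - \omega^2}=\frac{J_{1,2}}{J_{3,6}}\cdot\frac{J_{6,15}J_{6}}{J_{3}}.$$
   Context: For a complex number $p$ with $0<|p|<1$ and $x\in\mathbb{C}^*=\mathbb{C}\setminus\{0\}$: $(x;p)_n=\prod_{i=0}^{n-1}(1-p^ix)$, $(x;p)_\infty=\prod_{i\ge0}(1-p^ix)$, and $j(x;p)=(x;p)_\infty(p/x;p)_\infty(p;p)_\infty=\sum_{n\in\mathbb{Z}}(-1)^np^{\binom n2}x^n$. For integers $a,m$ with $m\ge1$: $J_{a,m}=j(q^a;q^m)$ and $J_m=J_{m,3m}=\prod_{i\ge1}(1-q^{mi})$. The tenth-order mock theta functions $\phi,\psi$ are, for $|q|<1$, $\phi(q)=\sum_{n\ge0}\frac{q^{\binom{n+1}{2}}}{(q;q^2)_{n+1}}$ and $\psi(q)=\sum_{n\ge0}\frac{q^{\binom{n+2}{2}}}{(q;q^2)_{n+1}}$. *)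

theory Defs
  imports "HOL-Analysis.Analysis"
begin

definition qpoch :: "complex \<Rightarrow> complex \<Rightarrow> nat \<Rightarrow> complex" where
  "qpoch x p n = (\<Prod>i<n. 1 - p ^ i * x)"

(* The infinite product converges absolutely for norm p < 1; prodinf has value 0
   when a factor vanishes. *)
definition qpoch_inf :: "complex \<Rightarrow> complex \<Rightarrow> complex" where
  "qpoch_inf x p = (\<Prod>i. 1 - p ^ i * x)"

definition theta_j :: "complex \<Rightarrow> complex \<Rightarrow> complex" where
  "theta_j x p = qpoch_inf x p * qpoch_inf (p / x) p * qpoch_inf p p"

(* theta_J q a m is J_{a,m} and theta_J1 q m is J_m; the base q, implicit in the
   usual notation, is an explicit argument. *)
definition theta_J :: "complex \<Rightarrow> int \<Rightarrow> int \<Rightarrow> complex" where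
  "theta_J q a m = theta_j (q powi a) (q powi m)"

definition theta_J1 :: "complex \<Rightarrow> int \<Rightarrow> complex" where
  "theta_J1 q m = theta_J q m (3 * m)"

definition mock_phi10 :: "complex \<Rightarrow> complex" where
  "mock_phi10 q = (\<Sum>n. q ^ ((n + 1) choose 2) / qpoch q (q ^ 2) (n + 1))"

definition mock_psi10 :: "complex \<Rightarrow> complex" where
  "mock_psi10 q = (\<Sum>n. q ^ ((n + 2) choose 2) / qpoch q (q ^ 2) (n + 1))"

definition primitive_root_of_unity :: "nat \<Rightarrow> complex \<Rightarrow> bool" where
  "primitive_root_of_unity n w \<longleftrightarrow>
     n > 0 \<and> w ^ n = 1 \<and> (\<forall>k. 0 < k \<and> k < n \<longrightarrow> w ^ k \<noteq> 1)"

end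

theory Submission
  imports Defs
begin

text \<open>
  A Bailey-type summation turns \<open>J\<^sub>1\<^sub>,\<^sub>2 \<phi>\<close> and \<open>J\<^sub>1\<^sub>,\<^sub>2 \<psi>\<close> into sums of \<open>(- 1)\<^sup>N q ^ (N\<^sup>2 + c N) k\<^sub>N\<close>, where the
  Hecke-type coefficients satisfy \<open>k\<^sub>N\<^sub>+\<^sub>2 = q ^ (N + 1) k\<^sub>N + 2\<close>. Split every series according to the residue mod 3
  of the exponents of \<open>q\<close>, by averaging over \<open>q\<close>, \<open>\<omega> q\<close>, \<open>\<omega>\<^sup>2 q\<close>. For the exponents congruent to 1, the
  coefficients \<open>k\<^sub>N\<close> at \<open>q\<close> reduce to those at \<open>q\<^sup>9\<close>; this expresses \<open>\<psi>(q\<^sup>9)\<close> through the parts of \<open>\<phi>\<close> of classes 0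
  and 1, and leaves only the part of class 0 to be evaluated.

  For that, the quotients \<open>e\<^sub>k\<close> of the normalized Hecke-type sums with \<open>c = 1 - 2 k\<close> by \<open>J\<^sub>1\<^sub>,\<^sub>2\<close> satisfy
  \<open>e\<^sub>k\<^sub>+\<^sub>5 = - q ^ (2 k + 4) e\<^sub>k - 2 q ^ (k + 3)\<close>, and \<open>\<Sum> e\<^sub>k u ^ k\<close> is a product of two theta series whenever
  \<open>u\<^sup>3 = 1\<close>. Projecting to a residue class that the last term misses gives two linear equations for the
  class-0 part of \<open>\<phi>\<close> and the class-1 part of \<open>\<psi>\<close>. Theta identities obtained from sublattices of index 5
  solve the system.
\<close>

section \<open>Bilateral series\<close>

text \<open>For a power series f in q let f_i be the part with exponents congruent to i mod 3. In
  the quotient on the left of the theorem q^n gets the weight 1, -1 or 0, so the quotient is phi_0 -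
  phi_1. This is why only class 1 of the Hecke sum matters, why psi(q^9) cancels, and why phi_0
  alone must become a product. The monomial inhomogeneity in the recurrence for the e_k obstructs a
  direct evaluation; projection removes it. Cube roots u enter because the series of e_k u^k times
  j(q u; q^2) has coefficients with a homogeneous recurrence of step 3. At u^3 = 1 its residue
  classes sum, up to one common factor, to (q;q)_inf^3, u (q;q)_inf^3 and 0, and the total (1 + u)
  (q;q)_inf^3 splits into theta functions. Steps 5 and 3 together leave progressions mod 15, hence
  theta series to the base t^30 with t = q^3; the sublattices of index 5 produce the same series.
  The pair j(t^2; t^5), j(t; t^5) satisfies a linear system with the same matrix as the unknown
  parts, so that comparing the two systems suffices. The determinant is (t^2; t^2)_inf^2.\<close>

definition tri :: "int \<Rightarrow> int" where
  "tri n = n * (n - 1) div 2"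

lemma two_tri: "2 * tri n = n * (n - 1)"
  unfolding tri_def by (rule dvd_mult_div_cancel) (cases "even n"; simp)

lemma tri_eqI: "2 * e = n * (n - 1) \<Longrightarrow> tri n = e"
  using two_tri[of n] by simp

lemma tri_0 [simp]: "tri 0 = 0"
  and tri_1 [simp]: "tri 1 = 0"
  and tri_2 [simp]: "tri 2 = 1"
  by (auto simp: tri_def)

lemma tri_add: "tri (a + b) = tri a + tri b + a * b"
  by (rule tri_eqI) (simp add: algebra_simps flip: two_tri, use two_tri[of a] two_tri[of b] in \<open>simp add: algebra_simps\<close>)

lemma tri_minus: "tri (- a) = tri a + a"
  by (rule tri_eqI) (use two_tri[of a] in \<open>simp add: algebra_simps\<close>)

lemma tri_diff: "tri (a - b) = tri a + tri b + b - a * b"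
  using tri_add[of a "-b"] by (simp add: tri_minus)

lemma tri_mult: "tri (k * a) = k * k * tri a + tri k * a"
proof (rule tri_eqI)
  have "2 * (k * k * tri a + tri k * a) = k * k * (2 * tri a) + (2 * tri k) * a"
    by (simp add: algebra_simps)
  also have "\<dots> = k * k * (a * (a - 1)) + (k * (k - 1)) * a"
    by (simp only: two_tri)
  also have "\<dots> = k * a * (k * a - 1)"
    by (simp add: algebra_simps)
  finally show "2 * (k * k * tri a + tri k * a) = k * a * (k * a - 1)" .
qed

lemma tri_numeral [simp]: "tri (numeral k) = numeral k * (numeral k - 1) div 2"
  by (simp add: tri_def)

lemma tri_Suc: "tri (1 + a) = tri a + a" "tri (a + 1) = tri a + a"
  by (simp_all add: tri_add)

lemma tri_reflect: "tri (1 - a) = tri a"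
  by (simp add: tri_diff)

lemma tri_ge: "tri n \<ge> 0"
proof -
  have "n * (n - 1) \<ge> 0"
    by (cases "n \<ge> 1") (auto simp: mult_nonpos_nonpos)
  then show ?thesis using two_tri[of n] by linarith
qed

lemma tri_nat: "nat (tri (int n)) = n choose 2"
proof -
  have "int (n choose 2) = tri (int n)"
  proof (induction n)
    case (Suc n)
    then show ?case
      by (simp add: numeral_2_eq_2 tri_Suc)
  qed (simp)
  then show ?thesis by (metis nat_int)
qed

text \<open>A parity test instead of \<open>(-1) powi n\<close>, so that sign identities reduce to
  the simplification rules for \<open>even\<close>.\<close>

definition alt_sign :: "int \<Rightarrow> complex" where
  "alt_sign n = (if even n then 1 else -1)"

lemma alt_sign_0 [simp]: "alt_sign 0 = 1" and alt_sign_1 [simp]: "alt_sign 1 = -1"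
  and alt_sign_numeral_Bit0 [simp]: "alt_sign (numeral (Num.Bit0 k)) = 1"
  and alt_sign_numeral_Bit1 [simp]: "alt_sign (numeral (Num.Bit1 k)) = -1"
  and norm_alt_sign [simp]: "norm (alt_sign n) = 1"
  and alt_sign_square [simp]: "alt_sign n * alt_sign n = 1"
  and alt_sign_neq_0 [simp]: "alt_sign n \<noteq> 0"
  by (auto simp: alt_sign_def)

lemma alt_sign_add: "alt_sign (a + b) = alt_sign a * alt_sign b"
  and alt_sign_diff: "alt_sign (a - b) = alt_sign a * alt_sign b"
  and alt_sign_minus [simp]: "alt_sign (- a) = alt_sign a"
  by (auto simp: alt_sign_def)

lemma alt_sign_eq_powi: "alt_sign n = (-1) powi n"
  by (auto simp: alt_sign_def power_int_minus_left)

section \<open>Absolutely convergent series over the integers\<close>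

lemma abs_summable_on_int:
  fixes f :: "int \<Rightarrow> 'a :: banach"
  assumes "summable (\<lambda>n. norm (f (int n)))" "summable (\<lambda>n. norm (f (- int n - 1)))"
  shows "(\<lambda>n. norm (f n)) summable_on UNIV"
proof -
  have a: "(\<lambda>n. norm (f n)) summable_on range int"
    using summable_on_reindex[of int UNIV "\<lambda>n. norm (f n)"] assms(1)
    by (simp add: o_def summable_on_UNIV_nonneg_real_iff)
  have b: "(\<lambda>n. norm (f n)) summable_on range (\<lambda>n. - int n - 1)"
    using summable_on_reindex[of "\<lambda>n. - int n - 1" UNIV "\<lambda>n. norm (f n)"] assms(2)
    by (simp add: o_def summable_on_UNIV_nonneg_real_iff inj_def)
  have c: "range int \<union> range (\<lambda>n. - int n - 1) = UNIV"
  proof (intro equalityI subsetI)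
    fix x :: int
    show "x \<in> range int \<union> range (\<lambda>n. - int n - 1)"
    proof (cases "x \<ge> 0")
      case False
      then have "x = - int (nat (- x - 1)) - 1" by simp
      then show ?thesis by blast
    qed (use nonneg_int_cases in blast)
  qed auto
  show ?thesis
    using summable_on_union[OF a b] c by simp
qed

lemma summable_theta_nat:
  fixes p x :: complex
  assumes "norm p < 1"
  shows "summable (\<lambda>n. norm (p ^ (n choose 2) * x ^ n))"
proof (cases "x = 0")
  case True
  show ?thesis
    by (rule summable_comparison_test_ev[OF _ summable_zero]) 
       (rule eventually_sequentiallyI[of 1], simp add: True)
next
  case False
  have lim: "(\<lambda>n. norm p ^ n * norm x) \<longlonglongrightarrow> 0"
    using assms by (intro tendsto_mult_left_zero LIMSEQ_power_zero) auto
  then have "eventually (\<lambda>n. norm p ^ n * norm x < 1/2) sequentially"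
    by (rule order_tendstoD) auto
  then obtain N where N: "\<And>n. n \<ge> N \<Longrightarrow> norm p ^ n * norm x < 1/2"
    by (auto simp: eventually_sequentially)
  show ?thesis
  proof (rule summable_ratio_test[of "1/2" N])
    fix n assume "n \<ge> N"
    then have "norm p ^ n * norm x \<le> 1/2" using N by (simp add: less_imp_le)
    then have "(norm p ^ (n choose 2) * norm x ^ n) * (norm p ^ n * norm x)
               \<le> (norm p ^ (n choose 2) * norm x ^ n) * (1/2)"
      by (intro mult_left_mono) auto
    moreover have "Suc n choose 2 = n + (n choose 2)"
      by (simp add: numeral_2_eq_2)
    ultimately show "norm (norm (p ^ (Suc n choose 2) * x ^ Suc n))
             \<le> 1/2 * norm (norm (p ^ (n choose 2) * x ^ n))"
      by (simp add: norm_mult norm_power power_add mult_ac)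
  qed auto
qed

lemma powi_tri_nat: "p powi tri (int n) = p ^ (n choose 2)"
  using tri_nat[of n] tri_ge[of "int n"] by (simp add: power_int_nonneg_exp)

lemma abs_summable_theta:
  fixes p x :: complex
  assumes "p \<noteq> 0" "norm p < 1" "x \<noteq> 0"
  shows "(\<lambda>n. norm (p powi tri n * x powi n)) summable_on UNIV"
proof (rule abs_summable_on_int)
  show "summable (\<lambda>n. norm (p powi tri (int n) * x powi int n))"
    using summable_theta_nat[OF assms(2), of x] by (simp add: powi_tri_nat)
  have "norm (p powi tri (- int n - 1) * x powi (- int n - 1))
        = norm (p / x) * norm (p ^ (n choose 2) * (p^2 / x) ^ n)" for n
  proof -
    have 1: "tri (- int n - 1) = tri (int n) + 2 * int n + 1"
      using tri_minus[of "int n + 1"] by (simp add: tri_Suc)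
    show ?thesis using assms unfolding 1
      by (simp add: power_int_add power_int_diff power_int_minus powi_tri_nat norm_mult norm_divide
                    norm_power power_int_mult field_simps)
         (simp add: mult.commute flip: power_mult)
  qed
  then show "summable (\<lambda>n. norm (p powi tri (- int n - 1) * x powi (- int n - 1)))"
    using summable_theta_nat[OF assms(2), of "p^2 / x"] by (simp add: summable_mult)
qed

text \<open>The linear weight will dominate the Hecke coefficients. Since |n| <= 2^n + 2^(-n), it is
  absorbed by the two theta series at 2 x and x / 2.\<close>

lemma abs_summable_theta_lin:
  fixes p x :: complex
  assumes "p \<noteq> 0" "norm p < 1" "x \<noteq> 0"
  shows "(\<lambda>n. norm (of_int (\<bar>n\<bar> + c) * (p powi tri n * x powi n))) summable_on UNIV"
proof (rule Infinite_Sum.abs_summable_on_comparison_test')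
  let ?g = "\<lambda>x n. norm (p powi tri n * x powi n)"
  define C where "C = 1 + \<bar>of_int c :: real\<bar>"
  show "(\<lambda>n. C * (?g (2 * x) n + ?g (x / 2) n)) summable_on UNIV"
    by (intro summable_on_cmult_right summable_on_add abs_summable_theta) (use assms in auto)
  fix n :: int
  have b: "of_int \<bar>n\<bar> \<le> (2 powi n + 2 powi (-n) :: real)"
  proof -
    have *: "real m \<le> 2 ^ m" for m :: nat
      by (rule less_imp_le, rule of_nat_less_two_power)
    obtain m where m: "n = int m \<or> n = - int m" by (metis int_cases2)
    from m show ?thesis by (auto intro: add_increasing add_increasing2 *)
  qed
  have one: "1 \<le> (2 powi n + 2 powi (-n) :: real)"
  proof (cases "n \<ge> 0")
    case True
    then have "(1::real) \<le> 2 powi n" by (intro one_le_power_int) auto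
    then show ?thesis by (smt (verit) zero_le_power_int)
  next
    case False
    then have "(1::real) \<le> 2 powi (-n)" by (intro one_le_power_int) auto
    then show ?thesis by (smt (verit) zero_le_power_int)
  qed
  have "\<bar>of_int (\<bar>n\<bar> + c) :: real\<bar> \<le> of_int \<bar>n\<bar> + \<bar>of_int c\<bar> * 1" by simp
  also have "\<dots> \<le> (2 powi n + 2 powi (-n)) + \<bar>of_int c\<bar> * (2 powi n + 2 powi (-n))"
    by (intro add_mono mult_left_mono b one) auto
  also have "\<dots> = C * (2 powi n + 2 powi (-n))" by (simp add: C_def algebra_simps)
  finally have "\<bar>of_int (\<bar>n\<bar> + c) :: real\<bar> * norm (p powi tri n * x powi n)
     \<le> C * (2 powi n + 2 powi (-n)) * norm (p powi tri n * x powi n)"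
    by (intro mult_right_mono) auto
  also have "\<dots> = C * (?g (2 * x) n + ?g (x / 2) n)"
    by (simp add: norm_mult norm_divide power_int_mult_distrib power_int_divide_distrib norm_power_int
                  power_int_minus field_simps)
  finally show "norm (of_int (\<bar>n\<bar> + c) * (p powi tri n * x powi n)) \<le> C * (?g (2 * x) n + ?g (x / 2) n)"
    by (simp only: norm_mult[of "of_int (\<bar>n\<bar> + c) :: complex"] norm_of_int)
qed


lemma infsum_times:
  fixes f :: "'a \<Rightarrow> complex" and g :: "'b \<Rightarrow> complex"
  assumes f: "(\<lambda>x. norm (f x)) summable_on A" and g: "(\<lambda>y. norm (g y)) summable_on B"
  shows "(\<lambda>(x, y). norm (f x * g y)) summable_on A \<times> B"
    and "infsum (\<lambda>(x, y). f x * g y) (A \<times> B) = infsum f A * infsum g B"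
proof -
  show a: "(\<lambda>(x, y). norm (f x * g y)) summable_on A \<times> B"
  proof (rule summable_on_SigmaI)
    show "((\<lambda>y. case (x, y) of (x, y) \<Rightarrow> norm (f x * g y)) has_sum (norm (f x) * infsum (\<lambda>y. norm (g y)) B)) B" for x
      using has_sum_cmult_right[OF has_sum_infsum[OF g], of "norm (f x)"] by (simp add: norm_mult)
    show "(\<lambda>x. norm (f x) * infsum (\<lambda>y. norm (g y)) B) summable_on A"
      by (intro summable_on_cmult_left f)
  qed auto
  have b: "(\<lambda>(x, y). f x * g y) summable_on A \<times> B"
    by (rule abs_summable_summable) (use a in \<open>simp add: case_prod_unfold\<close>)
  have "infsum (\<lambda>(x, y). f x * g y) (A \<times> B) = infsum (\<lambda>x. infsum (\<lambda>y. f x * g y) B) A"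
    using infsum_Sigma_banach[OF b] by simp
  also have "\<dots> = infsum f A * infsum g B"
    by (simp add: infsum_cmult_right' infsum_cmult_left')
  finally show "infsum (\<lambda>(x, y). f x * g y) (A \<times> B) = infsum f A * infsum g B" .
qed

lemma infsum_int_shift: "(\<Sum>\<^sub>\<infinity>n. f (n + a :: int)) = (\<Sum>\<^sub>\<infinity>n. f n)"
  by (rule infsum_reindex_bij_witness[of _ "\<lambda>n. n - a" "\<lambda>n. n + a"]) auto

lemma infsum_int_reflect: "(\<Sum>\<^sub>\<infinity>n. f (a - n :: int)) = (\<Sum>\<^sub>\<infinity>n. f n)"
  by (rule infsum_reindex_bij_witness[of _ "\<lambda>n. a - n" "\<lambda>n. a - n"]) auto

lemma infsum_int_neg: "(\<Sum>\<^sub>\<infinity>n. f (- n :: int)) = (\<Sum>\<^sub>\<infinity>n. f n)"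
  using infsum_int_reflect[of f 0] by simp

lemma infsum_int_antisym:
  fixes f :: "int \<Rightarrow> complex"
  assumes "\<And>n. f (a - n) = - f n"
  shows "(\<Sum>\<^sub>\<infinity>n. f n) = 0"
proof -
  have "(\<Sum>\<^sub>\<infinity>n. f n) = (\<Sum>\<^sub>\<infinity>n. f (a - n))" by (rule infsum_int_reflect[symmetric])
  also have "\<dots> = - (\<Sum>\<^sub>\<infinity>n. f n)" by (simp add: assms infsum_uminus)
  finally show ?thesis by (simp add: eq_neg_iff_add_eq_0)
qed

lemma summable_on_int_affine:
  fixes f :: "int \<Rightarrow> 'a :: banach"
  assumes "f summable_on UNIV" "k \<noteq> 0"
  shows "(\<lambda>m. f (k * m + i)) summable_on UNIV"
proof -
  have "f summable_on range (\<lambda>m. k * m + i)"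
    by (rule summable_on_subset_banach[OF assms(1)]) auto
  then show ?thesis
    using summable_on_reindex[of "\<lambda>m. k * m + i" UNIV f] assms(2) by (simp add: o_def inj_def)
qed

lemma infsum_int_mod:
  fixes f :: "int \<Rightarrow> 'a :: banach"
  assumes f: "f summable_on UNIV" and k: "k > 0"
  shows "(\<Sum>\<^sub>\<infinity>n. f n) = (\<Sum>i<k. \<Sum>\<^sub>\<infinity>m. f (int k * m + int i))"
proof -
  let ?B = "\<lambda>i. range (\<lambda>m. int k * m + int i)"
  have "(\<Sum>i<k. infsum f (?B i)) = infsum f (\<Union>i<k. ?B i)"
  proof (rule sum_infsum)
    show "f summable_on ?B i" for i by (rule summable_on_subset_banach[OF f]) auto
    fix i j assume ij: "i \<in> {..<k}" "j \<in> {..<k}" "i \<noteq> j"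
    {
      fix a b assume "int k * a + int i = int k * b + int j"
      then have "(int k * a + int i) mod int k = (int k * b + int j) mod int k" by simp
      then have False using ij by simp
    }
    then show "?B i \<inter> ?B j = {}" by blast
  qed auto
  also have "(\<Union>i<k. ?B i) = UNIV"
  proof (intro equalityI subsetI)
    fix n :: int
    have "nat (n mod int k) < k" using k by (simp add: nat_less_iff)
    moreover have "n = int k * (n div int k) + int (nat (n mod int k))" using k by simp
    ultimately show "n \<in> (\<Union>i<k. ?B i)" by blast
  qed auto
  also have "(\<Sum>i<k. infsum f (?B i)) = (\<Sum>i<k. \<Sum>\<^sub>\<infinity>m. f (int k * m + int i))"
    by (intro sum.cong refl, subst infsum_reindex) (use k in \<open>auto simp: inj_def o_def\<close>)
  finally show ?thesis by simp
qed

lemma infsum_convolution: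
  fixes f g :: "int \<Rightarrow> complex"
  assumes f: "(\<lambda>x. norm (f x)) summable_on UNIV" and g: "(\<lambda>y. norm (g y)) summable_on UNIV"
  shows "infsum f UNIV * infsum g UNIV = (\<Sum>\<^sub>\<infinity>m. \<Sum>\<^sub>\<infinity>n. f n * g (m - n))"
proof -
  have s: "(\<lambda>(x, y). f x * g y) summable_on UNIV \<times> UNIV"
    by (rule abs_summable_summable) (use infsum_times(1)[OF f g] in \<open>simp add: case_prod_unfold\<close>)
  have "infsum f UNIV * infsum g UNIV = infsum (\<lambda>(x, y). f x * g y) (UNIV \<times> UNIV)"
    by (rule infsum_times(2)[OF f g, symmetric])
  also have "\<dots> = infsum (\<lambda>(m, n). f n * g (m - n)) (UNIV \<times> UNIV)"
    by (rule infsum_reindex_bij_witness[of _ "\<lambda>(m, n). (n, m - n)" "\<lambda>(x, y). (x + y, x)"]) auto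
  also have "\<dots> = (\<Sum>\<^sub>\<infinity>m. \<Sum>\<^sub>\<infinity>n. f n * g (m - n))"
  proof (subst infsum_Sigma'_banach)
    show "(\<lambda>(m, n). f n * g (m - n)) summable_on UNIV \<times> UNIV"
      using s by (subst summable_on_reindex_bij_witness[of _ "\<lambda>(x, y). (x + y, x)" "\<lambda>(m, n). (n, m - n)" _ "\<lambda>(x, y). f x * g y"]) auto
  qed simp
  finally show ?thesis .
qed

section \<open>Shifted factorials and the Hecke coefficients\<close>

lemma qpoch_0 [simp]: "qpoch x p 0 = 1"
  and qpoch_Suc: "qpoch x p (Suc n) = qpoch x p n * (1 - p ^ n * x)"
  by (simp_all add: qpoch_def)

lemma qpoch_Suc_left: "qpoch x p (Suc n) = (1 - x) * qpoch (p * x) p n"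
  by (induction n) (simp_all add: qpoch_Suc mult_ac)

lemma qpoch_add: "qpoch x p (m + n) = qpoch x p m * qpoch (p ^ m * x) p n"
  by (induction n) (simp_all add: qpoch_Suc power_add mult_ac)

lemma convergent_prod_qpoch:
  fixes p x :: complex
  assumes "norm p < 1"
  shows "convergent_prod (\<lambda>i. 1 - p ^ i * x)"
proof -
  have "summable (\<lambda>i. norm p ^ i * norm x)"
    using assms by (intro summable_mult2 summable_geometric) auto
  then have "abs_convergent_prod (\<lambda>i. 1 - p ^ i * x)"
    unfolding abs_convergent_prod_conv_summable by (simp add: norm_mult norm_power)
  then show ?thesis by (rule abs_convergent_prod_imp_convergent_prod)
qed

lemma qpoch_tendsto:
  assumes "norm p < 1"
  shows "(\<lambda>n. qpoch x p n) \<longlonglongrightarrow> qpoch_inf x p"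
  using convergent_prod_LIMSEQ[OF convergent_prod_qpoch[OF assms, of x]]
  unfolding qpoch_inf_def qpoch_def LIMSEQ_lessThan_iff_atMost .

text \<open>Identities between infinite products are proved for the partial products along a
  subsequence \<open>g\<close> and then passed to the limit.\<close>

lemma qpoch_inf_eqI:
  assumes "norm p < 1" "strict_mono g" "\<And>n. qpoch x p (g n) = f n" "f \<longlonglongrightarrow> L"
  shows "qpoch_inf x p = L"
proof -
  have "(qpoch x p \<circ> g) \<longlonglongrightarrow> qpoch_inf x p"
    by (rule LIMSEQ_subseq_LIMSEQ[OF qpoch_tendsto[OF assms(1)] assms(2)])
  then show ?thesis
    using assms(3,4) LIMSEQ_unique by (force simp: o_def)
qed

lemma qpoch_inf_nonzero:
  assumes "norm p < 1" "\<And>i. p ^ i * x \<noteq> 1"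
  shows "qpoch_inf x p \<noteq> 0"
  unfolding qpoch_inf_def
  by (rule prodinf_nonzero[OF convergent_prod_qpoch[OF assms(1)]]) (use assms(2) in auto)

lemma norm_mult_power_neq_1:
  fixes p x :: complex
  assumes "norm p < 1" "norm x < 1"
  shows "p ^ i * x \<noteq> 1" "1 - p ^ i * x \<noteq> 0"
proof -
  have "norm (p ^ i * x) \<le> 1 * norm x"
    unfolding norm_mult norm_power using assms(1) by (intro mult_right_mono power_le_one) auto
  then show "p ^ i * x \<noteq> 1" "1 - p ^ i * x \<noteq> 0" using assms(2) by auto
qed

lemma qpoch_inf_nonzero':
  assumes "norm p < 1" "norm x < 1"
  shows "qpoch_inf x p \<noteq> 0"
  using qpoch_inf_nonzero[OF assms(1)] norm_mult_power_neq_1[OF assms] by blast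

lemma qpoch_nonzero:
  assumes "norm p < 1" "norm x < 1"
  shows "qpoch x p n \<noteq> 0"
  unfolding qpoch_def using norm_mult_power_neq_1(2)[OF assms] by simp

lemma qpoch_inf_shift:
  assumes "norm p < 1"
  shows "qpoch_inf x p = qpoch x p n * qpoch_inf (p ^ n * x) p"
proof (rule qpoch_inf_eqI[OF assms, of "\<lambda>k. n + k"])
  show "(\<lambda>k. qpoch x p n * qpoch (p ^ n * x) p k) \<longlonglongrightarrow> qpoch x p n * qpoch_inf (p ^ n * x) p"
    by (intro tendsto_intros qpoch_tendsto assms)
qed (auto simp: strict_mono_def qpoch_add)

lemma qpoch_inf_Suc:
  assumes "norm p < 1"
  shows "qpoch_inf x p = (1 - x) * qpoch_inf (p * x) p"
  using qpoch_inf_shift[OF assms, of x 1] by (simp add: qpoch_Suc)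

lemma qpoch_inf_split2:
  assumes "norm p < 1"
  shows "qpoch_inf x p = qpoch_inf x (p^2) * qpoch_inf (p * x) (p^2)"
proof (rule qpoch_inf_eqI[OF assms, of "\<lambda>n. 2 * n"])
  have "norm (p^2) < 1" using assms by (simp add: norm_power power_less_one_iff)
  then show "(\<lambda>n. qpoch x (p^2) n * qpoch (p * x) (p^2) n)
              \<longlonglongrightarrow> qpoch_inf x (p^2) * qpoch_inf (p * x) (p^2)"
    by (intro tendsto_intros qpoch_tendsto)
  show "qpoch x p (2 * n) = qpoch x (p^2) n * qpoch (p * x) (p^2) n" for n
    by (induction n) (simp_all add: qpoch_Suc mult_ac flip: power_mult)
qed (auto simp: strict_mono_def)

lemma qpoch_inf_split3:
  assumes "norm p < 1"
  shows "qpoch_inf x p = qpoch_inf x (p^3) * qpoch_inf (p * x) (p^3) * qpoch_inf (p^2 * x) (p^3)"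
proof (rule qpoch_inf_eqI[OF assms, of "\<lambda>n. 3 * n"])
  have "norm (p^3) < 1" using assms by (simp add: norm_power power_less_one_iff)
  then show "(\<lambda>n. qpoch x (p^3) n * qpoch (p * x) (p^3) n * qpoch (p^2 * x) (p^3) n)
              \<longlonglongrightarrow> qpoch_inf x (p^3) * qpoch_inf (p * x) (p^3) * qpoch_inf (p^2 * x) (p^3)"
    by (intro tendsto_intros qpoch_tendsto)
  show "qpoch x p (3 * n) = qpoch x (p^3) n * qpoch (p * x) (p^3) n * qpoch (p^2 * x) (p^3) n" for n
  proof (induction n)
    case (Suc n)
    have "qpoch x p (3 * Suc n) = qpoch x p (Suc (Suc (Suc (3 * n))))" by (simp add: eval_nat_numeral)
    also have "\<dots> = qpoch x p (3 * n) * (1 - (p^3) ^ n * x) * (1 - (p^3) ^ n * (p * x)) * (1 - (p^3) ^ n * (p^2 * x))"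
      by (simp only: qpoch_Suc) (simp add: power2_eq_square mult_ac flip: power_mult)
    finally show ?case unfolding Suc.IH qpoch_Suc by (simp add: mult_ac)
  qed simp
qed (auto simp: strict_mono_def)

lemma qpoch_square: "qpoch (x^2) (p^2) n = qpoch x p n * qpoch (- x) p n"
proof (induction n)
  case (Suc n)
  have "1 - (p^2) ^ n * x^2 = (1 - p ^ n * x) * (1 + p ^ n * x)"
    by (simp add: algebra_simps power2_eq_square power_mult_distrib)
  with Suc show ?case by (simp add: qpoch_Suc)
qed simp

lemma qpoch_inf_square:
  assumes "norm p < 1"
  shows "qpoch_inf (x^2) (p^2) = qpoch_inf x p * qpoch_inf (- x) p"
proof (rule qpoch_inf_eqI[of _ "\<lambda>n. n"])
  show "norm (p^2) < 1" using assms by (simp add: norm_power power_less_one_iff)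
  show "(\<lambda>n. qpoch x p n * qpoch (- x) p n) \<longlonglongrightarrow> qpoch_inf x p * qpoch_inf (- x) p"
    by (intro tendsto_intros qpoch_tendsto assms)
qed (auto simp: strict_mono_def qpoch_square)

lemma qpoch_bounded:
  assumes "norm p < 1"
  obtains B where "B > 0" "\<And>n. norm (qpoch x p n) \<le> B"
proof -
  have "Bseq (qpoch x p)" by (rule convergent_imp_Bseq[OF convergentI[OF qpoch_tendsto[OF assms]]])
  then show ?thesis using that unfolding Bseq_def by metis
qed

lemma inverse_qpoch_bounded:
  assumes "norm p < 1" "\<And>i. p ^ i * x \<noteq> 1"
  obtains B where "B > 0" "\<And>n. norm (1 / qpoch x p n) \<le> B"
proof -
  have "(\<lambda>n. 1 / qpoch x p n) \<longlonglongrightarrow> 1 / qpoch_inf x p"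
    by (intro tendsto_intros qpoch_tendsto qpoch_inf_nonzero assms)
  then have "Bseq (\<lambda>n. 1 / qpoch x p n)" by (intro convergent_imp_Bseq convergentI)
  then show ?thesis using that unfolding Bseq_def by metis
qed

text \<open>The value 0 at negative integers gives bilateral sums their finite support, and the
  recursion \<open>inv_qfact_rec\<close> holds at every integer, including 0 where the factor 1 -
  q^0 vanishes.\<close>

definition inv_qfact :: "complex \<Rightarrow> int \<Rightarrow> complex" where
  "inv_qfact q n = (if n < 0 then 0 else 1 / qpoch q q (nat n))"

lemma inv_qfact_0 [simp]: "inv_qfact q 0 = 1" and inv_qfact_neg: "i < 0 \<Longrightarrow> inv_qfact q i = 0"
  and inv_qfact_of_nat: "inv_qfact q (int n) = 1 / qpoch q q n"
  by (auto simp: inv_qfact_def)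

lemma inv_qfact_rec:
  assumes "norm q < 1"
  shows "(1 - q powi n) * inv_qfact q n = inv_qfact q (n - 1)"
proof -
  consider "n < 0" | "n = 0" | m where "n = int (Suc m)"
    by (cases n rule: int_cases3) (auto simp: gr0_conv_Suc)
  then show ?thesis
  proof cases
    case 3
    then have "inv_qfact q n = 1 / qpoch q q (Suc m)" "inv_qfact q (n - 1) = 1 / qpoch q q m" "q powi n = q ^ Suc m"
      using inv_qfact_of_nat[of q "Suc m"] inv_qfact_of_nat[of q m] power_int_of_nat[of q "Suc m"] by simp_all
    then show ?thesis using qpoch_nonzero[OF assms assms, of "Suc m"]
      by (simp add: qpoch_Suc mult.commute)
  qed (auto simp: inv_qfact_neg)
qed

lemma inv_qfact_bounded:
  assumes "norm q < 1"
  obtains B where "B > 0" "\<And>n. norm (inv_qfact q n) \<le> B"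
proof -
  obtain B where B: "B > 0" "\<And>n. norm (1 / qpoch q q n) \<le> B"
    using inverse_qpoch_bounded[OF assms norm_mult_power_neq_1(1)[OF assms assms]] by metis
  then have "norm (inv_qfact q n) \<le> B" for n
    by (simp add: inv_qfact_def)
  with B(1) show ?thesis using that by blast
qed

lemma inv_qfact_tendsto:
  assumes "norm q < 1"
  shows "(\<lambda>m. inv_qfact q (int m + a)) \<longlonglongrightarrow> 1 / qpoch_inf q q"
proof -
  \<comment> \<open>Starting at |a| keeps the argument nonnegative, where \<open>inv_qfact\<close>
    is a genuine reciprocal.\<close>
  have "(\<lambda>m. inv_qfact q (int (m + nat \<bar>a\<bar>) + a)) \<longlonglongrightarrow> 1 / qpoch_inf q q"
  proof -
    have "(\<lambda>m. 1 / qpoch q q (m + nat (\<bar>a\<bar> + a))) \<longlonglongrightarrow> 1 / qpoch_inf q q"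
      by (intro tendsto_intros LIMSEQ_ignore_initial_segment[OF qpoch_tendsto[OF assms]]
                qpoch_inf_nonzero'[OF assms assms])
    moreover have "inv_qfact q (int (m + nat \<bar>a\<bar>) + a) = 1 / qpoch q q (m + nat (\<bar>a\<bar> + a))" for m
    proof -
      have "int (m + nat \<bar>a\<bar>) + a = int (m + nat (\<bar>a\<bar> + a))" by auto
      then show ?thesis by (simp only: inv_qfact_of_nat)
    qed
    ultimately show ?thesis by simp
  qed
  then show ?thesis by (rule LIMSEQ_offset)
qed

text \<open>The coefficient of \<open>z ^ N\<close> in \<open>\<Sum> sg(r) q ^ (r s) z ^ (r + s)\<close>, summed over all pairs of integers \<open>r, s\<close>
  that are both nonnegative or both negative, with \<open>sg(r) = 1\<close> or \<open>- 1\<close> accordingly.\<close>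

definition hecke_coeff :: "complex \<Rightarrow> int \<Rightarrow> complex" where
  "hecke_coeff q N = (if N \<ge> 0 then (\<Sum>r\<le>nat N. q ^ (r * (nat N - r)))
             else - (\<Sum>r\<in>{1..<nat (- N)}. q ^ (r * (nat (- N) - r))))"

lemma hecke_coeff_0 [simp]: "hecke_coeff q 0 = 1" and hecke_coeff_1 [simp]: "hecke_coeff q 1 = 2"
  by (simp_all add: hecke_coeff_def)

lemma hecke_coeff_pos: "n > 0 \<Longrightarrow> hecke_coeff q (int n) = 2 + (\<Sum>r\<in>{1..<n}. q ^ (r * (n - r)))"
proof -
  assume "n > 0"
  then have "{..n} = insert 0 (insert n {1..<n})" by auto
  with \<open>n > 0\<close> show ?thesis by (simp add: hecke_coeff_def)
qed

text \<open>The end terms r = 0 and r = n, each equal to 1, occur only for positive index; they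
  account for the 2.\<close>

lemma hecke_coeff_reflect_nat: "hecke_coeff q (- int n) = 2 - hecke_coeff q (int n)"
  using hecke_coeff_pos[of n q] by (cases "n = 0") (auto simp: hecke_coeff_def[of q "- int n"])

lemma hecke_coeff_reflect: "hecke_coeff q (- N) = 2 - hecke_coeff q N"
  using hecke_coeff_reflect_nat[of q "nat \<bar>N\<bar>"] by (cases "N \<ge> 0") auto

text \<open>For r + s = N we have (r + 1)(s + 1) = r s + N + 1. Hence the interior terms at N + 2
  are those at N times q^(N + 1), and the two end terms add 2. Reflection maps N to -N - 2, which
  settles N <= -2; its fixed point -1 is checked directly.\<close>

lemma hecke_coeff_rec:
  assumes "q \<noteq> 0"
  shows "hecke_coeff q (N + 2) = q powi (N + 1) * hecke_coeff q N + 2"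
proof -
  have nat_case: "hecke_coeff q (int n + 2) = q powi (int n + 1) * hecke_coeff q (int n) + 2" for n
  proof -
    have "(\<Sum>r\<in>{1..<n+2}. q ^ (r * (n + 2 - r))) = (\<Sum>r\<le>n. q ^ ((r + 1) * (n + 1 - r)))"
      by (rule sum.reindex_bij_witness[of _ "\<lambda>r. r + 1" "\<lambda>r. r - 1"]) auto
    also have "\<dots> = (\<Sum>r\<le>n. q ^ (n + 1) * q ^ (r * (n - r)))"
    proof (rule sum.cong)
      fix r assume "r \<in> {..n}"
      then obtain s where "n = r + s" using le_Suc_ex by auto
      then show "q ^ ((r + 1) * (n + 1 - r)) = q ^ (n + 1) * q ^ (r * (n - r))"
        by (simp add: algebra_simps flip: power_add)
    qed simp
    finally have "hecke_coeff q (int (n + 2)) = 2 + q ^ (n + 1) * (\<Sum>r\<le>n. q ^ (r * (n - r)))"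
      by (subst hecke_coeff_pos) (simp_all add: sum_distrib_left)
    moreover have "hecke_coeff q (int n) = (\<Sum>r\<le>n. q ^ (r * (n - r)))" by (simp add: hecke_coeff_def)
    moreover have "q powi (int n + 1) = q ^ (n + 1)"
      using power_int_of_nat[of q "n + 1"] by (simp add: add.commute)
    ultimately show ?thesis by (simp add: add.commute)
  qed
  consider n where "N = int n" | "N = -1" | n where "N = - int n - 2"
  proof -
    have "N \<ge> 0 \<or> N = -1 \<or> N \<le> -2" by linarith
    moreover have "N = - int (nat (- N - 2)) - 2" if "N \<le> -2" using that by simp
    ultimately show ?thesis using that by (metis nonneg_int_cases)
  qed
  then show ?thesis
  proof cases
    case 3
    have "hecke_coeff q (N + 2) = 2 - hecke_coeff q (int n)" using hecke_coeff_reflect[of q "int n"] 3 by simp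
    moreover have "hecke_coeff q N = 2 - hecke_coeff q (int n + 2)"
      using hecke_coeff_reflect[of q "int n + 2"] 3 by simp
    moreover have "q powi (N + 1) * q powi (int n + 1) = 1"
      using assms 3 by (simp flip: power_int_add)
    ultimately show ?thesis unfolding nat_case by (simp add: algebra_simps)
  qed (use nat_case hecke_coeff_reflect[of q 1] in auto)
qed

lemma norm_hecke_coeff_le:
  assumes "norm q \<le> 1"
  shows "norm (hecke_coeff q N) \<le> of_int (\<bar>N\<bar> + 2)"
proof -
  have *: "norm (\<Sum>r\<in>A. q ^ g r) \<le> real (card A)" for A :: "nat set" and g
    using sum_norm_le[of A "\<lambda>r. q ^ g r" "\<lambda>_. 1"] assms by (simp add: norm_power power_le_one)
  show ?thesis
    using *[of "\<lambda>r. r * (nat N - r)" "{..nat N}"] *[of "\<lambda>r. r * (nat (-N) - r)" "{1..<nat (-N)}"]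
    by (auto simp: hecke_coeff_def)
qed

lemma summable_theta_hecke_coeff:
  fixes p x :: complex
  assumes "p \<noteq> 0" "norm p < 1" "x \<noteq> 0" "norm q \<le> 1"
  shows "(\<lambda>n. norm (p powi tri n * x powi n * hecke_coeff q (n + a))) summable_on UNIV"
proof (rule Infinite_Sum.abs_summable_on_comparison_test[OF abs_summable_theta_lin[OF assms(1-3), of "\<bar>a\<bar> + 2"]])
  fix n
  have "norm (hecke_coeff q (n + a)) \<le> of_int (\<bar>n + a\<bar> + 2)" by (rule norm_hecke_coeff_le[OF assms(4)])
  also have "\<dots> \<le> real_of_int \<bar>\<bar>n\<bar> + (\<bar>a\<bar> + 2)\<bar>" by linarith
  finally have "norm (hecke_coeff q (n + a)) * norm (p powi tri n * x powi n)
      \<le> real_of_int \<bar>\<bar>n\<bar> + (\<bar>a\<bar> + 2)\<bar> * norm (p powi tri n * x powi n)"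
    by (intro mult_right_mono) auto
  then show "norm (p powi tri n * x powi n * hecke_coeff q (n + a))
     \<le> norm (of_int (\<bar>n\<bar> + (\<bar>a\<bar> + 2)) * (p powi tri n * x powi n))"
    by (simp only: norm_mult norm_of_int of_int_abs mult_ac)
qed

section \<open>Finite theta functions\<close>

lemma summable_on_minus:
  fixes f g :: "'a \<Rightarrow> complex"
  assumes "f summable_on A" "g summable_on A"
  shows "(\<lambda>x. f x - g x) summable_on A"
  using summable_on_add[OF assms(1), of "\<lambda>x. - g x"] assms(2) by (simp add: summable_on_uminus)

lemma infsum_minus:
  fixes f g :: "'a \<Rightarrow> complex"
  assumes "f summable_on A" "g summable_on A"
  shows "(\<Sum>\<^sub>\<infinity>x\<in>A. f x - g x) = infsum f A - infsum g A"
  using infsum_add[OF assms(1), of "\<lambda>x. - g x"] assms(2) by (simp add: summable_on_uminus infsum_uminus)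

lemma infsum_nat_eq_suminf:
  fixes f :: "nat \<Rightarrow> 'a :: banach"
  assumes "summable (\<lambda>n. norm (f n))"
  shows "infsum f UNIV = suminf f"
  using norm_summable_imp_has_sum[OF assms summable_sums[OF summable_norm_cancel[OF assms]]] by (rule infsumI)

text \<open>Tannery's theorem, transported from the natural numbers by
  \<open>int_decode\<close>.\<close>

lemma tendsto_infsum_int:
  fixes f :: "nat \<Rightarrow> int \<Rightarrow> complex"
  assumes lim: "\<And>k. (\<lambda>n. f n k) \<longlonglongrightarrow> g k"
    and bound: "\<And>n k. norm (f n k) \<le> h k" and h: "h summable_on UNIV"
  shows "(\<lambda>n. \<Sum>\<^sub>\<infinity>k. f n k) \<longlonglongrightarrow> (\<Sum>\<^sub>\<infinity>k. g k)"
proof -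
  let ?d = int_decode
  have re: "infsum F UNIV = infsum (\<lambda>k. F (?d k)) UNIV" for F :: "int \<Rightarrow> complex"
    by (rule infsum_reindex_bij_betw[OF bij_int_decode, symmetric])
  have "(\<lambda>k. h (?d k)) summable_on UNIV"
    using h by (simp add: summable_on_reindex_bij_betw[OF bij_int_decode])
  then have M: "summable (\<lambda>k. h (?d k))" by (rule summable_on_imp_summable)
  have sf: "summable (\<lambda>k. norm (f n (?d k)))" for n
    by (rule summable_comparison_test'[OF M]) (simp add: bound)
  have bg: "norm (g k) \<le> h k" for k
    by (rule tendsto_upperbound[OF tendsto_norm[OF lim]]) (auto simp: bound)
  have sg: "summable (\<lambda>k. norm (g (?d k)))"
    by (rule summable_comparison_test'[OF M]) (simp add: bg)
  have "(\<lambda>n. \<Sum>k. f n (?d k)) \<longlonglongrightarrow> (\<Sum>k. g (?d k))"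
    using tannerys_theorem[of "\<lambda>k n. f n (?d k)" "\<lambda>k. g (?d k)" sequentially "\<lambda>k. h (?d k)"] lim bound M
    by (auto simp: case_prod_unfold)
  then show ?thesis
    by (simp add: re infsum_nat_eq_suminf[OF sf] infsum_nat_eq_suminf[OF sg])
qed

text \<open>The Bailey kernel relative to q with a theta term attached. Its support is -m - 1 <= N
  <= m, and as m grows it tends to a theta term divided by (q;q)_inf^2.\<close>

definition fin_theta_odd :: "complex \<Rightarrow> nat \<Rightarrow> int \<Rightarrow> complex" where
  "fin_theta_odd q m N = alt_sign N * q powi tri (N + 1) * inv_qfact q (int m - N) * inv_qfact q (int m + N + 1)"

lemma fin_theta_odd_reflect: "fin_theta_odd q m (-1 - N) = - fin_theta_odd q m N"
proof -
  have e: "tri (- 1 - N + 1) = tri (N + 1)" "alt_sign (- 1 - N) = - alt_sign N"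
    "int m - (-1 - N) = int m + N + 1" "int m + (-1 - N) + 1 = int m - N"
    using tri_minus[of N] alt_sign_diff[of "-1" N] by (simp_all add: tri_Suc)
  show ?thesis unfolding fin_theta_odd_def e by (simp add: mult_ac)
qed

context
  fixes q :: complex
  assumes q0: "q \<noteq> 0" and q1: "norm q < 1"
begin

lemma one_minus_power_nonzero: "n > 0 \<Longrightarrow> 1 - q ^ n \<noteq> 0"
  using norm_mult_power_neq_1(2)[OF q1 q1, of "n - 1"] by (cases n) (simp_all add: mult.commute)

text \<open>With the common factor \<open>X\<close> extracted, the recurrences below become rational
  identities in q^m and q^N.\<close>

lemma fin_theta_odd_factor:
  defines "X m N \<equiv> alt_sign N * q powi tri (N + 1) * inv_qfact q (int m + 1 - N) * inv_qfact q (int m + N + 2)"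
  shows "fin_theta_odd q m N = X m N * ((1 - q powi (int m + 1 - N)) * (1 - q powi (int m + N + 2)))"
    and "fin_theta_odd q m (N - 1) = - X m N * q powi (- N) * ((1 - q powi (int m + N + 1)) * (1 - q powi (int m + N + 2)))"
    and "fin_theta_odd q m (N + 1) = - X m N * q powi (N + 1) * ((1 - q powi (int m - N)) * (1 - q powi (int m + 1 - N)))"
    and "fin_theta_odd q (Suc m) N = X m N"
proof -
  have a: "inv_qfact q (int m - N) = (1 - q powi (int m + 1 - N)) * inv_qfact q (int m + 1 - N)"
    and b: "inv_qfact q (int m + N + 1) = (1 - q powi (int m + N + 2)) * inv_qfact q (int m + N + 2)"
    and c: "inv_qfact q (int m + N) = (1 - q powi (int m + N + 1)) * inv_qfact q (int m + N + 1)"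
    and d: "inv_qfact q (int m - N - 1) = (1 - q powi (int m - N)) * inv_qfact q (int m - N)"
    using inv_qfact_rec[OF q1, of "int m + 1 - N"] inv_qfact_rec[OF q1, of "int m + N + 2"]
      inv_qfact_rec[OF q1, of "int m + N + 1"] inv_qfact_rec[OF q1, of "int m - N"] by (simp_all add: algebra_simps)
  show "fin_theta_odd q m N = X m N * ((1 - q powi (int m + 1 - N)) * (1 - q powi (int m + N + 2)))"
    unfolding fin_theta_odd_def X_def a b by (simp add: mult_ac)
  have t: "q powi tri N = q powi tri (N + 1) * q powi (- N)"
    using q0 by (simp add: tri_Suc flip: power_int_add)
  have "fin_theta_odd q m (N - 1) = - alt_sign N * q powi tri N * inv_qfact q (int m + 1 - N) * inv_qfact q (int m + N)"
    unfolding fin_theta_odd_def by (simp add: alt_sign_diff algebra_simps)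
  then show "fin_theta_odd q m (N - 1) = - X m N * q powi (- N) * ((1 - q powi (int m + N + 1)) * (1 - q powi (int m + N + 2)))"
    unfolding X_def t c b by (simp add: mult_ac)
  have t: "q powi tri (N + 2) = q powi tri (N + 1) * q powi (N + 1)"
    using q0 tri_add[of N 2] tri_add[of N 1] by (simp add: algebra_simps flip: power_int_add)
  have "fin_theta_odd q m (N + 1) = - alt_sign N * q powi tri (N + 2) * inv_qfact q (int m - N - 1) * inv_qfact q (int m + N + 2)"
    unfolding fin_theta_odd_def by (simp add: alt_sign_add algebra_simps)
  then show "fin_theta_odd q m (N + 1) = - X m N * q powi (N + 1) * ((1 - q powi (int m - N)) * (1 - q powi (int m + 1 - N)))"
    unfolding X_def t d a by (simp add: mult_ac)
  show "fin_theta_odd q (Suc m) N = X m N"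
    unfolding fin_theta_odd_def X_def by (simp add: algebra_simps)
qed

text \<open>This recurrence in m drives two inductions: paired with z^N it yields the finite triple
  product, paired with Hecke coefficients the value of \<open>hecke_pairing\<close>.\<close>

lemma fin_theta_odd_rec:
  "(1 - q ^ (2 * m + 2)) * (1 - q ^ (2 * m + 3)) * fin_theta_odd q (Suc m) N
     = (1 + q ^ (2 * m + 2)) * fin_theta_odd q m N - q ^ (m + 1) * (fin_theta_odd q m (N - 1) + fin_theta_odd q m (N + 1))"
proof -
  define A where "A = q ^ m"
  define B where "B = q powi N"
  have B: "B \<noteq> 0" using q0 by (simp add: B_def)
  have e: "q powi (int m + 1 - N) = A * q / B" "q powi (int m + N + 2) = A * B * q^2"
       "q powi (int m + N + 1) = A * B * q" "q powi (int m - N) = A / B"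
       "q powi (N + 1) = B * q" "q powi (- N) = 1 / B"
       "q ^ (2 * m + 2) = A^2 * q^2" "q ^ (2 * m + 3) = A^2 * q^3" "q ^ (m + 1) = A * q"
    using q0 unfolding A_def B_def
    by (simp_all add: power_int_add power_int_diff power_int_minus field_simps power_add power2_eq_square power3_eq_cube power_mult)
  show ?thesis unfolding fin_theta_odd_factor[of m N] e using B
    by (simp add: field_simps power2_eq_square power3_eq_cube)
qed

text \<open>Trades the factor q^(N + 1), which the recurrence of the Hecke coefficients produces,
  for shifts of N.\<close>

lemma fin_theta_odd_shift:
  "q powi (N + 1) * fin_theta_odd q m N
     = q ^ (m + 1) * fin_theta_odd q m N - fin_theta_odd q m (N + 1) + q ^ (m + 1) * (q powi (N + 1) * fin_theta_odd q m (N + 1))"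
proof -
  define A where "A = q ^ m"
  define B where "B = q powi N"
  have B: "B \<noteq> 0" using q0 by (simp add: B_def)
  have e: "q powi (int m + 1 - N) = A * q / B" "q powi (int m + N + 2) = A * B * q^2"
       "q powi (int m - N) = A / B" "q powi (N + 1) = B * q" "q ^ (m + 1) = A * q"
    using q0 unfolding A_def B_def
    by (simp_all add: power_int_add power_int_diff power_int_minus field_simps power_add power2_eq_square power3_eq_cube power_mult)
  show ?thesis unfolding fin_theta_odd_factor[of m N] e using B
    by (simp add: field_simps power2_eq_square power3_eq_cube)
qed

text \<open>Uniformity in \<open>a\<close> and \<open>b\<close> makes one majorant serve for all m
  and for both the odd and the even kernel.\<close>

lemma bailey_kernel_bounded:
  obtains C where "C > 0"
    "\<And>N a b. norm (alt_sign N * q powi tri (N + 1) * (inv_qfact q a * inv_qfact q b)) \<le> C * norm (q powi tri N * q powi N)"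
proof -
  obtain B where B: "B > 0" "\<And>n. norm (inv_qfact q n) \<le> B" using inv_qfact_bounded[OF q1] by blast
  show ?thesis
  proof (rule that[of "B * B"])
    fix N a b
    have "norm (alt_sign N * q powi tri (N + 1) * (inv_qfact q a * inv_qfact q b)) = norm (q powi tri N * q powi N) * (norm (inv_qfact q a) * norm (inv_qfact q b))"
      using q0 by (simp add: norm_mult tri_Suc power_int_add)
    also have "\<dots> \<le> norm (q powi tri N * q powi N) * (B * B)"
      using B by (intro mult_left_mono mult_mono) (auto simp: less_imp_le)
    finally show "norm (alt_sign N * q powi tri (N + 1) * (inv_qfact q a * inv_qfact q b)) \<le> B * B * norm (q powi tri N * q powi N)"
      by (simp add: mult_ac)
  qed (use B in auto)
qed

lemma fin_theta_odd_bounded: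
  obtains C where "C > 0" "\<And>m N. norm (fin_theta_odd q m N) \<le> C * norm (q powi tri N * q powi N)"
  using bailey_kernel_bounded unfolding fin_theta_odd_def mult.assoc by metis

lemma fin_theta_odd_tendsto:
  "(\<lambda>m. fin_theta_odd q m N) \<longlonglongrightarrow> alt_sign N * q powi tri (N + 1) / (qpoch_inf q q)^2"
proof -
  have "(\<lambda>m. alt_sign N * q powi tri (N + 1) * inv_qfact q (int m + (- N)) * inv_qfact q (int m + (N + 1)))
     \<longlonglongrightarrow> alt_sign N * q powi tri (N + 1) * (1 / qpoch_inf q q) * (1 / qpoch_inf q q)"
    by (intro tendsto_intros inv_qfact_tendsto q1)
  then show ?thesis by (simp add: fin_theta_odd_def power2_eq_square add_ac)
qed

lemma fin_theta_odd_dominated: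
  assumes "(\<lambda>N. norm (q powi tri N * (q * x) powi N * g N)) summable_on UNIV"
  obtains h where "h summable_on UNIV" "\<And>m N. norm (fin_theta_odd q m N * x powi N * g N) \<le> h N"
proof -
  obtain C where C: "C > 0" "\<And>m N. norm (fin_theta_odd q m N) \<le> C * norm (q powi tri N * q powi N)"
    using fin_theta_odd_bounded by blast
  show ?thesis
  proof (rule that[OF summable_on_cmult_right[OF assms, of C]])
    fix m N
    have "norm (fin_theta_odd q m N) * norm (x powi N * g N) \<le> C * norm (q powi tri N * q powi N) * norm (x powi N * g N)"
      by (intro mult_right_mono C) auto
    then show "norm (fin_theta_odd q m N * x powi N * g N) \<le> C * norm (q powi tri N * (q * x) powi N * g N)"
      by (simp add: norm_mult power_int_mult_distrib mult_ac)
  qed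
qed

lemma fin_theta_odd_weighted_summable:
  assumes "(\<lambda>N. norm (q powi tri N * (q * x) powi N * g N)) summable_on UNIV"
  shows "(\<lambda>N. fin_theta_odd q m N * x powi N * g N) summable_on UNIV"
proof (rule abs_summable_summable)
  obtain h where "h summable_on UNIV" "\<And>m N. norm (fin_theta_odd q m N * x powi N * g N) \<le> h N"
    using fin_theta_odd_dominated[OF assms] by blast
  then show "(\<lambda>N. norm (fin_theta_odd q m N * x powi N * g N)) summable_on UNIV"
    by (intro Infinite_Sum.abs_summable_on_comparison_test'[of h]) auto
qed

lemma fin_theta_odd_hecke_coeff_summable: "x \<noteq> 0 \<Longrightarrow> (\<lambda>N. fin_theta_odd q m N * x powi N * hecke_coeff q (N + a)) summable_on UNIV"
  using q0 q1 by (intro fin_theta_odd_weighted_summable summable_theta_hecke_coeff) auto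

lemma fin_theta_odd_summable: "x \<noteq> 0 \<Longrightarrow> (\<lambda>N. fin_theta_odd q m N * x powi N) summable_on UNIV"
  using fin_theta_odd_weighted_summable[of x "\<lambda>_. 1" m] abs_summable_theta[OF q0 q1, of "q * x"] q0 by simp

definition hecke_pairing :: "nat \<Rightarrow> int \<Rightarrow> complex" where
  "hecke_pairing m a = (\<Sum>\<^sub>\<infinity>N. fin_theta_odd q m N * hecke_coeff q (N + a))"

lemma hecke_pairing_summable: "(\<lambda>N. fin_theta_odd q m N * hecke_coeff q (N + a)) summable_on UNIV"
  using fin_theta_odd_hecke_coeff_summable[of 1 m a] by simp

lemma infsum_fin_theta_odd: "(\<Sum>\<^sub>\<infinity>N. fin_theta_odd q m N) = 0"
  by (rule infsum_int_antisym[of _ "-1"]) (rule fin_theta_odd_reflect)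

lemma fin_theta_odd_summable1: "(\<lambda>N. fin_theta_odd q m N) summable_on UNIV"
  using fin_theta_odd_summable[of 1 m] by simp

text \<open>The map N -> -1 - N changes the sign of the kernel and turns a Hecke coefficient k into
  2 - k; the constant 2 pairs to zero by antisymmetry.\<close>

lemma hecke_pairing_reflect: "hecke_pairing m a = hecke_pairing m (1 - a)"
proof -
  have "hecke_pairing m a = (\<Sum>\<^sub>\<infinity>N. fin_theta_odd q m (-1 - N) * hecke_coeff q ((-1 - N) + a))"
    unfolding hecke_pairing_def by (rule infsum_int_reflect[symmetric])
  also have "\<dots> = (\<Sum>\<^sub>\<infinity>N. fin_theta_odd q m N * hecke_coeff q (N + (1 - a)) - 2 * fin_theta_odd q m N)"
  proof (rule infsum_cong)
    fix N :: int
    have "(-1 - N) + a = - (N + (1 - a))" by simp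
    then have k: "hecke_coeff q ((-1 - N) + a) = 2 - hecke_coeff q (N + (1 - a))"
      by (simp only: hecke_coeff_reflect)
    show "fin_theta_odd q m (-1 - N) * hecke_coeff q ((-1 - N) + a) = fin_theta_odd q m N * hecke_coeff q (N + (1 - a)) - 2 * fin_theta_odd q m N"
      unfolding fin_theta_odd_reflect k by (simp only: ring_distribs mult_minus_left mult_ac) simp
  qed
  also have "\<dots> = hecke_pairing m (1 - a) - 2 * (\<Sum>\<^sub>\<infinity>N. fin_theta_odd q m N)"
    unfolding hecke_pairing_def
    by (subst infsum_minus) (auto intro!: hecke_pairing_summable summable_on_cmult_right fin_theta_odd_summable1 simp: infsum_cmult_right')
  finally show ?thesis by (simp add: infsum_fin_theta_odd)
qed

text \<open>Write H(a) for \<open>hecke_pairing m a\<close>. The recurrence,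
  \<open>fin_theta_odd_shift\<close> and the recurrence once more, read backwards, give H(2) =
  q^(m+1) H(0) - H(-1) + q^(m+1) H(1). Reflection identifies H(-1) with H(2) and H(1) with H(0), so
  2 H(2) = 2 q^(m+1) H(0).\<close>

lemma hecke_pairing_2: "hecke_pairing m 2 = q ^ (m + 1) * hecke_pairing m 0"
proof -
  have s1: "(\<lambda>N. fin_theta_odd q m (N + 1) * hecke_coeff q N) summable_on UNIV"
    using summable_on_int_affine[OF hecke_pairing_summable[of m "-1"], of 1 1] by simp
  have k: "q powi N * hecke_coeff q (N - 1) = hecke_coeff q (N + 1) - 2" for N
    using hecke_coeff_rec[OF q0, of "N - 1"] by (simp add: add.commute)
  have s2: "(\<lambda>N. q powi N * fin_theta_odd q m N * hecke_coeff q (N - 1)) summable_on UNIV"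
    using fin_theta_odd_hecke_coeff_summable[OF q0, of m "-1"] by (simp add: mult_ac)
  then have s3: "(\<lambda>N. q powi (N + 1) * fin_theta_odd q m (N + 1) * hecke_coeff q N) summable_on UNIV"
    using summable_on_int_affine[OF s2, of 1 1] by simp
  have "hecke_pairing m 2 = (\<Sum>\<^sub>\<infinity>N. (q powi (N + 1) * fin_theta_odd q m N) * hecke_coeff q N + 2 * fin_theta_odd q m N)"
    unfolding hecke_pairing_def by (rule infsum_cong) (simp add: hecke_coeff_rec[OF q0] algebra_simps)
  also have "\<dots> = (\<Sum>\<^sub>\<infinity>N. q ^ (m + 1) * (fin_theta_odd q m N * hecke_coeff q (N + 0)) - fin_theta_odd q m (N + 1) * hecke_coeff q N
                 + q ^ (m + 1) * (q powi (N + 1) * fin_theta_odd q m (N + 1) * hecke_coeff q N) + 2 * fin_theta_odd q m N)"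
    unfolding fin_theta_odd_shift by (rule infsum_cong) (simp add: algebra_simps)
  also have "\<dots> = q ^ (m + 1) * hecke_pairing m 0 - (\<Sum>\<^sub>\<infinity>N. fin_theta_odd q m (N + 1) * hecke_coeff q N)
                 + q ^ (m + 1) * (\<Sum>\<^sub>\<infinity>N. q powi (N + 1) * fin_theta_odd q m (N + 1) * hecke_coeff q N) + 2 * (\<Sum>\<^sub>\<infinity>N. fin_theta_odd q m N)"
    unfolding hecke_pairing_def
    by (subst infsum_add infsum_minus;
        (intro summable_on_add summable_on_minus summable_on_cmult_right s1 s3 fin_theta_odd_summable1 hecke_pairing_summable)?)+
       (simp only: infsum_cmult_right')
  also have "(\<Sum>\<^sub>\<infinity>N. fin_theta_odd q m (N + 1) * hecke_coeff q N) = hecke_pairing m (- 1)"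
    unfolding hecke_pairing_def using infsum_int_shift[of "\<lambda>N. fin_theta_odd q m N * hecke_coeff q (N - 1)" 1] by simp
  also have "(\<Sum>\<^sub>\<infinity>N. q powi (N + 1) * fin_theta_odd q m (N + 1) * hecke_coeff q N) = (\<Sum>\<^sub>\<infinity>N. q powi N * fin_theta_odd q m N * hecke_coeff q (N - 1))"
    using infsum_int_shift[of "\<lambda>N. q powi N * fin_theta_odd q m N * hecke_coeff q (N - 1)" 1] by simp
  also have "\<dots> = (\<Sum>\<^sub>\<infinity>N. fin_theta_odd q m N * hecke_coeff q (N + 1) - 2 * fin_theta_odd q m N)"
  proof (rule infsum_cong)
    fix N
    have "q powi N * fin_theta_odd q m N * hecke_coeff q (N - 1) = fin_theta_odd q m N * (q powi N * hecke_coeff q (N - 1))" by (simp only: mult_ac)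
    then show "q powi N * fin_theta_odd q m N * hecke_coeff q (N - 1) = fin_theta_odd q m N * hecke_coeff q (N + 1) - 2 * fin_theta_odd q m N"
      unfolding k by (simp add: algebra_simps)
  qed
  also have "\<dots> = hecke_pairing m 1 - 2 * (\<Sum>\<^sub>\<infinity>N. fin_theta_odd q m N)"
    unfolding hecke_pairing_def
    by (subst infsum_minus) (auto intro!: hecke_pairing_summable summable_on_cmult_right fin_theta_odd_summable1 simp: infsum_cmult_right')
  finally have "hecke_pairing m 2 = q ^ (m + 1) * hecke_pairing m 0 - hecke_pairing m (- 1) + q ^ (m + 1) * hecke_pairing m 1"
    by (simp add: infsum_fin_theta_odd)
  then show ?thesis using hecke_pairing_reflect[of m 2] hecke_pairing_reflect[of m 1] by simp
qed

lemma infsum_fin_theta_odd_0: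
  fixes g :: "int \<Rightarrow> complex"
  shows "(\<Sum>\<^sub>\<infinity>N. fin_theta_odd q 0 N * g N) = (g 0 - g (-1)) / (1 - q)"
proof -
  have "fin_theta_odd q 0 N = 0" if "N \<noteq> 0" "N \<noteq> -1" for N
    using that by (cases "N > 0") (auto simp: fin_theta_odd_def inv_qfact_neg)
  then have "(\<Sum>\<^sub>\<infinity>N. fin_theta_odd q 0 N * g N) = infsum (\<lambda>N. fin_theta_odd q 0 N * g N) {0, -1}"
    by (intro infsum_cong_neutral) auto
  also have "\<dots> = (g 0 - g (-1)) / (1 - q)"
    using inv_qfact_of_nat[of q 1] alt_sign_minus[of 1] by (simp add: fin_theta_odd_def qpoch_Suc diff_divide_distrib del: alt_sign_minus)
  finally show ?thesis .
qed

text \<open>The recurrence in m brings in the pairings at 1 and -1, both of which are multiples of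
  the pairing at 0, so the induction closes on that one value.\<close>

lemma hecke_pairing_0: "hecke_pairing m 0 = qpoch q q m / qpoch q q (2 * m + 1)"
proof (induction m)
  case 0
  show ?case using infsum_fin_theta_odd_0[of "hecke_coeff q"] hecke_coeff_reflect[of q 1] by (simp add: hecke_pairing_def qpoch_Suc)
next
  case (Suc m)
  have nz: "1 - q ^ (2 * m + 2) \<noteq> 0" "1 - q ^ (2 * m + 3) \<noteq> 0"
    by (rule one_minus_power_nonzero; simp)+
  have s1: "(\<lambda>N. fin_theta_odd q m (N + 1) * hecke_coeff q N) summable_on UNIV"
    using summable_on_int_affine[OF hecke_pairing_summable[of m "-1"], of 1 1] by simp
  have s2: "(\<lambda>N. fin_theta_odd q m (N - 1) * hecke_coeff q N) summable_on UNIV"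
    using summable_on_int_affine[OF hecke_pairing_summable[of m 1], of 1 "-1"] by simp
  have "(1 - q ^ (2 * m + 2)) * (1 - q ^ (2 * m + 3)) * hecke_pairing (Suc m) 0
      = (\<Sum>\<^sub>\<infinity>N. ((1 - q ^ (2 * m + 2)) * (1 - q ^ (2 * m + 3)) * fin_theta_odd q (Suc m) N) * hecke_coeff q N)"
    unfolding hecke_pairing_def by (subst infsum_cmult_right'[symmetric]) (simp add: mult_ac)
  also have "\<dots> = (\<Sum>\<^sub>\<infinity>N. (1 + q ^ (2 * m + 2)) * (fin_theta_odd q m N * hecke_coeff q (N + 0))
                  - q ^ (m + 1) * (fin_theta_odd q m (N - 1) * hecke_coeff q N + fin_theta_odd q m (N + 1) * hecke_coeff q N))"
    unfolding fin_theta_odd_rec by (rule infsum_cong) (simp add: algebra_simps)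
  also have "\<dots> = (1 + q ^ (2 * m + 2)) * hecke_pairing m 0
                  - q ^ (m + 1) * ((\<Sum>\<^sub>\<infinity>N. fin_theta_odd q m (N - 1) * hecke_coeff q N) + (\<Sum>\<^sub>\<infinity>N. fin_theta_odd q m (N + 1) * hecke_coeff q N))"
    unfolding hecke_pairing_def
    by (subst infsum_minus) (simp_all only: infsum_cmult_right' infsum_add s1 s2 summable_on_add summable_on_cmult_right hecke_pairing_summable)
  also have "(\<Sum>\<^sub>\<infinity>N. fin_theta_odd q m (N + 1) * hecke_coeff q N) = hecke_pairing m (- 1)"
    unfolding hecke_pairing_def using infsum_int_shift[of "\<lambda>N. fin_theta_odd q m N * hecke_coeff q (N - 1)" 1] by simp
  also have "(\<Sum>\<^sub>\<infinity>N. fin_theta_odd q m (N - 1) * hecke_coeff q N) = hecke_pairing m 1"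
    unfolding hecke_pairing_def using infsum_int_shift[of "\<lambda>N. fin_theta_odd q m N * hecke_coeff q (N + 1)" "-1"] by simp
  also have "hecke_pairing m (-1) = q ^ (m + 1) * hecke_pairing m 0" using hecke_pairing_2[of m] hecke_pairing_reflect[of m 2] by simp
  also have "hecke_pairing m 1 = hecke_pairing m 0" using hecke_pairing_reflect[of m 1] by simp
  also have "(1 + q ^ (2 * m + 2)) * hecke_pairing m 0 - q ^ (m + 1) * (hecke_pairing m 0 + q ^ (m + 1) * hecke_pairing m 0) = (1 - q ^ (m + 1)) * hecke_pairing m 0"
    by (simp add: algebra_simps flip: power_add mult_2)
  finally have main: "(1 - q ^ (2 * m + 2)) * (1 - q ^ (2 * m + 3)) * hecke_pairing (Suc m) 0 = (1 - q ^ (m + 1)) * hecke_pairing m 0" .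
  then have "hecke_pairing (Suc m) 0 = (1 - q ^ (m + 1)) * hecke_pairing m 0 / ((1 - q ^ (2 * m + 2)) * (1 - q ^ (2 * m + 3)))"
    using nz by (metis nonzero_mult_div_cancel_left no_zero_divisors)
  moreover have "qpoch q q (2 * Suc m + 1) = qpoch q q (2 * m + 1) * (1 - q ^ (2 * m + 2)) * (1 - q ^ (2 * m + 3))"
    by (simp add: qpoch_Suc eval_nat_numeral mult_ac)
  ultimately show ?case unfolding Suc.IH by (simp add: qpoch_Suc mult_ac eval_nat_numeral power_add)
qed

text \<open>Here a shift of N costs only a factor z or 1 / z, and the right side of
  \<open>fin_theta_odd_rec\<close> factors into the two new linear factors of the product.\<close>

lemma jtp_finite:
  assumes z: "z \<noteq> 0"
  shows "(\<Sum>\<^sub>\<infinity>N. fin_theta_odd q m N * z powi N) = qpoch (q * z) q m * qpoch (1 / z) q (m + 1) / qpoch q q (2 * m + 1)"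
proof (induction m)
  case 0
  show ?case using infsum_fin_theta_odd_0[of "\<lambda>N. z powi N"] z by (simp add: qpoch_Suc power_int_minus field_simps)
next
  case (Suc m)
  define P where "P = (\<lambda>m. \<Sum>\<^sub>\<infinity>N. fin_theta_odd q m N * z powi N)"
  have nz: "1 - q ^ (2 * m + 2) \<noteq> 0" "1 - q ^ (2 * m + 3) \<noteq> 0"
    by (rule one_minus_power_nonzero; simp)+
  note s = fin_theta_odd_summable[OF z, of m]
  have s1: "(\<lambda>N. fin_theta_odd q m (N + 1) * z powi (N + 1)) summable_on UNIV"
    using summable_on_int_affine[OF s, of 1 1] by simp
  have s2: "(\<lambda>N. fin_theta_odd q m (N - 1) * z powi (N - 1)) summable_on UNIV"
    using summable_on_int_affine[OF s, of 1 "-1"] by simp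
  have "(1 - q ^ (2 * m + 2)) * (1 - q ^ (2 * m + 3)) * P (Suc m)
      = (\<Sum>\<^sub>\<infinity>N. ((1 - q ^ (2 * m + 2)) * (1 - q ^ (2 * m + 3)) * fin_theta_odd q (Suc m) N) * z powi N)"
    unfolding P_def by (subst infsum_cmult_right'[symmetric]) (simp add: mult_ac)
  also have "\<dots> = (\<Sum>\<^sub>\<infinity>N. (1 + q ^ (2 * m + 2)) * (fin_theta_odd q m N * z powi N)
                  - q ^ (m + 1) * (z * (fin_theta_odd q m (N - 1) * z powi (N - 1)) + 1 / z * (fin_theta_odd q m (N + 1) * z powi (N + 1))))"
    unfolding fin_theta_odd_rec using z by (intro infsum_cong) (simp add: power_int_add power_int_diff field_simps)
  also have "\<dots> = (1 + q ^ (2 * m + 2)) * P m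
                  - q ^ (m + 1) * (z * (\<Sum>\<^sub>\<infinity>N. fin_theta_odd q m (N - 1) * z powi (N - 1)) + 1 / z * (\<Sum>\<^sub>\<infinity>N. fin_theta_odd q m (N + 1) * z powi (N + 1)))"
    unfolding P_def
    by (subst infsum_minus) (simp_all only: infsum_cmult_right' infsum_add s s1 s2 summable_on_add summable_on_cmult_right)
  also have "(\<Sum>\<^sub>\<infinity>N. fin_theta_odd q m (N + 1) * z powi (N + 1)) = P m"
    unfolding P_def by (rule infsum_int_shift)
  also have "(\<Sum>\<^sub>\<infinity>N. fin_theta_odd q m (N - 1) * z powi (N - 1)) = P m"
    unfolding P_def using infsum_int_shift[of _ "-1"] by simp
  also have "(1 + q ^ (2 * m + 2)) * P m - q ^ (m + 1) * (z * P m + 1 / z * P m) = (1 - q ^ m * (q * z)) * (1 - q ^ (m + 1) * (1 / z)) * P m"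
    using z by (simp add: field_simps power_add power2_eq_square power_mult)
  finally have main: "(1 - q ^ (2 * m + 2)) * (1 - q ^ (2 * m + 3)) * P (Suc m)
      = (1 - q ^ m * (q * z)) * (1 - q ^ (m + 1) * (1 / z)) * P m" .
  then have "P (Suc m) = (1 - q ^ m * (q * z)) * (1 - q ^ (m + 1) * (1 / z)) * P m / ((1 - q ^ (2 * m + 2)) * (1 - q ^ (2 * m + 3)))"
    using nz by (metis nonzero_mult_div_cancel_left no_zero_divisors)
  moreover have "qpoch q q (2 * Suc m + 1) = qpoch q q (2 * m + 1) * (1 - q ^ (2 * m + 2)) * (1 - q ^ (2 * m + 3))"
    by (simp add: qpoch_Suc eval_nat_numeral mult_ac)
  moreover have "P m = qpoch (q * z) q m * qpoch (1 / z) q (m + 1) / qpoch q q (2 * m + 1)"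
    using Suc.IH by (simp add: P_def)
  ultimately have "P (Suc m) = qpoch (q * z) q (Suc m) * qpoch (1 / z) q (Suc m + 1) / qpoch q q (2 * Suc m + 1)"
    by (simp add: qpoch_Suc mult_ac eval_nat_numeral power_add)
  then show ?case by (simp add: P_def)
qed

end

section \<open>The triple product and the limiting Gauss sum\<close>

lemma pochhammer_limit_ratio:
  assumes "norm q < 1"
  shows "(\<lambda>m. qpoch q q m / qpoch q q (2 * m + 1)) \<longlonglongrightarrow> 1"
proof -
  have nz: "qpoch_inf q q \<noteq> 0" by (rule qpoch_inf_nonzero'[OF assms assms])
  have "((\<lambda>n. qpoch q q n) \<circ> (\<lambda>m. 2 * m + 1)) \<longlonglongrightarrow> qpoch_inf q q"
    by (rule LIMSEQ_subseq_LIMSEQ[OF qpoch_tendsto[OF assms]]) (auto simp: strict_mono_def)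
  then have "(\<lambda>m. qpoch q q m / qpoch q q (2 * m + 1)) \<longlonglongrightarrow> qpoch_inf q q / qpoch_inf q q"
    using nz by (intro tendsto_divide qpoch_tendsto[OF assms]) (auto simp: o_def)
  then show ?thesis using nz by simp
qed

lemma jacobi_triple_product:
  fixes q x :: complex
  assumes q0: "q \<noteq> 0" and q1: "norm q < 1" and x: "x \<noteq> 0"
  shows "theta_j x q = (\<Sum>\<^sub>\<infinity>n. alt_sign n * q powi tri n * x powi n)"
proof -
  \<comment> \<open>The kernel carries \<open>tri (N + 1)\<close>, that is tri N + N; dividing x by
    q absorbs the extra q^N.\<close>
  define z where "z = x / q"
  have z: "z \<noteq> 0" "x = q * z" "q / x = 1 / z" using q0 x by (auto simp: z_def)
  have nz: "qpoch_inf q q \<noteq> 0" by (rule qpoch_inf_nonzero'[OF q1 q1])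
  obtain h where h: "h summable_on UNIV" "\<And>m N. norm (fin_theta_odd q m N * z powi N) \<le> h N"
    using fin_theta_odd_dominated[OF q0 q1, of z "\<lambda>_. 1"] abs_summable_theta[OF q0 q1, of "q * z"] q0 z(1) by auto
  have "(\<lambda>m. \<Sum>\<^sub>\<infinity>N. fin_theta_odd q m N * z powi N)
      \<longlonglongrightarrow> (\<Sum>\<^sub>\<infinity>N. alt_sign N * q powi tri (N + 1) / (qpoch_inf q q)^2 * z powi N)"
    by (rule tendsto_infsum_int[OF _ h(2) h(1)]) (intro tendsto_intros fin_theta_odd_tendsto q1 q0)
  moreover have "(\<lambda>m. \<Sum>\<^sub>\<infinity>N. fin_theta_odd q m N * z powi N)
      \<longlonglongrightarrow> qpoch_inf (q * z) q * qpoch_inf (1 / z) q / qpoch_inf q q"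
  proof -
    have "((\<lambda>n. qpoch q q n) \<circ> (\<lambda>m. 2 * m + 1)) \<longlonglongrightarrow> qpoch_inf q q"
      by (rule LIMSEQ_subseq_LIMSEQ[OF qpoch_tendsto[OF q1]]) (auto simp: strict_mono_def)
    then show ?thesis unfolding jtp_finite[OF q0 q1 z(1)]
      using nz by (intro tendsto_intros qpoch_tendsto q1 LIMSEQ_ignore_initial_segment[OF qpoch_tendsto[OF q1]]) (auto simp: o_def)
  qed
  ultimately have "(\<Sum>\<^sub>\<infinity>N. alt_sign N * q powi tri (N + 1) / (qpoch_inf q q)^2 * z powi N)
      = qpoch_inf (q * z) q * qpoch_inf (1 / z) q / qpoch_inf q q"
    by (rule LIMSEQ_unique)
  moreover have "(\<Sum>\<^sub>\<infinity>N. alt_sign N * q powi tri (N + 1) / (qpoch_inf q q)^2 * z powi N)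
      = (\<Sum>\<^sub>\<infinity>N. 1 / (qpoch_inf q q)^2 * (alt_sign N * q powi tri N * x powi N))"
    using q0 by (intro infsum_cong) (simp add: z(2) tri_Suc power_int_add power_int_mult_distrib field_simps)
  ultimately have "1 / (qpoch_inf q q)^2 * (\<Sum>\<^sub>\<infinity>N. alt_sign N * q powi tri N * x powi N)
      = qpoch_inf (q * z) q * qpoch_inf (1 / z) q / qpoch_inf q q"
    by (simp only: infsum_cmult_right')
  then show ?thesis using nz by (simp add: theta_j_def z(3) field_simps power2_eq_square flip: z(2))
qed

text \<open>The limit of \<open>hecke_pairing_0\<close>: its right side tends to 1, while the kernel
  tends to a theta term over (q;q)_inf^2.\<close>

lemma infsum_hecke_coeff:
  assumes q0: "q \<noteq> 0" and q1: "norm q < 1"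
  shows "(\<Sum>\<^sub>\<infinity>N. alt_sign N * q powi tri (N + 1) * hecke_coeff q N) = (qpoch_inf q q)^2"
proof -
  have nz: "qpoch_inf q q \<noteq> 0" by (rule qpoch_inf_nonzero'[OF q1 q1])
  obtain h where h: "h summable_on UNIV" "\<And>m N. norm (fin_theta_odd q m N * 1 powi N * hecke_coeff q (N + 0)) \<le> h N"
    using fin_theta_odd_dominated[OF q0 q1 summable_theta_hecke_coeff[OF q0 q1, of "q * 1" q 0]] q0 q1 by auto
  have "(\<lambda>m. hecke_pairing q m 0) \<longlonglongrightarrow> (\<Sum>\<^sub>\<infinity>N. alt_sign N * q powi tri (N + 1) / (qpoch_inf q q)^2 * hecke_coeff q N)"
    unfolding hecke_pairing_def[OF q0 q1]
  proof (rule tendsto_infsum_int[OF _ _ h(1)])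
    show "(\<lambda>m. fin_theta_odd q m N * hecke_coeff q (N + 0)) \<longlonglongrightarrow> alt_sign N * q powi tri (N + 1) / (qpoch_inf q q)^2 * hecke_coeff q N" for N
      unfolding add_0_right by (rule tendsto_mult_right[OF fin_theta_odd_tendsto[OF q0 q1]])
    show "norm (fin_theta_odd q m N * hecke_coeff q (N + 0)) \<le> h N" for m N using h(2)[of m N] by simp
  qed
  then have "(\<Sum>\<^sub>\<infinity>N. alt_sign N * q powi tri (N + 1) / (qpoch_inf q q)^2 * hecke_coeff q N) = 1"
    unfolding hecke_pairing_0[OF q0 q1] using pochhammer_limit_ratio[OF q1] by (rule LIMSEQ_unique)
  moreover have "(\<Sum>\<^sub>\<infinity>N. alt_sign N * q powi tri (N + 1) / (qpoch_inf q q)^2 * hecke_coeff q N)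
      = 1 / (qpoch_inf q q)^2 * (\<Sum>\<^sub>\<infinity>N. alt_sign N * q powi tri (N + 1) * hecke_coeff q N)"
    by (subst infsum_cmult_right'[symmetric]) (simp add: field_simps)
  ultimately show ?thesis using nz by (simp add: field_simps)
qed

lemma qpoch_nonzero_iff: "qpoch x p n \<noteq> 0 \<longleftrightarrow> (\<forall>i<n. p ^ i * x \<noteq> 1)"
  by (auto simp: qpoch_def)

text \<open>The general term of the q-Gauss series 2phi1(a, b; c; c/(a b)) with c = -b x, in the
  limit of infinite a.\<close>

definition gauss_term :: "complex \<Rightarrow> complex \<Rightarrow> complex \<Rightarrow> nat \<Rightarrow> complex" where
  "gauss_term q b x m = qpoch b q m * x ^ m * q ^ (m choose 2) / (qpoch q q m * qpoch (- b * x) q m)"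

context
  fixes q b :: complex
  assumes q1: "norm q < 1"
begin

text \<open>The bound has to be uniform in j, because x q^j will tend to 0. Since (c;q)_(j+m) =
  (c;q)_j (c q^j;q)_m for c = -b x, every shifted denominator is a quotient of two members of one
  bounded sequence with bounded reciprocals.\<close>

lemma gauss_term_bound:
  assumes x: "\<And>i. q ^ i * (- b * x) \<noteq> 1"
  obtains K where "\<And>j m. norm (gauss_term q b (q ^ j * x) m) \<le> K * norm (q ^ (m choose 2) * (q ^ j * x) ^ m)"
proof -
  let ?c = "- b * x"
  obtain B1 where B1: "B1 > 0" "\<And>n. norm (qpoch b q n) \<le> B1" using qpoch_bounded[OF q1] by blast
  obtain B2 where B2: "B2 > 0" "\<And>n. norm (1 / qpoch q q n) \<le> B2"
    using inverse_qpoch_bounded[OF q1 norm_mult_power_neq_1(1)[OF q1 q1]] by metis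
  obtain B3 where B3: "B3 > 0" "\<And>n. norm (qpoch ?c q n) \<le> B3" using qpoch_bounded[OF q1] by blast
  obtain B4 where B4: "B4 > 0" "\<And>n. norm (1 / qpoch ?c q n) \<le> B4"
    using inverse_qpoch_bounded[OF q1 x] by metis
  have nz: "qpoch ?c q n \<noteq> 0" for n unfolding qpoch_nonzero_iff using x by blast
  show ?thesis
  proof (rule that[of "B1 * B2 * (B3 * B4)"])
    fix j m
    have "qpoch ?c q (j + m) = qpoch ?c q j * qpoch (- b * (q ^ j * x)) q m"
      by (simp add: qpoch_add mult_ac)
    then have e: "1 / qpoch (- b * (q ^ j * x)) q m = qpoch ?c q j * (1 / qpoch ?c q (j + m))"
      using nz[of j] nz[of "j + m"] by (simp add: field_simps)
    have "norm (gauss_term q b (q ^ j * x) m) = norm (qpoch b q m) * norm (1 / qpoch q q m)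
        * (norm (qpoch ?c q j) * norm (1 / qpoch ?c q (j + m))) * norm (q ^ (m choose 2) * (q ^ j * x) ^ m)"
      unfolding norm_mult[symmetric] e[symmetric] gauss_term_def by (simp add: field_simps)
    also have "\<dots> \<le> B1 * B2 * (B3 * B4) * norm (q ^ (m choose 2) * (q ^ j * x) ^ m)"
      using B1 B2 B3 B4 by (intro mult_right_mono mult_mono mult_nonneg_nonneg) (auto simp: less_imp_le)
    finally show "norm (gauss_term q b (q ^ j * x) m) \<le> B1 * B2 * (B3 * B4) * norm (q ^ (m choose 2) * (q ^ j * x) ^ m)" .
  qed
qed

lemma gauss_term_summable:
  assumes x: "\<And>i. q ^ i * (- b * x) \<noteq> 1"
  shows "summable (\<lambda>m. norm (gauss_term q b x m))"
proof -
  obtain K where K: "\<And>j m. norm (gauss_term q b (q ^ j * x) m) \<le> K * norm (q ^ (m choose 2) * (q ^ j * x) ^ m)"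
    using gauss_term_bound[OF x] by blast
  show ?thesis
    by (rule summable_comparison_test'[OF summable_mult[OF summable_theta_nat[OF q1, of x], of K]])
       (use K[of 0] in simp)
qed

text \<open>Contiguity in x by telescoping, with certificate \<open>v\<close>: the factor 1 - q^m
  makes it start at 0, and summability makes it end at 0.\<close>

lemma gauss_sum_step:
  assumes x: "\<And>i. q ^ i * (- b * x) \<noteq> 1"
  shows "(1 + b * x) * (\<Sum>m. gauss_term q b x m) = (1 + x) * (\<Sum>m. gauss_term q b (q * x) m)"
proof -
  have x': "q ^ i * (- b * (q * x)) \<noteq> 1" for i using x[of "Suc i"] by (simp add: mult_ac)
  have s: "summable (gauss_term q b x)" "summable (gauss_term q b (q * x))"
    using gauss_term_summable[OF x] gauss_term_summable[OF x'] by (auto intro: summable_norm_cancel)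
  define v where "v m = (1 - q ^ m) * (1 + b * x) * gauss_term q b x m" for m
  have step: "(1 + b * x) * gauss_term q b x m - (1 + x) * gauss_term q b (q * x) m = v m - v (Suc m)" for m
  proof -
    have n1: "1 + b * x * q ^ m \<noteq> 0" "1 + b * x \<noteq> 0"
      using x[of m] x[of 0] by (auto simp: mult_ac add_eq_0_iff2)
    have n2: "1 - q * q ^ m \<noteq> 0"
      using norm_mult_power_neq_1(2)[OF q1 q1, of m] by (simp add: mult.commute)
    have nz: "qpoch (- b * x) q m \<noteq> 0" "qpoch (- b * (q * x)) q m \<noteq> 0" "qpoch q q m \<noteq> 0"
      using qpoch_nonzero_iff x x' qpoch_nonzero[OF q1 q1] by blast+
    have "qpoch (- b * x) q m * (1 + b * x * q ^ m) = (1 + b * x) * qpoch (- b * (q * x)) q m"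
      using qpoch_Suc[of "- b * x" q m] qpoch_Suc_left[of "- b * x" q m] by (simp add: mult_ac)
    then have inv: "1 / qpoch (- b * (q * x)) q m = (1 + b * x) / (qpoch (- b * x) q m * (1 + b * x * q ^ m))"
      using n1 by simp
    have "gauss_term q b (q * x) m
        = qpoch b q m * x ^ m * q ^ (m choose 2) * q ^ m / qpoch q q m * (1 / qpoch (- b * (q * x)) q m)"
      by (simp add: gauss_term_def power_mult_distrib mult_ac)
    then have e1: "gauss_term q b (q * x) m = gauss_term q b x m * q ^ m * (1 + b * x) / (1 + b * x * q ^ m)"
      unfolding inv by (simp add: gauss_term_def)
    have "Suc m choose 2 = m + (m choose 2)" by (simp add: numeral_2_eq_2)
    then have e2: "gauss_term q b x (Suc m)
        = gauss_term q b x m * (1 - b * q ^ m) * x * q ^ m / ((1 - q * q ^ m) * (1 + b * x * q ^ m))"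
      unfolding gauss_term_def using n1 n2 nz by (simp add: qpoch_Suc power_add mult_ac)
    show ?thesis unfolding v_def e1 e2 using n1 n2 by (simp add: divide_simps) (simp add: algebra_simps)
  qed
  have "gauss_term q b x \<longlonglongrightarrow> 0" by (rule summable_LIMSEQ_zero[OF s(1)])
  then have "v \<longlonglongrightarrow> (1 - 0) * (1 + b * x) * 0"
    unfolding v_def by (intro tendsto_intros LIMSEQ_power_zero q1)
  then have "(\<lambda>m. v m - v (Suc m)) sums (v 0 - 0)" by (intro telescope_sums') simp
  then have "(\<lambda>m. (1 + b * x) * gauss_term q b x m - (1 + x) * gauss_term q b (q * x) m) sums 0"
    unfolding step by (simp add: v_def)
  moreover have "(\<lambda>m. (1 + b * x) * gauss_term q b x m - (1 + x) * gauss_term q b (q * x) m)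
      sums ((1 + b * x) * (\<Sum>m. gauss_term q b x m) - (1 + x) * (\<Sum>m. gauss_term q b (q * x) m))"
    by (intro sums_diff sums_mult summable_sums s)
  ultimately show ?thesis using sums_unique2 by force
qed

lemma gauss_sum_iterate:
  assumes x: "\<And>i. q ^ i * (- b * x) \<noteq> 1"
  shows "qpoch (- b * x) q j * (\<Sum>m. gauss_term q b x m) = qpoch (- x) q j * (\<Sum>m. gauss_term q b (q ^ j * x) m)"
proof (induction j)
  case (Suc j)
  have x': "q ^ i * (- b * (q ^ j * x)) \<noteq> 1" for i using x[of "i + j"] by (simp add: power_add mult_ac)
  have "qpoch (- b * x) q (Suc j) * (\<Sum>m. gauss_term q b x m)
      = (1 + b * (q ^ j * x)) * (qpoch (- b * x) q j * (\<Sum>m. gauss_term q b x m))"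
    by (simp add: qpoch_Suc mult_ac)
  also have "\<dots> = qpoch (- x) q j * ((1 + b * (q ^ j * x)) * (\<Sum>m. gauss_term q b (q ^ j * x) m))"
    unfolding Suc.IH by (simp only: mult_ac)
  also have "\<dots> = qpoch (- x) q (Suc j) * (\<Sum>m. gauss_term q b (q ^ Suc j * x) m)"
    unfolding gauss_sum_step[OF x'] by (simp add: qpoch_Suc mult_ac)
  finally show ?case .
qed simp

text \<open>Iterating the contiguity replaces x by q^j x at the cost of finite products. As j grows
  only the term m = 0 survives, with a majorant independent of j.\<close>

lemma gauss_sum:
  assumes x: "\<And>i. q ^ i * (- b * x) \<noteq> 1"
  shows "gauss_term q b x sums (qpoch_inf (- x) q / qpoch_inf (- b * x) q)"
proof -
  obtain K where K: "\<And>j m. norm (gauss_term q b (q ^ j * x) m) \<le> K * norm (q ^ (m choose 2) * (q ^ j * x) ^ m)"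
    using gauss_term_bound[OF x] by blast
  have K0: "K \<ge> 0" using K[of 0 0] by (simp add: gauss_term_def)
  define h where "h m = K * norm (q ^ (m choose 2) * x ^ m)" for m
  have h: "summable h" unfolding h_def by (intro summable_mult summable_theta_nat q1)
  have "(\<lambda>j. \<Sum>m. gauss_term q b (q ^ j * x) m) \<longlonglongrightarrow> (\<Sum>m. if m = 0 then 1 else 0)"
  proof -
    have "(\<lambda>j. gauss_term q b (q ^ j * x) m) \<longlonglongrightarrow> (if m = 0 then 1 else 0)" for m
    proof (cases "m = 0")
      case False
      have "(\<lambda>j. K * norm (q ^ (m choose 2) * (q ^ j * x) ^ m)) \<longlonglongrightarrow> K * norm (q ^ (m choose 2) * (0 * x) ^ m)"
        by (intro tendsto_intros LIMSEQ_power_zero q1)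
      then have "(\<lambda>j. K * norm (q ^ (m choose 2) * (q ^ j * x) ^ m)) \<longlonglongrightarrow> 0"
        using False by (simp add: zero_power)
      then have "(\<lambda>j. gauss_term q b (q ^ j * x) m) \<longlonglongrightarrow> 0"
        by (intro Lim_null_comparison[OF always_eventually[OF allI[OF K]]]) auto
      then show ?thesis using False by simp
    qed (simp add: gauss_term_def numeral_2_eq_2)
    moreover have "norm (gauss_term q b (q ^ j * x) m) \<le> h m" for j m
    proof -
      have "norm (q ^ j * x) ^ m \<le> norm x ^ m"
        using q1 by (intro power_mono) (auto simp: norm_mult norm_power mult_left_le_one_le power_le_one)
      then have "K * norm (q ^ (m choose 2) * (q ^ j * x) ^ m) \<le> h m"
        unfolding h_def norm_mult norm_power[of _ m] by (intro mult_left_mono K0) auto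
      with K show ?thesis using order_trans by blast
    qed
    ultimately show ?thesis
      using tannerys_theorem[of "\<lambda>m j. gauss_term q b (q ^ j * x) m" "\<lambda>m. if m = 0 then 1 else 0" sequentially h] h
      by (auto simp: case_prod_unfold)
  qed
  moreover have "(\<Sum>m. if m = 0 then 1 else 0 :: complex) = 1"
    by (subst suminf_finite[of "{0}"]) auto
  ultimately have "(\<lambda>j. qpoch (- x) q j * (\<Sum>m. gauss_term q b (q ^ j * x) m)) \<longlonglongrightarrow> qpoch_inf (- x) q * 1"
    by (intro tendsto_mult qpoch_tendsto q1) simp
  moreover have "(\<lambda>j. qpoch (- b * x) q j * (\<Sum>m. gauss_term q b x m)) \<longlonglongrightarrow> qpoch_inf (- b * x) q * (\<Sum>m. gauss_term q b x m)"
    by (intro tendsto_intros qpoch_tendsto q1)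
  ultimately have "qpoch_inf (- b * x) q * (\<Sum>m. gauss_term q b x m) = qpoch_inf (- x) q"
    unfolding gauss_sum_iterate[OF x] using LIMSEQ_unique by fastforce
  moreover have "qpoch_inf (- b * x) q \<noteq> 0" by (rule qpoch_inf_nonzero[OF q1 x])
  ultimately have "(\<Sum>m. gauss_term q b x m) = qpoch_inf (- x) q / qpoch_inf (- b * x) q"
    by (simp add: field_simps)
  then show ?thesis using summable_sums[OF summable_norm_cancel[OF gauss_term_summable[OF x]]] by simp
qed

lemma gauss_has_sum:
  assumes x: "\<And>i. q ^ i * (- b * x) \<noteq> 1"
  shows "(gauss_term q b x has_sum (qpoch_inf (- x) q / qpoch_inf (- b * x) q)) UNIV"
  by (rule norm_summable_imp_has_sum[OF gauss_term_summable[OF x] gauss_sum[OF x]])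

end

section \<open>Hecke-type sums for the mock theta functions\<close>

abbreviation theta_J12 :: "complex \<Rightarrow> complex" where
  "theta_J12 q \<equiv> theta_j q (q^2)"

lemma qpoch_split2: "qpoch x p (2 * n) = qpoch x (p^2) n * qpoch (p * x) (p^2) n"
  by (induction n) (simp_all add: qpoch_Suc mult_ac flip: power_mult)

section \<open>The product form of J_{1,2}\<close>

context
  fixes q :: complex
  assumes q0: "q \<noteq> 0" and q1: "norm q < 1"
begin

lemma norm_power_less_1: "n > 0 \<Longrightarrow> norm (q ^ n) < 1"
  using q1 by (simp add: norm_power power_less_one_iff)

lemma norm_q2: "norm (q^2) < 1"
  by (rule norm_power_less_1) simp

text \<open>Split (q;q)_inf into odd and even factors in (q^2;q^2)_inf = (q;q)_inf (-q;q)_inf and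
  cancel the even part.\<close>

lemma euler_product: "qpoch_inf q (q^2) * qpoch_inf (- q) q = 1"
proof -
  have "qpoch_inf (q^2) (q^2) = qpoch_inf q q * qpoch_inf (- q) q"
    by (rule qpoch_inf_square[OF q1])
  also have "qpoch_inf q q = qpoch_inf q (q^2) * qpoch_inf (q^2) (q^2)"
    using qpoch_inf_split2[OF q1, of q] by (simp add: power2_eq_square)
  finally have "qpoch_inf (q^2) (q^2) * (qpoch_inf q (q^2) * qpoch_inf (- q) q) = qpoch_inf (q^2) (q^2) * 1"
    by (simp add: mult_ac)
  then show ?thesis using qpoch_inf_nonzero'[OF norm_q2 norm_q2] by (simp only: mult_cancel_left) simp
qed

lemma theta_J12_eq: "theta_J12 q = qpoch_inf q (q^2) ^ 2 * qpoch_inf (q^2) (q^2)"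
proof -
  have "q^2 / q = q" using q0 by (simp add: power2_eq_square)
  then show ?thesis by (simp add: theta_j_def power2_eq_square)
qed

lemma qq_split: "qpoch_inf q q = qpoch_inf q (q^2) * qpoch_inf (q^2) (q^2)"
  using qpoch_inf_split2[OF q1, of q] by (simp add: power2_eq_square)

lemma theta_J12_ratio: "theta_J12 q * (qpoch_inf (- q) q / qpoch_inf q q) = 1"
proof -
  have "qpoch_inf q q \<noteq> 0" by (rule qpoch_inf_nonzero'[OF q1 q1])
  moreover have "theta_J12 q * qpoch_inf (- q) q = qpoch_inf q q * (qpoch_inf q (q^2) * qpoch_inf (- q) q)"
    unfolding theta_J12_eq qq_split by (simp add: power2_eq_square mult_ac)
  ultimately show ?thesis by (simp add: euler_product)
qed

lemma theta_J12_nonzero: "theta_J12 q \<noteq> 0"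
  using theta_J12_ratio by auto

text \<open>Terms with n < N vanish. For n = N + m the sum is a Gauss series with x = q^(N + 1). The
  hypothesis on \<open>c\<close> says -b x = q^(c + 1), which is exactly what lets (q;q)_(c+m) split
  as (q;q)_c (-b x;q)_m.\<close>

lemma bailey_sum_aux:
  fixes b :: complex and N c :: nat
  assumes b: "b = - (q ^ N) \<or> b = - (q ^ (N + 1))"
    and c: "b * q ^ (N + 1) = - (q ^ (c + 1))"
    and W: "\<And>m. W (N + m) = W N * qpoch b q m"
  shows "((\<lambda>n. q powi tri (int n + 1) * W n * (inv_qfact q (int n - int N) * inv_qfact q (int n + (int c - int N))))
          has_sum (q powi tri (int N + 1) * W N * qpoch_inf (- (q ^ (N + 1))) q / qpoch_inf q q)) UNIV"
proof -
  let ?f = "\<lambda>n. q powi tri (int n + 1) * W n * (inv_qfact q (int n - int N) * inv_qfact q (int n + (int c - int N)))"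
  define x where "x = q ^ (N + 1)"
  have cx: "- b * x = q ^ (c + 1)" using c by (simp add: x_def)
  have nx: "q ^ i * (- b * x) \<noteq> 1" for i
    unfolding cx by (rule norm_mult_power_neq_1[OF q1 norm_power_less_1]) simp
  define A where "A = q powi tri (int N + 1) * W N / qpoch q q c"
  have "((\<lambda>m. A * gauss_term q b x m) has_sum (A * (qpoch_inf (- x) q / qpoch_inf (- b * x) q))) UNIV"
    by (intro has_sum_cmult_right gauss_has_sum q1 nx)
  also have "(\<lambda>m. A * gauss_term q b x m) = (\<lambda>m. ?f (N + m))"
  proof
    fix m
    have 1: "inv_qfact q (int (N + m) - int N) = 1 / qpoch q q m"
      using inv_qfact_of_nat[of q m] by simp
    have "int (N + m) + (int c - int N) = int (c + m)" by simp
    then have 2: "inv_qfact q (int (N + m) + (int c - int N)) = 1 / (qpoch q q c * qpoch (- b * x) q m)"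
      unfolding cx by (simp only: inv_qfact_of_nat qpoch_add) (simp add: mult.commute)
    have "tri (int (N + m) + 1) = tri (int N + 1) + (tri (int m) + int (N + 1) * int m)"
      using tri_add[of "int N + 1" "int m"] by (simp add: algebra_simps)
    moreover have "x ^ m = q powi (int (N + 1) * int m)"
      unfolding x_def by (simp only: power_int_mult power_int_of_nat)
    ultimately have 3: "q powi tri (int (N + m) + 1) = q powi tri (int N + 1) * (q ^ (m choose 2) * x ^ m)"
      using q0 by (simp add: power_int_add flip: powi_tri_nat)
    show "A * gauss_term q b x m = ?f (N + m)"
      unfolding 1 2 3 W gauss_term_def A_def by (simp add: mult_ac)
  qed
  also have "((\<lambda>m. ?f (N + m)) has_sum (A * (qpoch_inf (- x) q / qpoch_inf (- b * x) q))) UNIV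
      \<longleftrightarrow> (?f has_sum (A * (qpoch_inf (- x) q / qpoch_inf (- b * x) q))) {N..}"
    by (rule has_sum_reindex_bij_witness[of _ "\<lambda>n. n - N" "\<lambda>m. N + m"]) auto
  also have "\<dots> \<longleftrightarrow> (?f has_sum (A * (qpoch_inf (- x) q / qpoch_inf (- b * x) q))) UNIV"
    by (rule has_sum_cong_neutral) (auto simp: inv_qfact_neg)
  also have "A * (qpoch_inf (- x) q / qpoch_inf (- b * x) q)
      = q powi tri (int N + 1) * W N * qpoch_inf (- (q ^ (N + 1))) q / qpoch_inf q q"
  proof -
    have "qpoch_inf q q = qpoch q q c * qpoch_inf (- b * x) q"
      using qpoch_inf_shift[OF q1, of q c] unfolding cx by (simp add: mult.commute)
    then show ?thesis by (simp add: A_def x_def)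
  qed
  finally show ?thesis .
qed

definition bailey_ratio where "bailey_ratio = qpoch_inf (- q) q / qpoch_inf q q"

text \<open>The conjugate Bailey pair relative to q, from b = -q^(N+1) and c = 2 N + 1. Negative N
  follows because both sides are invariant under N -> -1 - N.\<close>

lemma bailey_phi:
  "((\<lambda>n. q powi tri (int n + 1) * qpoch (- q) q n * (inv_qfact q (int n - N) * inv_qfact q (int n + N + 1)))
     has_sum (q powi tri (N + 1) * bailey_ratio)) UNIV"
proof -
  have nat_case: "((\<lambda>n. q powi tri (int n + 1) * qpoch (- q) q n * (inv_qfact q (int n - int M) * inv_qfact q (int n + int M + 1)))
     has_sum (q powi tri (int M + 1) * bailey_ratio)) UNIV" for M
  proof -
    have "((\<lambda>n. q powi tri (int n + 1) * qpoch (- q) q n * (inv_qfact q (int n - int M) * inv_qfact q (int n + (int (2 * M + 1) - int M))))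
          has_sum (q powi tri (int M + 1) * qpoch (- q) q M * qpoch_inf (- (q ^ (M + 1))) q / qpoch_inf q q)) UNIV"
      by (rule bailey_sum_aux[where b = "- (q ^ (M + 1))"])
         (auto simp: qpoch_add power_add power_mult power2_eq_square mult_ac)
    then show ?thesis
      using qpoch_inf_shift[OF q1, of "- q" M] by (simp add: bailey_ratio_def mult_ac add_ac)
  qed
  show ?thesis
  proof (cases "N \<ge> 0")
    case True
    then show ?thesis using nat_case[of "nat N"] by simp
  next
    case False
    then have i: "int (nat (- 1 - N)) = - 1 - N" by simp
    have e: "tri (- 1 - N + 1) = tri (N + 1)" using tri_minus[of N] by (simp add: tri_Suc)
    have e': "int n - (- 1 - N) = int n + N + 1" "int n + (- 1 - N) + 1 = int n - N" for n by simp_all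
    show ?thesis using nat_case[of "nat (- 1 - N)"] unfolding i e e' by (simp only: mult_ac)
  qed
qed

lemma one_plus_power_nonzero: "1 + q powi N \<noteq> 0"
proof -
  have *: "1 + q ^ n \<noteq> 0" for n
  proof (cases "n = 0")
    case False
    show ?thesis
    proof
      assume "1 + q ^ n = 0"
      then have "q ^ n = - 1" by (metis add.commute add_eq_0_iff2)
      then show False using norm_power_less_1[of n] False by simp
    qed
  qed simp
  show ?thesis
  proof (cases "N \<ge> 0")
    case True
    then show ?thesis using *[of "nat N"] by (simp add: power_int_nonneg_exp)
  next
    case False
    then have "q ^ nat (- N) = q powi (- N)" by (simp add: power_int_nonneg_exp)
    then have "1 + q powi N = q powi N * (1 + q ^ nat (- N))"
      using q0 by (simp add: algebra_simps flip: power_int_add)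
    then show ?thesis using *[of "nat (- N)"] q0 by simp
  qed
qed

text \<open>The conjugate pair relative to 1, from b = -q^N and c = 2 N. The denominator 1 + q^N is
  the factor that (-1;q)_N (-q^(N+1);q)_inf lacks compared with (-1;q)_inf = 2 (-q;q)_inf.\<close>

lemma bailey_psi:
  "((\<lambda>n. q powi tri (int n + 1) * qpoch (- 1) q n * (inv_qfact q (int n - N) * inv_qfact q (int n + N)))
     has_sum (q powi tri (N + 1) * 2 / (1 + q powi N) * bailey_ratio)) UNIV"
proof -
  have nat_case: "((\<lambda>n. q powi tri (int n + 1) * qpoch (- 1) q n * (inv_qfact q (int n - int M) * inv_qfact q (int n + int M)))
     has_sum (q powi tri (int M + 1) * 2 / (1 + q powi int M) * bailey_ratio)) UNIV" for M
  proof -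
    have "((\<lambda>n. q powi tri (int n + 1) * qpoch (- 1) q n * (inv_qfact q (int n - int M) * inv_qfact q (int n + (int (2 * M) - int M))))
          has_sum (q powi tri (int M + 1) * qpoch (- 1) q M * qpoch_inf (- (q ^ (M + 1))) q / qpoch_inf q q)) UNIV"
      by (rule bailey_sum_aux[where b = "- (q ^ M)"])
         (auto simp: qpoch_add power_add power_mult power2_eq_square mult_ac)
    moreover have "2 * qpoch_inf (- q) q = qpoch (- 1) q M * ((1 + q ^ M) * qpoch_inf (- (q ^ (M + 1))) q)"
      using qpoch_inf_shift[OF q1, of "- 1" M] qpoch_inf_Suc[OF q1, of "- 1"] qpoch_inf_Suc[OF q1, of "- (q ^ M)"]
      by (simp add: mult_ac)
    then have "qpoch (- 1) q M * qpoch_inf (- (q ^ (M + 1))) q = 2 / (1 + q powi int M) * qpoch_inf (- q) q"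
      using one_plus_power_nonzero[of "int M"] by (simp add: field_simps)
    ultimately show ?thesis by (simp add: bailey_ratio_def mult.assoc)
  qed
  show ?thesis
  proof (cases "N \<ge> 0")
    case True
    then show ?thesis using nat_case[of "nat N"] by simp
  next
    case False
    then have i: "int (nat (- N)) = - N" by simp
    have "q powi tri (N + 1) * 2 / (1 + q powi N) = q powi tri (- N + 1) * 2 / (1 + q powi (- N))"
    proof -
      have "tri (- N + 1) = tri (N + 1) - N" using tri_reflect[of N] by (simp add: tri_Suc)
      then have e1: "q powi tri (N + 1) = q powi tri (- N + 1) * q powi N"
        using q0 by (simp flip: power_int_add)
      have e2: "1 + q powi N = q powi N * (1 + q powi (- N))"
        using q0 by (simp add: algebra_simps flip: power_int_add)
      show ?thesis unfolding e1 e2 using q0 by simp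
    qed
    moreover have e': "int n - (- N) = int n + N" "int n + (- N) = int n - N" for n by simp_all
    ultimately show ?thesis using nat_case[of "nat (- N)"] unfolding i e' by (simp only: mult_ac)
  qed
qed

text \<open>Exchanging the sums over \<open>n\<close> and \<open>N\<close> needs only that every finite Bailey kernel is bounded by
  its limiting theta term.\<close>

lemma bailey_swap:
  fixes w :: "nat \<Rightarrow> complex" and g :: "nat \<Rightarrow> int \<Rightarrow> complex"
  assumes w: "\<And>n. norm (w n) \<le> K" and g: "\<And>n N. norm (g n N) \<le> L * norm (q powi tri N * q powi N)"
    and inner: "\<And>n. v n = (\<Sum>\<^sub>\<infinity>N. g n N * hecke_coeff q (N + a))"
    and outer: "\<And>N. ((\<lambda>n. q powi tri (int n + 1) * w n * g n N) has_sum h N) UNIV"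
  shows "(\<lambda>n. q powi tri (int n + 1) * w n * v n) sums (\<Sum>\<^sub>\<infinity>N. h N * hecke_coeff q (N + a))"
    and "(\<lambda>N. h N * hecke_coeff q (N + a)) summable_on UNIV"
proof -
  let ?F = "\<lambda>n N. q powi tri (int n + 1) * w n * g n N * hecke_coeff q (N + a)"
  define A where "A n = K * norm (q powi tri (int n + 1))" for n
  define B where "B N = L * norm (q powi tri N * q powi N * hecke_coeff q (N + a))" for N
  have K0: "K \<ge> 0" using w[of 0] norm_ge_zero order_trans by blast
  have "0 \<le> norm (g 0 0)" by simp
  also have "\<dots> \<le> L" using g[of 0 0] by simp
  finally have L0: "L \<ge> 0" .
  have A: "(\<lambda>n. norm (complex_of_real (A n))) summable_on UNIV"
  proof -
    have "(\<lambda>n. norm (q powi tri n * q powi n)) summable_on UNIV"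
      by (rule abs_summable_theta[OF q0 q1 q0])
    then have "(\<lambda>n. norm (q powi tri n * q powi n)) summable_on range int"
      by (rule summable_on_subset_banach) simp
    then have "(\<lambda>n. norm (q powi tri (int n) * q powi int n)) summable_on UNIV"
      by (subst (asm) summable_on_reindex) (auto simp: o_def)
    then have "(\<lambda>n. K * norm (q powi tri (int n) * q powi int n)) summable_on UNIV"
      by (rule summable_on_cmult_right)
    then show ?thesis using q0 K0 by (simp add: A_def tri_Suc power_int_add norm_mult abs_mult)
  qed
  have B: "(\<lambda>N. norm (complex_of_real (B N))) summable_on UNIV"
    using summable_on_cmult_right[OF summable_theta_hecke_coeff[OF q0 q1 q0, of q a], of L] q1 L0
    by (simp only: norm_of_real B_def abs_mult abs_of_nonneg[OF L0] abs_norm_cancel less_imp_le)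
  have bound: "norm (?F n N) \<le> A n * B N" for n N
  proof -
    have "norm (?F n N) = norm (q powi tri (int n + 1)) * norm (w n) * (norm (g n N) * norm (hecke_coeff q (N + a)))"
      by (simp add: norm_mult)
    also have "\<dots> \<le> norm (q powi tri (int n + 1)) * K * (L * norm (q powi tri N * q powi N) * norm (hecke_coeff q (N + a)))"
      using w[of n] g[of n N] K0 by (intro mult_mono mult_left_mono mult_right_mono mult_nonneg_nonneg) auto
    also have "\<dots> = A n * B N" by (simp add: A_def B_def norm_mult)
    finally show ?thesis .
  qed
  have "(\<lambda>(n, N). norm (complex_of_real (A n) * complex_of_real (B N))) summable_on UNIV \<times> UNIV"
    by (rule infsum_times(1)[OF A B])
  then have "(\<lambda>x. norm (case x of (n, N) \<Rightarrow> ?F n N)) summable_on UNIV \<times> UNIV"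
  proof (rule Infinite_Sum.abs_summable_on_comparison_test')
    fix x :: "nat \<times> int"
    show "norm (case x of (n, N) \<Rightarrow> ?F n N) \<le> (case x of (n, N) \<Rightarrow> norm (complex_of_real (A n) * complex_of_real (B N)))"
      using bound[of "fst x" "snd x"] norm_ge_zero[of "?F (fst x) (snd x)"]
      by (simp add: case_prod_unfold norm_mult flip: abs_mult)
  qed
  then have s: "(\<lambda>(n, N). ?F n N) summable_on UNIV \<times> UNIV"
    by (rule abs_summable_summable)
  then obtain S where S: "((\<lambda>(n, N). ?F n N) has_sum S) (UNIV \<times> UNIV)" by (auto simp: summable_on_def)
  have sn: "?F n summable_on UNIV" for n
    using summable_on_SigmaD1[OF s, of n] by simp
  have "((\<lambda>n. q powi tri (int n + 1) * w n * v n) has_sum S) UNIV"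
  proof (rule has_sum_SigmaD[OF S])
    fix n
    have "(\<Sum>\<^sub>\<infinity>N. ?F n N) = q powi tri (int n + 1) * w n * v n"
      unfolding inner by (subst infsum_cmult_right'[symmetric]) (simp add: mult_ac)
    then show "((\<lambda>N. case (n, N) of (n, N) \<Rightarrow> ?F n N) has_sum (q powi tri (int n + 1) * w n * v n)) UNIV"
      using has_sum_infsum[OF sn[of n]] by simp
  qed
  then have 1: "(\<lambda>n. q powi tri (int n + 1) * w n * v n) sums S" by (rule has_sum_imp_sums)
  have 2: "((\<lambda>N. h N * hecke_coeff q (N + a)) has_sum S) UNIV"
  proof (rule has_sum_SigmaD[OF S[THEN has_sum_swap[THEN iffD1]]])
    fix N
    show "((\<lambda>n. case (N, n) of (x, y) \<Rightarrow> case (y, x) of (n, N) \<Rightarrow> ?F n N) has_sum (h N * hecke_coeff q (N + a))) UNIV"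
      using has_sum_cmult_left[OF outer[of N], of "hecke_coeff q (N + a)"] by simp
  qed
  then show "(\<lambda>N. h N * hecke_coeff q (N + a)) summable_on UNIV" by (auto simp: summable_on_def)
  from 1 2 show "(\<lambda>n. q powi tri (int n + 1) * w n * v n) sums (\<Sum>\<^sub>\<infinity>N. h N * hecke_coeff q (N + a))"
    by (simp add: infsumI)
qed

section \<open>Hecke-type sums, their shift relations and the evaluation of phi and psi\<close>

definition hecke_sum :: "int \<Rightarrow> complex" where
  "hecke_sum c = (\<Sum>\<^sub>\<infinity>N. alt_sign N * q powi (N * N + c * N) * hecke_coeff q N)"

text \<open>The second factor is the value of \<open>hecke_pairing q n 0\<close>, which is how the
  mock theta terms enter Bailey's lemma.\<close>

lemma qpoch_odd: "1 / qpoch q (q^2) (n + 1) = qpoch (- q) q n * (qpoch q q n / qpoch q q (2 * n + 1))"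
proof -
  have *: "qpoch q q (2 * n) = qpoch q (q^2) n * qpoch (q^2) (q^2) n" for n
    using qpoch_split2[of q q n] by (simp add: power2_eq_square)
  have "qpoch q q (2 * n + 1) = qpoch q (q^2) (n + 1) * (qpoch q q n * qpoch (- q) q n)"
    using *[of n] qpoch_square[of q q n] by (simp add: qpoch_Suc mult_ac flip: power_mult)
  moreover have "qpoch q q n \<noteq> 0" by (rule qpoch_nonzero[OF q1 q1])
  moreover have "qpoch (- q) q n \<noteq> 0" by (rule qpoch_nonzero[OF q1]) (use q1 in simp)
  moreover have "qpoch q (q^2) (n + 1) \<noteq> 0" by (rule qpoch_nonzero[OF norm_q2 q1])
  ultimately show ?thesis by simp
qed

lemma power_choose_eq: "q ^ ((n + 1) choose 2) = q powi tri (int n + 1)"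
  using powi_tri_nat[of q "n + 1"] by (simp add: add.commute)

text \<open>Bailey's lemma in the form \<open>bailey_swap\<close>. One factor q^(tri (N+1)) comes
  from the kernel and one from the Gauss sum; their product is q^(N^2 + N).\<close>

lemma mock_phi10_hecke: "theta_J12 q * mock_phi10 q = hecke_sum 1"
proof -
  obtain K where K: "\<And>n. norm (qpoch (- q) q n) \<le> K" using qpoch_bounded[OF q1] by blast
  obtain L where L: "\<And>m N. norm (fin_theta_odd q m N) \<le> L * norm (q powi tri N * q powi N)"
    using fin_theta_odd_bounded[OF q0 q1] by blast
  have "(\<lambda>n. q powi tri (int n + 1) * qpoch (- q) q n * hecke_pairing q n 0)
      sums (\<Sum>\<^sub>\<infinity>N. (alt_sign N * q powi tri (N + 1) * (q powi tri (N + 1) * bailey_ratio)) * hecke_coeff q (N + 0))"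
  proof (rule bailey_swap(1)[OF K L])
    show "hecke_pairing q n 0 = (\<Sum>\<^sub>\<infinity>N. fin_theta_odd q n N * hecke_coeff q (N + 0))" for n by (simp add: hecke_pairing_def[OF q0 q1])
    show "((\<lambda>n. q powi tri (int n + 1) * qpoch (- q) q n * fin_theta_odd q n N)
        has_sum (alt_sign N * q powi tri (N + 1) * (q powi tri (N + 1) * bailey_ratio))) UNIV" for N
      using has_sum_cmult_right[OF bailey_phi[of N], of "alt_sign N * q powi tri (N + 1)"]
      by (simp add: fin_theta_odd_def mult_ac)
  qed
  also have "(\<lambda>n. q powi tri (int n + 1) * qpoch (- q) q n * hecke_pairing q n 0) = (\<lambda>n. q ^ ((n + 1) choose 2) / qpoch q (q ^ 2) (n + 1))"
  proof
    fix n
    have "q powi tri (int n + 1) * qpoch (- q) q n * hecke_pairing q n 0 = q powi tri (int n + 1) * (1 / qpoch q (q^2) (n + 1))"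
      unfolding qpoch_odd hecke_pairing_0[OF q0 q1] by (simp only: mult.assoc)
    then show "q powi tri (int n + 1) * qpoch (- q) q n * hecke_pairing q n 0 = q ^ ((n + 1) choose 2) / qpoch q (q ^ 2) (n + 1)"
      unfolding power_choose_eq by simp
  qed
  also have "(\<Sum>\<^sub>\<infinity>N. (alt_sign N * q powi tri (N + 1) * (q powi tri (N + 1) * bailey_ratio)) * hecke_coeff q (N + 0)) = bailey_ratio * hecke_sum 1"
    unfolding hecke_sum_def
  proof (subst infsum_cmult_right'[symmetric], rule infsum_cong)
    fix N :: int
    have "tri (N + 1) + tri (N + 1) = N * N + 1 * N" using two_tri[of "N + 1"] by (simp add: algebra_simps)
    then have "q powi tri (N + 1) * q powi tri (N + 1) = q powi (N * N + 1 * N)"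
      using q0 by (simp flip: power_int_add)
    then show "(alt_sign N * q powi tri (N + 1) * (q powi tri (N + 1) * bailey_ratio)) * hecke_coeff q (N + 0)
        = bailey_ratio * (alt_sign N * q powi (N * N + 1 * N) * hecke_coeff q N)" by (simp add: mult_ac)
  qed
  finally have "mock_phi10 q = bailey_ratio * hecke_sum 1" unfolding mock_phi10_def by (rule sums_unique[symmetric])
  then show ?thesis using theta_J12_ratio by (simp add: bailey_ratio_def flip: mult.assoc)
qed

lemma quadratic_powi: "(q^2) powi tri N * (q powi (c + 1)) powi N = q powi (N * N + c * N)"
proof -
  have "(q^2) powi tri N = q powi (2 * tri N)" by (simp add: power_int_power)
  moreover have "(q powi (c + 1)) powi N = q powi ((c + 1) * N)" by (simp flip: power_int_mult)
  moreover have "2 * tri N + (c + 1) * N = N * N + c * N" using two_tri[of N] by (simp add: algebra_simps)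
  ultimately show ?thesis using q0 by (simp flip: power_int_add)
qed

lemma hecke_sum_summable: "(\<lambda>N. alt_sign N * q powi (N * N + c * N) * hecke_coeff q (N + a)) summable_on UNIV"
proof (rule abs_summable_summable)
  have "(\<lambda>N. norm ((q^2) powi tri N * (q powi (c + 1)) powi N * hecke_coeff q (N + a))) summable_on UNIV"
    using q0 q1 norm_q2 by (intro summable_theta_hecke_coeff) auto
  then show "(\<lambda>N. norm (alt_sign N * q powi (N * N + c * N) * hecke_coeff q (N + a))) summable_on UNIV"
    unfolding quadratic_powi by (simp add: norm_mult)
qed

lemma square_theta_abs_summable: "(\<lambda>N. norm (alt_sign N * q powi (N * N + c * N))) summable_on UNIV"
proof -
  have "(\<lambda>N. norm ((q^2) powi tri N * (q powi (c + 1)) powi N)) summable_on UNIV"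
    using q0 q1 norm_q2 by (intro abs_summable_theta) auto
  then show ?thesis unfolding quadratic_powi by (simp add: norm_mult)
qed

lemma square_theta_summable: "(\<lambda>N. alt_sign N * q powi (N * N + c * N)) summable_on UNIV"
  by (rule abs_summable_summable[OF square_theta_abs_summable])

definition square_theta :: "int \<Rightarrow> complex" where
  "square_theta c = (\<Sum>\<^sub>\<infinity>N. alt_sign N * q powi (N * N + c * N))"

text \<open>The reflection N -> -c - N preserves the exponent and, for odd c, reverses the
  sign.\<close>

lemma square_theta_odd:
  assumes "odd c"
  shows "square_theta c = 0"
  unfolding square_theta_def
proof (rule infsum_int_antisym[of _ "- c"])
  fix N :: int
  have "(- c - N) * (- c - N) + c * (- c - N) = N * N + c * N" by (simp add: algebra_simps)
  moreover have "alt_sign (- c - N) = - alt_sign N" using assms by (simp add: alt_sign_def)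
  ultimately show "alt_sign (- c - N) * q powi ((- c - N) * (- c - N) + c * (- c - N)) = - (alt_sign N * q powi (N * N + c * N))"
    by simp
qed

lemma square_theta_0: "square_theta 0 = theta_J12 q"
proof -
  have "theta_J12 q = (\<Sum>\<^sub>\<infinity>n. alt_sign n * (q^2) powi tri n * q powi n)"
    by (rule jacobi_triple_product) (use q0 norm_q2 in auto)
  also have "\<dots> = square_theta 0" unfolding square_theta_def
    unfolding quadratic_powi[symmetric] by (simp add: mult.assoc)
  finally show ?thesis ..
qed

lemma square_theta_even: "square_theta (2 * d) = alt_sign d * q powi (- d * d) * theta_J12 q"
proof -
  have "square_theta (2 * d) = (\<Sum>\<^sub>\<infinity>N. alt_sign (N - d) * q powi ((N - d) * (N - d) + 2 * d * (N - d)))"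
    unfolding square_theta_def using infsum_int_shift[of "\<lambda>N. alt_sign N * q powi (N * N + 2 * d * N)" "- d"] by simp
  also have "\<dots> = (\<Sum>\<^sub>\<infinity>N. alt_sign d * q powi (- d * d) * (alt_sign N * q powi (N * N + 0 * N)))"
  proof (rule infsum_cong)
    fix N :: int
    have e: "(N - d) * (N - d) + 2 * d * (N - d) = - d * d + (N * N + 0 * N)" by (simp add: algebra_simps)
    show "alt_sign (N - d) * q powi ((N - d) * (N - d) + 2 * d * (N - d))
        = alt_sign d * q powi (- d * d) * (alt_sign N * q powi (N * N + 0 * N))"
      unfolding e using q0 by (simp add: alt_sign_diff power_int_add del: mult_minus_left)
  qed
  also have "\<dots> = alt_sign d * q powi (- d * d) * theta_J12 q"
    unfolding square_theta_0[symmetric] square_theta_def by (rule infsum_cmult_right')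
  finally show ?thesis .
qed

text \<open>Shifting N by 2 lets the recurrence of the coefficients act: the square contributes 4 N
  and the factor q^(N+1) one more N, so c moves by 5, and the constant 2 leaves a pure theta
  series.\<close>

lemma hecke_sum_rec: "hecke_sum c = q powi (5 + 2 * c) * hecke_sum (c + 5) + 2 * square_theta c"
proof -
  have "hecke_sum c = (\<Sum>\<^sub>\<infinity>N. alt_sign (N + 2) * q powi ((N + 2) * (N + 2) + c * (N + 2)) * hecke_coeff q (N + 2))"
    unfolding hecke_sum_def by (rule infsum_int_shift[symmetric])
  also have "\<dots> = (\<Sum>\<^sub>\<infinity>N. q powi (5 + 2 * c) * (alt_sign N * q powi (N * N + (c + 5) * N) * hecke_coeff q (N + 0))
      + 2 * (alt_sign (N + 2) * q powi ((N + 2) * (N + 2) + c * (N + 2))))"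
  proof (rule infsum_cong)
    fix N :: int
    have "(N + 2) * (N + 2) + c * (N + 2) + (N + 1) = 5 + 2 * c + (N * N + (c + 5) * N)" by (simp add: algebra_simps)
    then have "q powi ((N + 2) * (N + 2) + c * (N + 2)) * q powi (N + 1) = q powi (5 + 2 * c) * q powi (N * N + (c + 5) * N)"
      using q0 by (simp only: power_int_add[symmetric] simp_thms)
    then show "alt_sign (N + 2) * q powi ((N + 2) * (N + 2) + c * (N + 2)) * hecke_coeff q (N + 2)
       = q powi (5 + 2 * c) * (alt_sign N * q powi (N * N + (c + 5) * N) * hecke_coeff q (N + 0))
      + 2 * (alt_sign (N + 2) * q powi ((N + 2) * (N + 2) + c * (N + 2)))"
      by (simp only: hecke_coeff_rec[OF q0] alt_sign_add add_0_right) (simp add: ring_distribs mult_ac)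
  qed
  also have "\<dots> = q powi (5 + 2 * c) * hecke_sum (c + 5) + 2 * (\<Sum>\<^sub>\<infinity>N. alt_sign (N + 2) * q powi ((N + 2) * (N + 2) + c * (N + 2)))"
  proof (subst infsum_add)
    show "(\<lambda>N. 2 * (alt_sign (N + 2) * q powi ((N + 2) * (N + 2) + c * (N + 2)))) summable_on UNIV"
      using summable_on_int_affine[OF square_theta_summable, of 1 2 c] by (intro summable_on_cmult_right) simp
  qed (use hecke_sum_summable[of "c + 5" 0] in \<open>auto intro!: summable_on_cmult_right simp: infsum_cmult_right' hecke_sum_def\<close>)
  also have "(\<Sum>\<^sub>\<infinity>N. alt_sign (N + 2) * q powi ((N + 2) * (N + 2) + c * (N + 2))) = square_theta c"
    unfolding square_theta_def by (rule infsum_int_shift)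
  finally show ?thesis .
qed

lemma hecke_sum_neg: "hecke_sum (- c) = 2 * square_theta c - hecke_sum c"
proof -
  have "hecke_sum (- c) = (\<Sum>\<^sub>\<infinity>N. alt_sign (- N) * q powi (- N * - N + - c * - N) * hecke_coeff q (- N))"
    unfolding hecke_sum_def by (rule infsum_int_neg[symmetric])
  also have "\<dots> = (\<Sum>\<^sub>\<infinity>N. 2 * (alt_sign N * q powi (N * N + c * N)) - alt_sign N * q powi (N * N + c * N) * hecke_coeff q (N + 0))"
    by (rule infsum_cong) (simp add: hecke_coeff_reflect algebra_simps)
  also have "\<dots> = 2 * square_theta c - hecke_sum c"
    by (subst infsum_minus)
       (use hecke_sum_summable[of c 0] in \<open>auto intro!: summable_on_cmult_right square_theta_summable simp: infsum_cmult_right' hecke_sum_def square_theta_def\<close>)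
  finally show ?thesis .
qed

text \<open>The Bailey kernel relative to 1, with the symmetric support -n <= N <= n.\<close>

definition fin_theta_even :: "nat \<Rightarrow> int \<Rightarrow> complex" where
  "fin_theta_even n N = alt_sign N * q powi tri (N + 1) * (inv_qfact q (int n - N) * inv_qfact q (int n + N))"

lemma fin_theta_even_Suc: "(1 - q ^ (2 * n + 2)) * fin_theta_even (Suc n) N = fin_theta_odd q n N - q ^ (n + 1) * fin_theta_odd q n (N - 1)"
proof -
  define A where "A = q ^ n"
  define B where "B = q powi N"
  define E where "E = fin_theta_even (Suc n) N"
  have B: "B \<noteq> 0" using q0 by (simp add: B_def)
  have a: "inv_qfact q (int n - N) = (1 - A * q / B) * inv_qfact q (int n + 1 - N)"
    and b: "inv_qfact q (int n + N) = (1 - A * B * q) * inv_qfact q (int n + N + 1)"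
    using inv_qfact_rec[OF q1, of "int n + 1 - N"] inv_qfact_rec[OF q1, of "int n + N + 1"] q0
    by (simp_all add: A_def B_def power_int_add power_int_diff mult_ac)
  have t: "q powi tri N = q powi tri (N + 1) / B"
    using q0 by (simp add: tri_Suc B_def power_int_add)
  have E: "E = alt_sign N * q powi tri (N + 1) * (inv_qfact q (int n + 1 - N) * inv_qfact q (int n + N + 1))"
    by (simp add: E_def fin_theta_even_def algebra_simps)
  have h1: "fin_theta_odd q n N = (1 - A * q / B) * E"
    unfolding fin_theta_odd_def a E by (simp add: mult_ac)
  have h2: "fin_theta_odd q n (N - 1) = - ((1 - A * B * q) / B * E)"
  proof -
    have "fin_theta_odd q n (N - 1) = - alt_sign N * q powi tri N * (inv_qfact q (int n + 1 - N) * inv_qfact q (int n + N))"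
      unfolding fin_theta_odd_def by (simp add: alt_sign_diff algebra_simps)
    then show ?thesis unfolding t b E by (simp add: mult_ac)
  qed
  have p: "q ^ (2 * n + 2) = A * A * q * q" "q ^ (n + 1) = A * q"
    by (simp_all add: A_def power_add power_mult power2_eq_square mult_ac)
  show ?thesis unfolding E_def[symmetric] h1 h2 p using B by (simp add: field_simps)
qed

text \<open>Up to the factor 1 - q^(2n+2) the sum is \<open>hecke_pairing q n 1\<close> minus
  q^(n+1) times \<open>hecke_pairing q n 2\<close>. Both are multiples of
  \<open>hecke_pairing q n 0\<close>, and the same factor reappears.\<close>

lemma fin_theta_even_pair_Suc: "(\<Sum>\<^sub>\<infinity>N. fin_theta_even (Suc n) N * hecke_coeff q (N + 1)) = hecke_pairing q n 0"
proof -
  have nz: "1 - q ^ (2 * n + 2) \<noteq> 0" by (rule one_minus_power_nonzero[OF q0 q1]) simp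
  note s = hecke_pairing_summable[OF q0 q1]
  have s2: "(\<lambda>N. fin_theta_odd q n (N - 1) * hecke_coeff q (N + 1)) summable_on UNIV"
    using summable_on_int_affine[OF s[of n 2], of 1 "-1"] by (simp add: algebra_simps)
  have "(1 - q ^ (2 * n + 2)) * (\<Sum>\<^sub>\<infinity>N. fin_theta_even (Suc n) N * hecke_coeff q (N + 1))
      = (\<Sum>\<^sub>\<infinity>N. ((1 - q ^ (2 * n + 2)) * fin_theta_even (Suc n) N) * hecke_coeff q (N + 1))"
    by (subst infsum_cmult_right'[symmetric]) (simp add: mult_ac)
  also have "\<dots> = (\<Sum>\<^sub>\<infinity>N. fin_theta_odd q n N * hecke_coeff q (N + 1) - q ^ (n + 1) * (fin_theta_odd q n (N - 1) * hecke_coeff q (N + 1)))"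
    unfolding fin_theta_even_Suc by (rule infsum_cong) (simp add: algebra_simps)
  also have "\<dots> = hecke_pairing q n 1 - q ^ (n + 1) * (\<Sum>\<^sub>\<infinity>N. fin_theta_odd q n (N - 1) * hecke_coeff q (N + 1))"
    unfolding hecke_pairing_def[OF q0 q1]
    by (subst infsum_minus) (simp_all only: infsum_cmult_right' s s2 summable_on_cmult_right)
  also have "(\<Sum>\<^sub>\<infinity>N. fin_theta_odd q n (N - 1) * hecke_coeff q (N + 1)) = hecke_pairing q n 2"
    unfolding hecke_pairing_def[OF q0 q1] using infsum_int_shift[of "\<lambda>N. fin_theta_odd q n N * hecke_coeff q (N + 2)" "-1"] by (simp add: algebra_simps)
  also have "hecke_pairing q n 2 = q ^ (n + 1) * hecke_pairing q n 0" by (rule hecke_pairing_2[OF q0 q1])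
  also have "hecke_pairing q n 1 = hecke_pairing q n 0" using hecke_pairing_reflect[OF q0 q1, of n 1] by simp
  also have "hecke_pairing q n 0 - q ^ (n + 1) * (q ^ (n + 1) * hecke_pairing q n 0) = (1 - q ^ (2 * n + 2)) * hecke_pairing q n 0"
    by (simp add: algebra_simps power_mult power_add power2_eq_square)
  finally show ?thesis using nz by (simp only: mult_cancel_left) simp
qed

lemma fin_theta_even_pair_0: "(\<Sum>\<^sub>\<infinity>N. fin_theta_even 0 N * hecke_coeff q (N + 1)) = 2"
proof -
  have "fin_theta_even 0 N = 0" if "N \<noteq> 0" for N
    using that by (cases "N > 0") (auto simp: fin_theta_even_def inv_qfact_neg)
  then have "(\<Sum>\<^sub>\<infinity>N. fin_theta_even 0 N * hecke_coeff q (N + 1)) = infsum (\<lambda>N. fin_theta_even 0 N * hecke_coeff q (N + 1)) {0}"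
    by (intro infsum_cong_neutral) auto
  then show ?thesis by (simp add: fin_theta_even_def)
qed

lemma mock_psi10_hecke: "theta_J12 q * mock_psi10 q = q * hecke_sum 2"
proof -
  obtain K where K: "\<And>n. norm (qpoch (- 1) q n) \<le> K" using qpoch_bounded[OF q1] by blast
  obtain L where L: "\<And>m N. norm (fin_theta_even m N) \<le> L * norm (q powi tri N * q powi N)"
    using bailey_kernel_bounded[OF q0 q1] unfolding fin_theta_even_def by metis
  define v where "v n = (\<Sum>\<^sub>\<infinity>N. fin_theta_even n N * hecke_coeff q (N + 1))" for n
  define h where "h N = alt_sign N * q powi tri (N + 1) * (q powi tri (N + 1) * 2 / (1 + q powi N) * bailey_ratio)" for N
  have outer: "((\<lambda>n. q powi tri (int n + 1) * qpoch (- 1) q n * fin_theta_even n N) has_sum h N) UNIV" for N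
    using has_sum_cmult_right[OF bailey_psi[of N], of "alt_sign N * q powi tri (N + 1)"]
    by (simp add: fin_theta_even_def h_def mult_ac)
  have sums: "(\<lambda>n. q powi tri (int n + 1) * qpoch (- 1) q n * v n) sums (\<Sum>\<^sub>\<infinity>N. h N * hecke_coeff q (N + 1))"
    and hs: "(\<lambda>N. h N * hecke_coeff q (N + 1)) summable_on UNIV"
    using bailey_swap[OF K L v_def outer] by blast+
  \<comment> \<open>Since (-1;q)_(n+1) = 2 (-q;q)_n, term n + 1 of this series is twice term n of
    psi. Term 0 equals 2, so the full series yields 1 + psi after halving.\<close>
  have terms: "q powi tri (int (Suc n) + 1) * qpoch (- 1) q (Suc n) * v (Suc n)
      = 2 * (q ^ ((n + 2) choose 2) / qpoch q (q ^ 2) (n + 1))" for n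
  proof -
    have "q powi tri (int (Suc n) + 1) * qpoch (- 1) q (Suc n) * v (Suc n)
        = 2 * (q ^ ((Suc n + 1) choose 2) * (qpoch (- q) q n * (qpoch q q n / qpoch q q (2 * n + 1))))"
      unfolding v_def fin_theta_even_pair_Suc hecke_pairing_0[OF q0 q1] power_choose_eq by (simp add: qpoch_Suc_left mult_ac)
    then show ?thesis unfolding qpoch_odd[symmetric] by simp
  qed
  have "(\<lambda>n. 2 * (q ^ ((n + 2) choose 2) / qpoch q (q ^ 2) (n + 1))) sums ((\<Sum>\<^sub>\<infinity>N. h N * hecke_coeff q (N + 1)) - 2)"
    using sums_Suc_iff[of "\<lambda>n. q powi tri (int n + 1) * qpoch (- 1) q n * v n"] sums
    unfolding terms by (simp add: v_def fin_theta_even_pair_0)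
  from sums_divide[OF this, of 2] have psi: "mock_psi10 q = (\<Sum>\<^sub>\<infinity>N. h N * hecke_coeff q (N + 1)) / 2 - 1"
    unfolding mock_psi10_def by (simp add: sums_iff diff_divide_distrib)
  define a where "a N = alt_sign N * q powi (N * N + N) / (1 + q powi N) * hecke_coeff q (N + 1)" for N
  have ha: "h N * hecke_coeff q (N + 1) = 2 * bailey_ratio * a N" for N
  proof -
    have "tri (N + 1) + tri (N + 1) = N * N + N" using two_tri[of "N + 1"] by (simp add: algebra_simps)
    then have "q powi tri (N + 1) * q powi tri (N + 1) = q powi (N * N + N)"
      using q0 by (simp flip: power_int_add)
    then show ?thesis by (simp add: h_def a_def mult_ac)
  qed
  have R0: "bailey_ratio \<noteq> 0" using theta_J12_ratio unfolding bailey_ratio_def by auto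
  have sa: "a summable_on UNIV"
    using summable_on_cmult_right[OF hs, of "1 / (2 * bailey_ratio)"] R0 unfolding ha by simp
  have sa': "(\<lambda>N. a (- N)) summable_on UNIV"
    using summable_on_int_affine[OF sa, of "-1" 0] by simp
  have Ja: "theta_J12 q * (1 + mock_psi10 q) = (\<Sum>\<^sub>\<infinity>N. a N)"
    using theta_J12_ratio unfolding psi ha infsum_cmult_right' bailey_ratio_def by (simp flip: mult.assoc)
  \<comment> \<open>Symmetrization removes the denominator: by reflection and recurrence, the
    combined numerator of the terms at N and -N is divisible by 1 + q^N.\<close>
  have aa: "a N + a (- N) = 2 * (alt_sign N * q powi (N * N + (- 1) * N))
      - alt_sign N * q powi (N * N + (- 1) * N) * hecke_coeff q (N + 1) + alt_sign N * q powi (N * N + 0 * N) * hecke_coeff q (N + 1)" for N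
  proof -
    define B where "B = q powi N"
    define Q where "Q = q powi (N * N)"
    define k where "k = hecke_coeff q (N + 1)"
    have B: "B \<noteq> 0" "1 + B \<noteq> 0" using q0 one_plus_power_nonzero by (auto simp: B_def)
    have "hecke_coeff q (N + 1) = B * hecke_coeff q (N - 1) + 2" using hecke_coeff_rec[OF q0, of "N - 1"] by (simp add: B_def add.commute)
    then have "hecke_coeff q (N - 1) = (k - 2) / B" using B by (simp add: k_def)
    moreover have "hecke_coeff q (- N + 1) = 2 - hecke_coeff q (N - 1)" using hecke_coeff_reflect[of q "N - 1"] by simp
    ultimately have k': "hecke_coeff q (- N + 1) = 2 - (k - 2) / B" by simp
    have e: "q powi (N * N + N) = Q * B" "q powi (- N * - N + - N) = Q / B" "q powi (N * N + (- 1) * N) = Q / B"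
      "q powi (N * N + 0 * N) = Q" "q powi (- N) = 1 / B"
      using q0 by (simp_all add: Q_def B_def power_int_add power_int_diff power_int_minus_divide)
    have "1 + 1 / B = (1 + B) / B" using B by (simp add: field_simps)
    then show ?thesis unfolding a_def e k' alt_sign_minus k_def[symmetric] B_def[symmetric]
      using B by (simp add: divide_simps) (simp add: algebra_simps)
  qed
  have "2 * (\<Sum>\<^sub>\<infinity>N. a N) = (\<Sum>\<^sub>\<infinity>N. a N + a (- N))"
    using infsum_add[OF sa sa'] infsum_int_neg[of a] by simp
  also have "\<dots> = 2 * square_theta (- 1) - (\<Sum>\<^sub>\<infinity>N. alt_sign N * q powi (N * N + (- 1) * N) * hecke_coeff q (N + 1))
      + (\<Sum>\<^sub>\<infinity>N. alt_sign N * q powi (N * N + 0 * N) * hecke_coeff q (N + 1))"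
  proof -
    have t: "(\<lambda>N. 2 * (alt_sign N * q powi (N * N + (- 1) * N))) summable_on UNIV"
      by (intro summable_on_cmult_right square_theta_summable)
    show ?thesis unfolding aa square_theta_def infsum_cmult_right'[symmetric]
      using infsum_add[OF summable_on_minus[OF t hecke_sum_summable[of "-1" 1]] hecke_sum_summable[of 0 1]]
        infsum_minus[OF t hecke_sum_summable[of "-1" 1]] by simp
  qed
  also have "square_theta (- 1) = 0" by (rule square_theta_odd) simp
  also have "(\<Sum>\<^sub>\<infinity>N. alt_sign N * q powi (N * N + (- 1) * N) * hecke_coeff q (N + 1)) = - (q^2) * hecke_sum (- 3)"
    unfolding hecke_sum_def infsum_cmult_right'[symmetric]
  proof (subst infsum_int_shift[symmetric, of _ "-1"], rule infsum_cong)
    fix N :: int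
    have e: "(N + - 1) * (N + - 1) + - 1 * (N + - 1) = (N * N + - 3 * N) + 2" by (simp add: algebra_simps)
    show "alt_sign (N + - 1) * q powi ((N + - 1) * (N + - 1) + - 1 * (N + - 1)) * hecke_coeff q (N + - 1 + 1)
        = - (q^2) * (alt_sign N * q powi (N * N + - 3 * N) * hecke_coeff q N)"
      unfolding e alt_sign_add using q0 by (simp add: power_int_add)
  qed
  also have "(\<Sum>\<^sub>\<infinity>N. alt_sign N * q powi (N * N + 0 * N) * hecke_coeff q (N + 1)) = - q * hecke_sum (- 2)"
    unfolding hecke_sum_def infsum_cmult_right'[symmetric]
  proof (subst infsum_int_shift[symmetric, of _ "-1"], rule infsum_cong)
    fix N :: int
    have e: "(N + - 1) * (N + - 1) + 0 * (N + - 1) = (N * N + - 2 * N) + 1" by (simp add: algebra_simps)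
    show "alt_sign (N + - 1) * q powi ((N + - 1) * (N + - 1) + 0 * (N + - 1)) * hecke_coeff q (N + - 1 + 1)
        = - q * (alt_sign N * q powi (N * N + - 2 * N) * hecke_coeff q N)"
      unfolding e alt_sign_add using q0 by (simp add: power_int_add)
  qed
  finally have main: "2 * (\<Sum>\<^sub>\<infinity>N. a N) = q^2 * hecke_sum (- 3) - q * hecke_sum (- 2)" by simp
  have "hecke_sum (- 3) = hecke_sum 2 / q" using hecke_sum_rec[of "-3"] square_theta_odd[of "-3"] q0 by (simp add: power_int_minus divide_inverse)
  then have "q^2 * hecke_sum (- 3) = q * hecke_sum 2" using q0 by (simp add: power2_eq_square)
  \<comment> \<open>The theta term arising here cancels the surplus 1 in 1 + psi.\<close>
  moreover have "q * hecke_sum (- 2) = - 2 * theta_J12 q - q * hecke_sum 2"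
  proof -
    have "q * square_theta 2 = - theta_J12 q" using square_theta_even[of 1] q0 by (simp add: power_int_minus)
    moreover have "q * hecke_sum (- 2) = 2 * (q * square_theta 2) - q * hecke_sum 2"
      unfolding hecke_sum_neg by (simp add: algebra_simps)
    ultimately show ?thesis by simp
  qed
  ultimately have "2 * (\<Sum>\<^sub>\<infinity>N. a N) = 2 * (q * hecke_sum 2 + theta_J12 q)"
    using main by simp
  then have "(\<Sum>\<^sub>\<infinity>N. a N) = q * hecke_sum 2 + theta_J12 q" by (metis mult_cancel_left zero_neq_numeral)
  with Ja show ?thesis by (simp add: algebra_simps)
qed

end

section \<open>Shifted Hecke sums\<close>

lemma norm_cube_root: "w ^ 3 = 1 \<Longrightarrow> norm (w :: complex) = 1"
  using power_eq_imp_eq_base[of "norm w" 3 1] by (metis norm_ge_zero norm_one norm_power power_one zero_le_one zero_less_numeral)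

lemma summable_convolution:
  fixes f g :: "int \<Rightarrow> complex"
  assumes f: "(\<lambda>x. norm (f x)) summable_on UNIV" and g: "(\<lambda>y. norm (g y)) summable_on UNIV"
  shows "(\<lambda>m. \<Sum>\<^sub>\<infinity>n. f n * g (m - n)) summable_on UNIV"
proof -
  have s: "(\<lambda>(x, y). f x * g y) summable_on UNIV \<times> UNIV"
    by (rule abs_summable_summable) (use infsum_times(1)[OF f g] in \<open>simp add: case_prod_unfold\<close>)
  have "(\<lambda>(m, n). f n * g (m - n)) summable_on UNIV \<times> UNIV"
    using s by (subst summable_on_reindex_bij_witness[of _ "\<lambda>(x, y). (x + y, x)" "\<lambda>(m, n). (n, m - n)" _ "\<lambda>(x, y). f x * g y"]) auto
  then show ?thesis using summable_on_Sigma_banach by fastforce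
qed

context
  fixes q :: complex
  assumes q0: "q \<noteq> 0" and q1: "norm q < 1"
begin

text \<open>The prefactor completes the square: by \<open>hecke_shift_eq\<close>, k merely
  translates the quadratic exponent against fixed Hecke coefficients. It also yields the symmetry k
  -> 1 - k.\<close>

definition hecke_shift :: "int \<Rightarrow> complex" where
  "hecke_shift k = alt_sign k * q powi (k * k - k) * hecke_sum q (1 - 2 * k)"

definition hecke_ratio :: "int \<Rightarrow> complex" where
  "hecke_ratio k = hecke_shift k / theta_J12 q"

lemma hecke_shift_eq: "hecke_shift k = (\<Sum>\<^sub>\<infinity>M. alt_sign (M - k) * q powi ((M - k) * (M - k) + (M - k)) * hecke_coeff q M)"
  unfolding hecke_shift_def hecke_sum_def[OF q0 q1] infsum_cmult_right'[symmetric]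
proof (rule infsum_cong)
  fix M :: int
  have e: "(M - k) * (M - k) + (M - k) = (k * k - k) + (M * M + (1 - 2 * k) * M)" by (simp add: algebra_simps)
  show "alt_sign k * q powi (k * k - k) * (alt_sign M * q powi (M * M + (1 - 2 * k) * M) * hecke_coeff q M) =
         alt_sign (M - k) * q powi ((M - k) * (M - k) + (M - k)) * hecke_coeff q M"
    unfolding e alt_sign_diff using q0 by (simp add: power_int_add)
qed

text \<open>Raising k by 5 lowers c = 1 - 2 k by 10, which is two uses of
  \<open>hecke_sum_rec\<close>. One of the two theta terms has odd argument and vanishes; the other
  is a monomial times J_{1,2}, and the quotient keeps only the monomial.\<close>

lemma hecke_ratio_rec: "hecke_ratio (k + 5) = - (q powi (2 * k + 4)) * hecke_ratio k - 2 * q powi (k + 3)"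
proof -
  have f1: "hecke_sum q (1 - 2 * (k + 5)) = q powi (- 13 - 4 * k) * hecke_sum q (- 4 - 2 * k)"
  proof -
    have e: "1 - 2 * (k + 5) = - 9 - 2 * k" "5 + 2 * (- 9 - 2 * k) = - 13 - 4 * k" "- 9 - 2 * k + 5 = - 4 - 2 * k"
      by simp_all
    have "square_theta q (- 9 - 2 * k) = 0" by (rule square_theta_odd[OF q0 q1]) simp
    then show ?thesis
      using hecke_sum_rec[OF q0 q1, of "- 9 - 2 * k"] by (simp only: e mult_zero_right add_0_right)
  qed
  have f2: "hecke_sum q (- 4 - 2 * k) = q powi (- 3 - 4 * k) * hecke_sum q (1 - 2 * k) + 2 * (alt_sign k * q powi (- ((k + 2) * (k + 2))) * theta_J12 q)"
  proof -
    have e: "- 4 - 2 * k = 2 * (- (k + 2))" "5 + 2 * (2 * (- (k + 2))) = - 3 - 4 * k" "2 * (- (k + 2)) + 5 = 1 - 2 * k"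
      "- (- (k + 2)) * - (k + 2) = - ((k + 2) * (k + 2))"
      by (simp_all add: algebra_simps)
    have m: "alt_sign (- (k + 2)) = alt_sign k" by (simp add: alt_sign_def)
    show ?thesis
      using hecke_sum_rec[OF q0 q1, of "2 * (- (k + 2))"] square_theta_even[OF q0 q1, of "- (k + 2)"] unfolding m e by (simp only: e)
  qed
  have "(k + 5) * (k + 5) - (k + 5) + (- 13 - 4 * k) + (- 3 - 4 * k) = (2 * k + 4) + (k * k - k)"
    by (simp add: algebra_simps)
  then have p1: "q powi ((k + 5) * (k + 5) - (k + 5)) * q powi (- 13 - 4 * k) * q powi (- 3 - 4 * k) = q powi (2 * k + 4) * q powi (k * k - k)"
    using q0 by (simp only: power_int_add[symmetric] simp_thms)
  have "(k + 5) * (k + 5) - (k + 5) + (- 13 - 4 * k) + (- ((k + 2) * (k + 2))) = k + 3"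
    by (simp add: algebra_simps)
  then have p2: "q powi ((k + 5) * (k + 5) - (k + 5)) * q powi (- 13 - 4 * k) * q powi (- ((k + 2) * (k + 2))) = q powi (k + 3)"
    using q0 by (simp only: power_int_add[symmetric] simp_thms)
  have m: "alt_sign (k + 5) = - alt_sign k" by (simp add: alt_sign_add)
  have "hecke_shift (k + 5) = - alt_sign k * ((q powi ((k + 5) * (k + 5) - (k + 5)) * q powi (- 13 - 4 * k) * q powi (- 3 - 4 * k)) * hecke_sum q (1 - 2 * k))
      - (alt_sign k * alt_sign k) * 2 * ((q powi ((k + 5) * (k + 5) - (k + 5)) * q powi (- 13 - 4 * k) * q powi (- ((k + 2) * (k + 2)))) * theta_J12 q)"
  proof -
    have alg: "- s * A * (B * (C * F + 2 * (s * P * J))) = - s * ((A * B * C) * F) - (s * s) * 2 * ((A * B * P) * J)"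
      for A B C F J P s :: complex by (simp add: algebra_simps)
    show ?thesis unfolding hecke_shift_def m f1 f2 by (rule alg)
  qed
  also have "\<dots> = - (q powi (2 * k + 4)) * hecke_shift k - 2 * (q powi (k + 3) * theta_J12 q)"
    unfolding p1 p2 hecke_shift_def alt_sign_square by (simp only: mult_1_left mult_minus_left mult_minus_right mult.assoc mult.left_commute)
  finally show ?thesis
    using theta_J12_nonzero[OF q0 q1] by (simp add: hecke_ratio_def field_simps)
qed

lemma hecke_ratio_reflect: "hecke_ratio (1 - k) = hecke_ratio k"
proof -
  have e: "(1 - k) * (1 - k) - (1 - k) = k * k - k" "1 - 2 * (1 - k) = - (1 - 2 * k)"
    by (simp_all add: algebra_simps)
  have "square_theta q (1 - 2 * k) = 0" by (rule square_theta_odd[OF q0 q1]) simp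
  then show ?thesis unfolding hecke_ratio_def hecke_shift_def e hecke_sum_neg[OF q0 q1] by (simp add: alt_sign_diff)
qed

text \<open>The value at 3 is explicit because the recurrence at k = -2 leads from -2 to 3, two
  indices exchanged by the reflection.\<close>

lemma hecke_ratio_values: "hecke_ratio 0 = mock_phi10 q" "hecke_ratio 1 = mock_phi10 q" "hecke_ratio 2 = mock_psi10 q" "hecke_ratio (- 1) = mock_psi10 q" "hecke_ratio 3 = - q"
proof -
  note J = theta_J12_nonzero[OF q0 q1]
  have "hecke_shift 0 = theta_J12 q * mock_phi10 q" unfolding mock_phi10_hecke[OF q0 q1] by (simp add: hecke_shift_def)
  then show 0: "hecke_ratio 0 = mock_phi10 q" using J by (simp add: hecke_ratio_def)
  then show "hecke_ratio 1 = mock_phi10 q" using hecke_ratio_reflect[of 0] by simp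
  have "q * hecke_sum q (- 3) = hecke_sum q 2"
    using hecke_sum_rec[OF q0 q1, of "-3"] square_theta_odd[OF q0 q1, of "-3"] q0 by (simp add: power_int_minus field_simps)
  then have "hecke_shift 2 = theta_J12 q * mock_psi10 q"
    unfolding mock_psi10_hecke[OF q0 q1] by (simp add: hecke_shift_def power2_eq_square mult_ac)
  then show 2: "hecke_ratio 2 = mock_psi10 q" using J by (simp add: hecke_ratio_def)
  then show "hecke_ratio (- 1) = mock_psi10 q" using hecke_ratio_reflect[of 2] by simp
  have "2 * hecke_ratio 3 = 2 * (- q)" using hecke_ratio_rec[of "-2"] hecke_ratio_reflect[of "-2"] by simp
  then show "hecke_ratio 3 = - q" by (metis mult_cancel_left zero_neq_numeral)
qed

text \<open>The rate r = sqrt |q| leaves room for the inhomogeneity: 2 |q|^(m+3) = 2 r^(2m+6) is at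
  most 2 r^(m+5). The induction then closes once M r + 2 <= M, and the finite sum in
  \<open>M\<close> covers the five initial values.\<close>

lemma hecke_ratio_bound:
  obtains M where "\<And>n. norm (hecke_ratio (int n)) \<le> M * sqrt (norm q) ^ n"
proof -
  define r where "r = sqrt (norm q)"
  have r: "0 < r" "r < 1" and r2: "norm q = r * r" using q0 q1 by (auto simp: r_def)
  define M where "M = 2 / (1 - r) + (\<Sum>i<5. norm (hecke_ratio (int i)) / r ^ i)"
  have M0: "2 / (1 - r) \<le> M" unfolding M_def using r by (intro add_increasing2 sum_nonneg) auto
  then have M2: "2 \<le> M * (1 - r)" using r by (simp add: field_simps)
  have M1: "0 \<le> M" using M0 r by (smt (verit) divide_nonneg_pos)
  have "norm (hecke_ratio (int n)) \<le> M * r ^ n" for n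
  proof (induction n rule: less_induct)
    case (less n)
    show ?case
    proof (cases "n < 5")
      case True
      have "norm (hecke_ratio (int n)) / r ^ n \<le> (\<Sum>i<5. norm (hecke_ratio (int i)) / r ^ i)"
        using True r by (intro member_le_sum) auto
      also have "\<dots> \<le> M" unfolding M_def using r by simp
      finally show ?thesis using r by (simp add: field_simps)
    next
      case False
      then obtain m where m: "n = m + 5" using le_Suc_ex[of 5 n] by (auto simp: add.commute)
      have i: "int n = int m + 5" using m by simp
      have e: "q powi (2 * int m + 4) = q ^ (2 * m + 4)" "q powi (int m + 3) = q ^ (m + 3)"
        using power_int_of_nat[of q "2 * m + 4"] power_int_of_nat[of q "m + 3"] by (simp_all add: algebra_simps)
      have "norm (hecke_ratio (int n)) \<le> norm q ^ (2 * m + 4) * norm (hecke_ratio (int m)) + 2 * norm q ^ (m + 3)"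
        unfolding i hecke_ratio_rec e
        using norm_triangle_ineq4[of "- (q ^ (2 * m + 4)) * hecke_ratio (int m)" "2 * q ^ (m + 3)"] by (simp add: norm_mult norm_power)
      also have "\<dots> \<le> norm q ^ (2 * m + 4) * (M * r ^ m) + 2 * norm q ^ (m + 3)"
        using less[of m] m by (intro add_mono mult_left_mono) auto
      also have "\<dots> = r ^ (m + 5) * (M * r ^ (4 * m + 3) + 2 * r ^ (m + 1))"
        unfolding r2 by (simp add: power_add power_mult eval_nat_numeral power_mult_distrib algebra_simps)
      also have "\<dots> \<le> r ^ (m + 5) * (M * r + 2 * 1)"
      proof -
        have "r ^ (4 * m + 3) \<le> r ^ 1" by (rule power_decreasing) (use r in auto)
        moreover have "r ^ (m + 1) \<le> 1" by (rule power_le_one) (use r in auto)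
        ultimately show ?thesis using r M1 by (intro mult_left_mono add_mono) auto
      qed
      also have "\<dots> \<le> r ^ (m + 5) * M" using M2 r by (intro mult_left_mono) (auto simp: algebra_simps)
      finally show ?thesis by (simp add: m mult.commute)
    qed
  qed
  then show ?thesis using that unfolding r_def by blast
qed

lemma hecke_ratio_abs_summable: "(\<lambda>k. norm (hecke_ratio k)) summable_on UNIV"
proof (rule abs_summable_on_int)
  obtain M where M: "\<And>n. norm (hecke_ratio (int n)) \<le> M * sqrt (norm q) ^ n" using hecke_ratio_bound by blast
  have s: "summable (\<lambda>n. M * sqrt (norm q) ^ n)"
    using q1 by (intro summable_mult summable_geometric) auto
  show a: "summable (\<lambda>n. norm (hecke_ratio (int n)))"
    by (rule summable_comparison_test'[OF s]) (use M in simp)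
  have "hecke_ratio (- int n - 1) = hecke_ratio (int (n + 2))" for n
    using hecke_ratio_reflect[of "- int n - 1"] by (simp add: algebra_simps)
  then show "summable (\<lambda>n. norm (hecke_ratio (- int n - 1)))"
    using summable_ignore_initial_segment[OF a, of 2] by simp
qed

text \<open>The coefficient of z^m in the formal product of the series of j(z; q) with the sum of
  all \<open>hecke_coeff q M\<close> z^M.\<close>

definition hecke_conv :: "int \<Rightarrow> complex" where
  "hecke_conv m = (\<Sum>\<^sub>\<infinity>M. alt_sign (m - M) * q powi tri (m - M) * hecke_coeff q M)"

lemma tri_shift_summable: "(\<lambda>M. norm (alt_sign (m - M) * q powi tri (m - M) * hecke_coeff q M)) summable_on UNIV"
proof -
  have "(\<lambda>n. norm (q powi tri n * 1 powi n * hecke_coeff q (m - n))) summable_on UNIV"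
  proof -
    have "(\<lambda>n. norm (q powi tri n * q powi n * hecke_coeff q (n + m))) summable_on UNIV"
      using q0 q1 by (intro summable_theta_hecke_coeff) auto
    then have "(\<lambda>n. norm (q powi tri (- n) * hecke_coeff q (m + n))) summable_on UNIV"
      using q0 by (simp add: tri_minus power_int_add add.commute mult_ac)
    from summable_on_int_affine[OF this, of "-1" 0] show ?thesis by simp
  qed
  from summable_on_int_affine[OF this, of "-1" m] show ?thesis by (simp add: norm_mult)
qed

text \<open>This is j(1; q) = 0. It removes the inhomogeneous terms from the relations for
  \<open>hecke_conv\<close>.\<close>

lemma theta_one: "(\<Sum>\<^sub>\<infinity>M. alt_sign (m - M) * q powi tri (m - M)) = 0"
proof (rule infsum_int_antisym[of _ "2 * m - 1"])
  fix M :: int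
  have e: "m - (2 * m - 1 - M) = 1 - (m - M)" by simp
  show "alt_sign (m - (2 * m - 1 - M)) * q powi tri (m - (2 * m - 1 - M)) = - (alt_sign (m - M) * q powi tri (m - M))"
    unfolding e tri_reflect by (simp add: alt_sign_def)
qed

lemma tri_shift_summable1: "(\<lambda>M. alt_sign (m - M) * q powi tri (m - M)) summable_on UNIV"
proof -
  have "(\<lambda>n. norm (q powi tri n * 1 powi n)) summable_on UNIV"
    using q0 q1 by (intro abs_summable_theta) auto
  from summable_on_int_affine[OF this, of "-1" m]
  have "(\<lambda>M. norm (alt_sign (m - M) * q powi tri (m - M))) summable_on UNIV" by (simp add: norm_mult)
  then show ?thesis by (rule abs_summable_summable)
qed

text \<open>After the shift M -> M + 2, tri (m - M + 1) + (M + 1) = (m + 1) + tri (m - M) pulls a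
  factor free of M out of the sum. Three values therefore determine the whole sequence.\<close>

lemma hecke_conv_rec: "hecke_conv (m + 3) = - (q powi (m + 1)) * hecke_conv m"
proof -
  have "hecke_conv (m + 3) = (\<Sum>\<^sub>\<infinity>M. alt_sign (m + 3 - (M + 2)) * q powi tri (m + 3 - (M + 2)) * hecke_coeff q (M + 2))"
    unfolding hecke_conv_def by (rule infsum_int_shift[symmetric])
  also have "\<dots> = (\<Sum>\<^sub>\<infinity>M. - (q powi (m + 1)) * (alt_sign (m - M) * q powi tri (m - M) * hecke_coeff q M) + 2 * (alt_sign (m + 1 - M) * q powi tri (m + 1 - M)))"
  proof (rule infsum_cong)
    fix M :: int
    have e: "m + 3 - (M + 2) = (m - M) + 1" "m + 1 - M = (m - M) + 1" by simp_all
    have t: "tri (m - M + 1) + (M + 1) = (m + 1) + tri (m - M)" by (simp add: tri_Suc)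
    then have p: "q powi tri (m - M + 1) * q powi (M + 1) = q powi (m + 1) * q powi tri (m - M)"
      using q0 by (simp only: power_int_add[symmetric] simp_thms)
    have "alt_sign (m - M + 1) * q powi tri (m - M + 1) * (q powi (M + 1) * hecke_coeff q M + 2)
        = alt_sign (m - M + 1) * (q powi tri (m - M + 1) * q powi (M + 1)) * hecke_coeff q M + 2 * (alt_sign (m - M + 1) * q powi tri (m - M + 1))"
      by (simp add: algebra_simps)
    then show "alt_sign (m + 3 - (M + 2)) * q powi tri (m + 3 - (M + 2)) * hecke_coeff q (M + 2) =
         - (q powi (m + 1)) * (alt_sign (m - M) * q powi tri (m - M) * hecke_coeff q M) + 2 * (alt_sign (m + 1 - M) * q powi tri (m + 1 - M))"
      unfolding e hecke_coeff_rec[OF q0] p by (simp add: alt_sign_add)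
  qed
  also have "\<dots> = - (q powi (m + 1)) * hecke_conv m + 2 * (\<Sum>\<^sub>\<infinity>M. alt_sign (m + 1 - M) * q powi tri (m + 1 - M))"
    unfolding hecke_conv_def infsum_cmult_right'[symmetric]
    by (intro infsum_add summable_on_cmult_right tri_shift_summable1 abs_summable_summable[OF tri_shift_summable])
  finally show ?thesis by (simp add: theta_one)
qed

lemma hecke_conv_reflect: "hecke_conv (- m) = hecke_conv (m + 1)"
proof -
  have "hecke_conv (- m) = (\<Sum>\<^sub>\<infinity>M. alt_sign (- m - (- M)) * q powi tri (- m - (- M)) * hecke_coeff q (- M))"
    unfolding hecke_conv_def by (rule infsum_int_neg[symmetric])
  also have "\<dots> = (\<Sum>\<^sub>\<infinity>M. alt_sign (m + 1 - M) * q powi tri (m + 1 - M) * hecke_coeff q M - 2 * (alt_sign (m + 1 - M) * q powi tri (m + 1 - M)))"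
  proof (rule infsum_cong)
    fix M :: int
    have e: "- m - - M = 1 - (m + 1 - M)" by simp
    have s: "alt_sign (1 - (m + 1 - M)) = - alt_sign (m + 1 - M)" by (simp add: alt_sign_def)
    show "alt_sign (- m - - M) * q powi tri (- m - - M) * hecke_coeff q (- M)
        = alt_sign (m + 1 - M) * q powi tri (m + 1 - M) * hecke_coeff q M - 2 * (alt_sign (m + 1 - M) * q powi tri (m + 1 - M))"
      unfolding e tri_reflect s hecke_coeff_reflect by (simp only: ring_distribs mult_minus_left mult_ac) simp
  qed
  also have "\<dots> = hecke_conv (m + 1) - 2 * (\<Sum>\<^sub>\<infinity>M. alt_sign (m + 1 - M) * q powi tri (m + 1 - M))"
    unfolding hecke_conv_def infsum_cmult_right'[symmetric]
    by (intro infsum_minus summable_on_cmult_right tri_shift_summable1 abs_summable_summable[OF tri_shift_summable])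
  finally show ?thesis by (simp add: theta_one)
qed

text \<open>At 0 this is \<open>infsum_hecke_coeff\<close>, at 1 its reflection. At 2, reflection
  and recurrence both lead to index -1, with opposite signs.\<close>

lemma hecke_conv_values: "hecke_conv 0 = (qpoch_inf q q)^2" "hecke_conv 1 = (qpoch_inf q q)^2" "hecke_conv 2 = 0"
proof -
  have "hecke_conv 0 = (\<Sum>\<^sub>\<infinity>N. alt_sign N * q powi tri (N + 1) * hecke_coeff q N)"
    unfolding hecke_conv_def by (rule infsum_cong) (simp add: tri_minus tri_Suc)
  then show 0: "hecke_conv 0 = (qpoch_inf q q)^2" using infsum_hecke_coeff[OF q0 q1] by simp
  show "hecke_conv 1 = (qpoch_inf q q)^2" using hecke_conv_reflect[of 0] 0 by simp
  have "hecke_conv 2 = - hecke_conv 2" using hecke_conv_reflect[of 1] hecke_conv_rec[of "-1"] by simp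
  then show "hecke_conv 2 = 0" by (simp add: eq_neg_iff_add_eq_0)
qed

end

lemma int_recurrence:
  fixes f :: "int \<Rightarrow> complex"
  assumes q0: "q \<noteq> 0" and rec: "\<And>n. f (n + 1) = - (q powi (a * n + b)) * f n"
  shows "f n = alt_sign n * q powi (a * tri n + b * n) * f 0"
proof (induction n rule: int_induct[where k = 0])
  case (step1 n)
  have "a * tri (n + 1) + b * (n + 1) = (a * n + b) + (a * tri n + b * n)" by (simp add: tri_Suc algebra_simps)
  then show ?case using q0 rec[of n] step1 by (simp add: alt_sign_add power_int_add)
next
  case (step2 n)
  have e: "a * tri n + b * n = (a * (n - 1) + b) + (a * tri (n - 1) + b * (n - 1))"
  proof -
    have t: "tri n = tri (n - 1) + (n - 1)" using tri_Suc(2)[of "n - 1"] by simp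
    show ?thesis unfolding t by (simp add: algebra_simps)
  qed
  define A where "A = q powi (a * (n - 1) + b)"
  define B where "B = q powi (a * tri (n - 1) + b * (n - 1))"
  have A: "A \<noteq> 0" using q0 by (simp add: A_def)
  have "f n = - A * f (n - 1)" using rec[of "n - 1"] by (simp add: A_def)
  moreover have "f n = alt_sign n * (A * B) * f 0"
    using step2 q0 unfolding e by (simp add: A_def B_def power_int_add)
  ultimately have "A * f (n - 1) = A * (- alt_sign n * B * f 0)" by (simp add: mult_ac)
  then have "f (n - 1) = - alt_sign n * B * f 0" using A by (simp only: mult_cancel_left) simp
  then show ?case by (simp add: B_def alt_sign_diff)
qed simp

section \<open>Shifted Hecke sums at cube roots of unity\<close>

lemma infsum_pair:
  fixes F :: "'a \<times> 'b \<Rightarrow> complex"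
  assumes "F summable_on UNIV \<times> UNIV"
  shows "infsum F (UNIV \<times> UNIV) = (\<Sum>\<^sub>\<infinity>x. \<Sum>\<^sub>\<infinity>y. F (x, y))"
  by (rule infsum_Sigma_banach[OF assms, symmetric])

context
  fixes q :: complex
  assumes q0: "q \<noteq> 0" and q1: "norm q < 1"
begin

text \<open>Every triangular number is 2 j^2 + j for exactly one integer j, so this is Ramanujan's
  psi(q), half of the sum of q^(tri n) over all integers n.\<close>

definition half_theta :: complex where
  "half_theta = (\<Sum>\<^sub>\<infinity>j. q powi (2 * (j * j) + j))"

text \<open>For even d, translation by d / 2 completes the square. For odd d that translation is not
  integral, but the reflection j -> (d - 1) / 2 - j has the same effect.\<close>

lemma half_theta_shift: "q powi (d * d - d) * (\<Sum>\<^sub>\<infinity>j. q powi (2 * (j * j) + (1 - 2 * d) * j)) = q powi tri d * half_theta"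
proof (cases "even d")
  case True
  then obtain e where d: "d = 2 * e" by blast
  have "(\<Sum>\<^sub>\<infinity>j. q powi (2 * (j * j) + (1 - 2 * d) * j))
      = (\<Sum>\<^sub>\<infinity>j. q powi (2 * ((j + e) * (j + e)) + (1 - 2 * d) * (j + e)))"
    by (rule infsum_int_shift[symmetric])
  then show ?thesis unfolding half_theta_def
  proof (simp only: infsum_cmult_right'[symmetric], intro infsum_cong)
    fix j :: int
    have "d * d - d + (2 * ((j + e) * (j + e)) + (1 - 2 * d) * (j + e)) = tri d + (2 * (j * j) + j)"
      using two_tri[of d] unfolding d by (simp add: algebra_simps)
    then show "q powi (d * d - d) * q powi (2 * ((j + e) * (j + e)) + (1 - 2 * d) * (j + e)) = q powi tri d * q powi (2 * (j * j) + j)"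
      using q0 by (simp only: power_int_add[symmetric] simp_thms)
  qed
next
  case False
  then obtain e where d: "d = 1 - 2 * e" by (metis add_diff_cancel_left' diff_diff_eq2 dvd_def even_minus odd_even_add odd_one uminus_add_conv_diff diff_add_cancel)
  have "(\<Sum>\<^sub>\<infinity>j. q powi (2 * (j * j) + (1 - 2 * d) * j))
      = (\<Sum>\<^sub>\<infinity>j. q powi (2 * ((- e - j) * (- e - j)) + (1 - 2 * d) * (- e - j)))"
    by (rule infsum_int_reflect[symmetric])
  then show ?thesis unfolding half_theta_def
  proof (simp only: infsum_cmult_right'[symmetric], intro infsum_cong)
    fix j :: int
    have "d * d - d + (2 * ((- e - j) * (- e - j)) + (1 - 2 * d) * (- e - j)) = tri d + (2 * (j * j) + j)"
      using two_tri[of d] unfolding d by (simp add: algebra_simps)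
    then show "q powi (d * d - d) * q powi (2 * ((- e - j) * (- e - j)) + (1 - 2 * d) * (- e - j)) = q powi tri d * q powi (2 * (j * j) + j)"
      using q0 by (simp only: power_int_add[symmetric] simp_thms)
  qed
qed

text \<open>In the variables j and d = j - N the exponent is d^2 - d + 2 j^2 + (1 - 2 d) j. By
  \<open>half_theta_shift\<close> the sum over j depends on d only through q^(tri d), so
  \<open>half_theta\<close> factors out and the sum over d is \<open>hecke_conv\<close>.\<close>

lemma hecke_shift_convolution:
  "(\<Sum>\<^sub>\<infinity>k. hecke_shift q k * (alt_sign (m - k) * q powi ((m - k) * (m - k)))) = half_theta * hecke_conv q m"
proof -
  define F where "F j N = alt_sign N * q powi (N * N + N) * hecke_coeff q (N + (m - j)) * (alt_sign j * q powi (j * j))" for j N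
  \<comment> \<open>The linear weights in \<open>A\<close> and \<open>B\<close> majorize the growth
    of the Hecke coefficient at N + m - j by a product of a function of j and a function of
    N.\<close>
  define A where "A j = of_int (\<bar>j\<bar> + 1) * ((q^2) powi tri j * q powi j)" for j
  define B where "B N = of_int (\<bar>N\<bar> + (\<bar>m\<bar> + 2)) * ((q^2) powi tri N * (q powi (1 + 1)) powi N)" for N
  have q2: "q^2 \<noteq> 0" "norm (q^2) < 1" using q0 norm_q2[OF q0 q1] by auto
  have A: "(\<lambda>j. norm (A j)) summable_on UNIV"
    unfolding A_def by (rule abs_summable_theta_lin[OF q2 q0])
  have B: "(\<lambda>N. norm (B N)) summable_on UNIV"
    unfolding B_def by (rule abs_summable_theta_lin[OF q2]) (use q0 in simp)
  have bound: "norm (F j N) \<le> norm (A j * B N)" for j N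
  proof -
    have Aj: "norm (A j) = of_int (\<bar>j\<bar> + 1) * norm (q powi (j * j))"
    proof -
      have "(q^2) powi tri j * q powi j = q powi (j * j)" using quadratic_powi[OF q0 q1, of j 0] by simp
      then show ?thesis unfolding A_def by (simp only: norm_mult[of "of_int _"] norm_of_int)
    qed
    have BN: "norm (B N) = of_int (\<bar>N\<bar> + (\<bar>m\<bar> + 2)) * norm (q powi (N * N + N))"
      unfolding B_def quadratic_powi[OF q0 q1] by (simp only: norm_mult norm_of_int) simp
    have "norm (hecke_coeff q (N + (m - j))) \<le> of_int (\<bar>N + (m - j)\<bar> + 2)"
      by (rule norm_hecke_coeff_le) (use q1 in simp)
    also have "\<dots> \<le> of_int ((\<bar>j\<bar> + 1) * (\<bar>N\<bar> + (\<bar>m\<bar> + 2)))"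
    proof -
      have "0 \<le> \<bar>j\<bar> * (\<bar>N\<bar> + \<bar>m\<bar> + 1)" by simp
      then have "\<bar>N + (m - j)\<bar> + 2 \<le> (\<bar>j\<bar> + 1) * (\<bar>N\<bar> + (\<bar>m\<bar> + 2))"
        unfolding ring_distribs by linarith
      then show ?thesis by (simp only: of_int_le_iff)
    qed
    finally have "norm (hecke_coeff q (N + (m - j))) * (norm (q powi (N * N + N)) * norm (q powi (j * j)))
       \<le> of_int ((\<bar>j\<bar> + 1) * (\<bar>N\<bar> + (\<bar>m\<bar> + 2))) * (norm (q powi (N * N + N)) * norm (q powi (j * j)))"
      by (intro mult_right_mono) auto
    then show ?thesis unfolding F_def norm_mult[of "A j"] Aj BN
      by (simp only: norm_mult norm_alt_sign of_int_mult mult_1_left mult_ac)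
  qed
  have s: "(\<lambda>(j, N). F j N) summable_on UNIV \<times> UNIV"
  proof (rule abs_summable_summable, rule Infinite_Sum.abs_summable_on_comparison_test'[OF infsum_times(1)[OF A B]])
    fix x :: "int \<times> int"
    show "norm (case x of (j, N) \<Rightarrow> F j N) \<le> (case x of (j, N) \<Rightarrow> norm (A j * B N))"
      using bound by (simp add: case_prod_unfold)
  qed
  have "(\<Sum>\<^sub>\<infinity>k. hecke_shift q k * (alt_sign (m - k) * q powi ((m - k) * (m - k))))
      = (\<Sum>\<^sub>\<infinity>j. hecke_shift q (m - j) * (alt_sign (m - (m - j)) * q powi ((m - (m - j)) * (m - (m - j)))))"
    by (rule infsum_int_reflect[symmetric])
  also have "\<dots> = (\<Sum>\<^sub>\<infinity>j. \<Sum>\<^sub>\<infinity>N. F j N)"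
  proof (rule infsum_cong)
    fix j
    have "hecke_shift q (m - j) = (\<Sum>\<^sub>\<infinity>N. alt_sign (N + (m - j) - (m - j)) * q powi ((N + (m - j) - (m - j)) * (N + (m - j) - (m - j)) + (N + (m - j) - (m - j))) * hecke_coeff q (N + (m - j)))"
      unfolding hecke_shift_eq[OF q0 q1] by (rule infsum_int_shift[symmetric])
    then have "hecke_shift q (m - j) = (\<Sum>\<^sub>\<infinity>N. alt_sign N * q powi (N * N + N) * hecke_coeff q (N + (m - j)))" by simp
    then show "hecke_shift q (m - j) * (alt_sign (m - (m - j)) * q powi ((m - (m - j)) * (m - (m - j)))) = (\<Sum>\<^sub>\<infinity>N. F j N)"
      unfolding F_def infsum_cmult_left' by simp
  qed
  also have "\<dots> = infsum (\<lambda>(j, N). F j N) (UNIV \<times> UNIV)"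
    by (subst infsum_pair[OF s]) simp
  also have "\<dots> = infsum (\<lambda>(d, j). F j (j - d)) (UNIV \<times> UNIV)"
    by (rule infsum_reindex_bij_witness[of _ "\<lambda>(d, j). (j, j - d)" "\<lambda>(j, N). (j - N, j)"]) auto
  also have "\<dots> = (\<Sum>\<^sub>\<infinity>d. \<Sum>\<^sub>\<infinity>j. F j (j - d))"
  proof (subst infsum_pair)
    show "(\<lambda>(d, j). F j (j - d)) summable_on UNIV \<times> UNIV"
      using s by (subst summable_on_reindex_bij_witness[of _ "\<lambda>(j, N). (j - N, j)" "\<lambda>(d, j). (j, j - d)" _ "\<lambda>(j, N). F j N"]) auto
  qed simp
  also have "\<dots> = (\<Sum>\<^sub>\<infinity>d. half_theta * (alt_sign d * q powi tri d * hecke_coeff q (m - d)))"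
  proof (rule infsum_cong)
    fix d
    have "(\<Sum>\<^sub>\<infinity>j. F j (j - d)) = (\<Sum>\<^sub>\<infinity>j. alt_sign d * hecke_coeff q (m - d) * (q powi (d * d - d) * q powi (2 * (j * j) + (1 - 2 * d) * j)))"
    proof (rule infsum_cong)
      fix j
      have "(j - d) * (j - d) + (j - d) + j * j = d * d - d + (2 * (j * j) + (1 - 2 * d) * j)" by (simp add: algebra_simps)
      then have e: "q powi ((j - d) * (j - d) + (j - d)) * q powi (j * j) = q powi (d * d - d) * q powi (2 * (j * j) + (1 - 2 * d) * j)"
        using q0 by (simp only: power_int_add[symmetric] simp_thms)
      have "F j (j - d) = (alt_sign j * alt_sign j) * alt_sign d * hecke_coeff q (j - d + (m - j)) * (q powi ((j - d) * (j - d) + (j - d)) * q powi (j * j))"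
        unfolding F_def alt_sign_diff by (simp only: mult_ac)
      then show "F j (j - d) = alt_sign d * hecke_coeff q (m - d) * (q powi (d * d - d) * q powi (2 * (j * j) + (1 - 2 * d) * j))"
        unfolding e by simp
    qed
    then show "(\<Sum>\<^sub>\<infinity>j. F j (j - d)) = half_theta * (alt_sign d * q powi tri d * hecke_coeff q (m - d))"
      unfolding infsum_cmult_right' half_theta_shift by (simp add: mult_ac)
  qed
  also have "\<dots> = half_theta * hecke_conv q m"
    unfolding infsum_cmult_right' hecke_conv_def[OF q0 q1]
    using infsum_int_reflect[of "\<lambda>d. alt_sign d * q powi tri d * hecke_coeff q (m - d)" m] by simp
  finally show ?thesis .
qed

section \<open>Evaluation at cube roots of unity\<close>

lemma powi_linear: "(q ^ a) powi m = q powi (int a * m)" "(q powi b) powi n = q powi (b * n)"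
  by (rule power_int_power, rule power_int_mult[symmetric])

lemma theta_series_linear:
  assumes "a > 0"
  shows "theta_j (q powi b) (q ^ a) = (\<Sum>\<^sub>\<infinity>n. alt_sign n * q powi (int a * tri n + b * n))"
proof -
  have "theta_j (q powi b) (q ^ a) = (\<Sum>\<^sub>\<infinity>n. alt_sign n * (q ^ a) powi tri n * (q powi b) powi n)"
    using q0 norm_power_less_1[OF q0 q1 assms] by (intro jacobi_triple_product) auto
  also have "\<dots> = (\<Sum>\<^sub>\<infinity>n. alt_sign n * q powi (int a * tri n + b * n))"
    using q0 by (intro infsum_cong) (simp add: power_int_add mult.assoc powi_linear)
  finally show ?thesis .
qed

lemma theta_linear_abs_summable:
  assumes "a > 0"
  shows "(\<lambda>n. norm (q powi (int a * tri n + b * n))) summable_on UNIV"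
proof -
  have "(\<lambda>n. norm ((q ^ a) powi tri n * (q powi b) powi n)) summable_on UNIV"
    using q0 norm_power_less_1[OF q0 q1 assms] by (intro abs_summable_theta) auto
  then show ?thesis using q0 by (simp add: power_int_add powi_linear)
qed

lemma theta_linear_summable:
  assumes "a > 0"
  shows "(\<lambda>n. q powi (int a * tri n + b * n)) summable_on UNIV"
    and "(\<lambda>n. alt_sign n * q powi (int a * tri n + b * n)) summable_on UNIV"
proof -
  show "(\<lambda>n. q powi (int a * tri n + b * n)) summable_on UNIV"
    by (rule abs_summable_summable[OF theta_linear_abs_summable[OF assms]])
  show "(\<lambda>n. alt_sign n * q powi (int a * tri n + b * n)) summable_on UNIV"
    by (rule abs_summable_summable) (use theta_linear_abs_summable[OF assms] in \<open>simp add: norm_mult\<close>)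
qed

lemma qq_cube_base: "theta_j q (q^3) = qpoch_inf q q" "theta_j (q^2) (q^3) = qpoch_inf q q"
proof -
  have e: "q^3 / q = q^2" "q^3 / q^2 = q" "q * q = q^2" "q * q^2 = q^3"
    using q0 by (simp_all add: power2_eq_square power3_eq_cube)
  show "theta_j q (q^3) = qpoch_inf q q" "theta_j (q^2) (q^3) = qpoch_inf q q"
    using qpoch_inf_split3[OF q1, of q] by (simp_all add: theta_j_def e mult_ac)
qed

text \<open>A cube root of unity has constant powers on residue classes mod 3, which is the step of
  \<open>hecke_conv_rec\<close>. Classes 0 and 1 sum to j(q; q^3) and j(q^2; q^3), both equal to
  (q;q)_inf, times (q;q)_inf^2; class 2 vanishes.\<close>

lemma infsum_hecke_conv:
  assumes w: "w ^ 3 = 1" and s: "(\<lambda>m. hecke_conv q m * w powi m) summable_on UNIV"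
  shows "(\<Sum>\<^sub>\<infinity>m. hecke_conv q m * w powi m) = (1 + w) * qpoch_inf q q ^ 3"
proof -
  have w0: "w \<noteq> 0" using w by auto
  have w3: "w powi (3 * m) = 1" for m using w by (simp add: power_int_mult)
  have g0: "hecke_conv q (3 * n) = alt_sign n * q powi (3 * tri n + 1 * n) * (qpoch_inf q q)^2" for n
    using int_recurrence[OF q0, of "\<lambda>n. hecke_conv q (3 * n)" 3 1 n] hecke_conv_rec[OF q0 q1, of "3 * _"] hecke_conv_values[OF q0 q1]
    by (simp add: algebra_simps)
  have g1: "hecke_conv q (3 * n + 1) = alt_sign n * q powi (3 * tri n + 2 * n) * (qpoch_inf q q)^2" for n
    using int_recurrence[OF q0, of "\<lambda>n. hecke_conv q (3 * n + 1)" 3 2 n] hecke_conv_rec[OF q0 q1, of "3 * _ + 1"] hecke_conv_values[OF q0 q1]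
    by (simp add: algebra_simps)
  have g2: "hecke_conv q (3 * n + 2) = 0" for n
    using int_recurrence[OF q0, of "\<lambda>n. hecke_conv q (3 * n + 2)" 3 3 n] hecke_conv_rec[OF q0 q1, of "3 * _ + 2"] hecke_conv_values[OF q0 q1]
    by (simp add: algebra_simps)
  have "(\<Sum>\<^sub>\<infinity>m. hecke_conv q m * w powi m) = (\<Sum>i<3. \<Sum>\<^sub>\<infinity>m. hecke_conv q (int 3 * m + int i) * w powi (int 3 * m + int i))"
    by (rule infsum_int_mod[OF s]) simp
  also have "\<dots> = (\<Sum>\<^sub>\<infinity>m. hecke_conv q (3 * m)) + (\<Sum>\<^sub>\<infinity>m. hecke_conv q (3 * m + 1)) * w"
    using w0 by (simp add: eval_nat_numeral power_int_add w3 g2 infsum_cmult_left')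
  also have "(\<Sum>\<^sub>\<infinity>m. hecke_conv q (3 * m)) = theta_j q (q^3) * (qpoch_inf q q)^2"
    unfolding g0 infsum_cmult_left' using theta_series_linear[of 3 1] by simp
  also have "(\<Sum>\<^sub>\<infinity>m. hecke_conv q (3 * m + 1)) = theta_j (q^2) (q^3) * (qpoch_inf q q)^2"
    unfolding g1 infsum_cmult_left' using theta_series_linear[of 3 2] by simp
  finally show ?thesis unfolding qq_cube_base by (simp add: algebra_simps power2_eq_square power3_eq_cube)
qed

text \<open>Put x = q w and then x = q w^2 in (x^2;q^2)_inf = (x;q)_inf (-x;q)_inf. Since w^4 = w,
  the second relation exchanges \<open>a\<close> and \<open>b\<close>, so the product of the two is
  free of w. Only the leading factor 1 + w of (-w;q)_inf survives.\<close>

lemma cube_root_product: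
  assumes w: "w ^ 3 = 1"
  shows "theta_J12 q * theta_j (- w) q * theta_j (q * w) (q^2) = (1 + w) * qpoch_inf q q ^ 3"
    and "theta_j (q * w) (q^2) \<noteq> 0"
proof -
  have w0: "w \<noteq> 0" using w by auto
  have nw: "norm w = 1" by (rule norm_cube_root[OF w])
  have nx: "norm (q * u) < 1" "norm (q^2 * u) < 1" if "norm u = 1" for u
    using q1 norm_q2[OF q0 q1] that by (simp_all add: norm_mult)
  have nw2: "norm (w^2) = 1" using nw by (simp add: norm_power)
  have iw: "1 / w = w^2" using w w0 by (simp add: field_simps power2_eq_square power3_eq_cube)
  have e: "- w \<noteq> 0" "q / (- w) = - (q * w^2)" "q^2 / (q * w) = q * w^2"
    using iw w0 q0 by (auto simp: field_simps power2_eq_square)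
  define a where "a = qpoch_inf (q^2 * w) (q^2)"
  define b where "b = qpoch_inf (q^2 * w^2) (q^2)"
  have nz: "a \<noteq> 0" "b \<noteq> 0"
    unfolding a_def b_def
    by (rule qpoch_inf_nonzero'[OF norm_q2[OF q0 q1] nx(2)[OF nw]], rule qpoch_inf_nonzero'[OF norm_q2[OF q0 q1] nx(2)[OF nw2]])
  have X: "qpoch_inf (- (q * w)) q * qpoch_inf (q * w) (q^2) * a = b"
    using qpoch_inf_square[OF q1, of "q * w"] qpoch_inf_split2[OF q1, of "q * w"]
    by (simp add: a_def b_def power_mult_distrib mult_ac power2_eq_square)
  have w4: "w^2 * w^2 = w" using w by (simp add: power2_eq_square power3_eq_cube mult_ac)
  have Y: "qpoch_inf (- (q * w^2)) q * qpoch_inf (q * w^2) (q^2) * b = a"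
  proof -
    have e1: "(q * w^2)^2 = q^2 * w" unfolding power_mult_distrib using w4 by (simp only: power2_eq_square)
    have e2: "q * (q * w^2) = q^2 * w^2" by (simp add: power2_eq_square)
    show ?thesis
      using qpoch_inf_square[OF q1, of "q * w^2"] qpoch_inf_split2[OF q1, of "q * w^2"]
      unfolding e1 e2 by (simp add: a_def b_def mult_ac)
  qed
  have "(qpoch_inf (- (q * w)) q * qpoch_inf (q * w) (q^2)) * (qpoch_inf (- (q * w^2)) q * qpoch_inf (q * w^2) (q^2)) * a = 1 * a"
    using X Y by (metis mult.assoc mult.left_commute mult_1_left)
  then have XY: "(qpoch_inf (- (q * w)) q * qpoch_inf (q * w) (q^2)) * (qpoch_inf (- (q * w^2)) q * qpoch_inf (q * w^2) (q^2)) = 1"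
    using nz by (simp only: mult_cancel_right) simp
  have S: "qpoch_inf (- w) q = (1 + w) * qpoch_inf (- (q * w)) q"
    using qpoch_inf_Suc[OF q1, of "- w"] by simp
  have "theta_J12 q * theta_j (- w) q * theta_j (q * w) (q^2)
      = (1 + w) * (qpoch_inf q (q^2) * qpoch_inf (q^2) (q^2))^2 * qpoch_inf q q
        * ((qpoch_inf (- (q * w)) q * qpoch_inf (q * w) (q^2)) * (qpoch_inf (- (q * w^2)) q * qpoch_inf (q * w^2) (q^2)))"
    unfolding theta_J12_eq[OF q0 q1] theta_j_def[of "- w"] theta_j_def[of "q * w"] e S by (simp only: power2_eq_square mult_ac)
  then show "theta_J12 q * theta_j (- w) q * theta_j (q * w) (q^2) = (1 + w) * qpoch_inf q q ^ 3"
    unfolding XY qq_split[OF q0 q1, symmetric] by (simp add: power2_eq_square power3_eq_cube)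
  show "theta_j (q * w) (q^2) \<noteq> 0"
    using qpoch_inf_nonzero'[OF norm_q2[OF q0 q1] nx(1)[OF nw]] qpoch_inf_nonzero'[OF norm_q2[OF q0 q1] nx(1)[OF nw2]]
      qpoch_inf_nonzero'[OF norm_q2[OF q0 q1] norm_q2[OF q0 q1]]
    by (simp add: theta_j_def e)
qed

text \<open>Multiplication by j(q w; q^2) turns the left side into a convolution. Its value contains
  the same theta function by \<open>cube_root_product\<close>, which cancels because it is
  nonzero.\<close>

lemma hecke_ratio_cube_root_sum:
  assumes w: "w ^ 3 = 1"
  shows "(\<Sum>\<^sub>\<infinity>k. hecke_ratio q k * w powi k) = half_theta * (\<Sum>\<^sub>\<infinity>n. q powi tri n * w powi n)"
proof -
  have w0: "w \<noteq> 0" using w by auto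
  have nw: "norm (w powi k) = 1" for k using norm_cube_root[OF w] by (simp add: norm_power_int)
  note J = theta_J12_nonzero[OF q0 q1]
  define t where "t j = alt_sign j * q powi (j * j) * w powi j" for j
  have theta: "theta_j (q * w) (q^2) = (\<Sum>\<^sub>\<infinity>j. t j)"
  proof -
    have "theta_j (q * w) (q^2) = (\<Sum>\<^sub>\<infinity>j. alt_sign j * (q^2) powi tri j * (q * w) powi j)"
      using q0 w0 norm_q2[OF q0 q1] by (intro jacobi_triple_product) auto
    also have "\<dots> = (\<Sum>\<^sub>\<infinity>j. t j)"
    proof (rule infsum_cong)
      fix j
      have "(q^2) powi tri j * q powi j = q powi (j * j)" using quadratic_powi[OF q0 q1, of j 0] by simp
      then show "alt_sign j * (q^2) powi tri j * (q * w) powi j = t j"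
        by (simp add: t_def power_int_mult_distrib flip: mult.assoc)
    qed
    finally show ?thesis .
  qed
  have ts: "(\<lambda>j. norm (t j)) summable_on UNIV"
    using square_theta_abs_summable[OF q0 q1, of 0] by (simp add: t_def norm_mult nw)
  have cs: "(\<lambda>k. norm (hecke_shift q k * w powi k)) summable_on UNIV"
  proof -
    have "(\<lambda>k. norm (theta_J12 q) * norm (hecke_ratio q k)) summable_on UNIV"
      by (intro summable_on_cmult_right hecke_ratio_abs_summable q0 q1)
    moreover have "norm (theta_J12 q) * norm (hecke_ratio q k) = norm (hecke_shift q k * w powi k)" for k
      using J by (simp add: hecke_ratio_def[OF q0 q1] norm_mult nw norm_divide)
    ultimately show ?thesis by simp
  qed
  have conv: "(\<Sum>\<^sub>\<infinity>n. (hecke_shift q n * w powi n) * t (m - n)) = half_theta * (hecke_conv q m * w powi m)" for m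
  proof -
    have "(\<Sum>\<^sub>\<infinity>n. (hecke_shift q n * w powi n) * t (m - n)) = (\<Sum>\<^sub>\<infinity>n. hecke_shift q n * (alt_sign (m - n) * q powi ((m - n) * (m - n))) * w powi m)"
      using w0 by (intro infsum_cong) (simp add: t_def power_int_diff)
    then show ?thesis unfolding infsum_cmult_left' hecke_shift_convolution by (simp add: mult_ac)
  qed
  have main: "(\<Sum>\<^sub>\<infinity>k. hecke_shift q k * w powi k) * theta_j (q * w) (q^2) = (\<Sum>\<^sub>\<infinity>m. half_theta * (hecke_conv q m * w powi m))"
    unfolding theta infsum_convolution[OF cs ts] conv ..
  have sk: "(\<lambda>m. half_theta * (hecke_conv q m * w powi m)) summable_on UNIV"
    using summable_convolution[OF cs ts] unfolding conv .
  have "(\<Sum>\<^sub>\<infinity>m. half_theta * (hecke_conv q m * w powi m)) = half_theta * ((1 + w) * qpoch_inf q q ^ 3)"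
  \<comment> \<open>Summability of \<open>hecke_conv\<close> comes from that of the convolution
    after division by \<open>half_theta\<close>; if \<open>half_theta\<close> is 0, both sides are
    0.\<close>
  proof (cases "half_theta = 0")
    case False
    then have "(\<lambda>m. hecke_conv q m * w powi m) summable_on UNIV"
      using summable_on_cmult_right[OF sk, of "1 / half_theta"] by simp
    then show ?thesis unfolding infsum_cmult_right' by (simp add: infsum_hecke_conv[OF w])
  qed simp
  then have "(\<Sum>\<^sub>\<infinity>k. hecke_shift q k * w powi k) * theta_j (q * w) (q^2) = (half_theta * theta_J12 q * theta_j (- w) q) * theta_j (q * w) (q^2)"
    unfolding main cube_root_product(1)[OF w, symmetric] by (simp only: mult_ac)
  then have "(\<Sum>\<^sub>\<infinity>k. hecke_shift q k * w powi k) = half_theta * theta_J12 q * theta_j (- w) q"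
    using cube_root_product(2)[OF w] by (simp only: mult_cancel_right) simp
  moreover have "(\<Sum>\<^sub>\<infinity>k. hecke_shift q k * w powi k) = theta_J12 q * (\<Sum>\<^sub>\<infinity>k. hecke_ratio q k * w powi k)"
    unfolding infsum_cmult_right'[symmetric] using J by (intro infsum_cong) (simp add: hecke_ratio_def[OF q0 q1])
  moreover have "theta_j (- w) q = (\<Sum>\<^sub>\<infinity>n. q powi tri n * w powi n)"
  proof -
    have "theta_j (- w) q = (\<Sum>\<^sub>\<infinity>n. alt_sign n * q powi tri n * (- w) powi n)"
      using q0 q1 w0 by (intro jacobi_triple_product) auto
    also have "\<dots> = (\<Sum>\<^sub>\<infinity>n. q powi tri n * w powi n)"
    proof (rule infsum_cong)
      fix n
      have "(- w) powi n = alt_sign n * w powi n" using power_int_mult_distrib[of "-1" w n] by (simp add: alt_sign_eq_powi)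
      then have "alt_sign n * q powi tri n * (- w) powi n = (alt_sign n * alt_sign n) * (q powi tri n * w powi n)" by (simp only: mult_ac)
      then show "alt_sign n * q powi tri n * (- w) powi n = q powi tri n * w powi n" by simp
    qed
    finally show ?thesis .
  qed
  ultimately have "theta_J12 q * (\<Sum>\<^sub>\<infinity>k. hecke_ratio q k * w powi k) = theta_J12 q * (half_theta * (\<Sum>\<^sub>\<infinity>n. q powi tri n * w powi n))"
    by (simp only: mult_ac)
  then show ?thesis using J by (simp only: mult_cancel_left) simp
qed

end

text \<open>Fourier inversion on the integers mod 3: the sums twisted by 1, w and w^2 determine the
  three class sums.\<close>

lemma infsum_class_eqI:
  fixes f g :: "int \<Rightarrow> complex" and w :: complex
  assumes f: "(\<lambda>n. norm (f n)) summable_on UNIV" and g: "(\<lambda>n. norm (g n)) summable_on UNIV"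
    and w: "w ^ 3 = 1" "w \<noteq> 1"
    and eq: "\<And>u. u ^ 3 = 1 \<Longrightarrow> (\<Sum>\<^sub>\<infinity>n. f n * u powi n) = (\<Sum>\<^sub>\<infinity>n. g n * u powi n)"
    and i: "i < 3"
  shows "(\<Sum>\<^sub>\<infinity>m. f (3 * m + int i)) = (\<Sum>\<^sub>\<infinity>m. g (3 * m + int i))"
proof -
  define S where "S h i = (\<Sum>\<^sub>\<infinity>m. h (3 * m + int i))" for h :: "int \<Rightarrow> complex" and i
  have split: "(\<Sum>\<^sub>\<infinity>n. h n * u powi n) = S h 0 + S h 1 * u + S h 2 * u^2"
    if u: "u ^ 3 = 1" and h: "(\<lambda>n. norm (h n)) summable_on UNIV" for u and h :: "int \<Rightarrow> complex"
  proof -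
    have u0: "u \<noteq> 0" using u by auto
    have u3: "u powi (3 * m) = 1" for m using u by (simp add: power_int_mult)
    have "(\<lambda>n. norm (h n * u powi n)) summable_on UNIV"
      using h norm_cube_root[OF u] by (simp add: norm_mult norm_power_int)
    then have "(\<lambda>n. h n * u powi n) summable_on UNIV" by (rule abs_summable_summable)
    then have "(\<Sum>\<^sub>\<infinity>n. h n * u powi n) = (\<Sum>i<3. \<Sum>\<^sub>\<infinity>m. h (int 3 * m + int i) * u powi (int 3 * m + int i))"
      by (rule infsum_int_mod) simp
    then show ?thesis
      using u0 by (simp add: S_def eval_nat_numeral power_int_add u3 infsum_cmult_left')
  qed
  define d where "d i = S f i - S g i" for i
  have d: "d 0 + d 1 * u + d 2 * u^2 = 0" if "u ^ 3 = 1" for u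
    using eq[OF that] unfolding split[OF that f] split[OF that g] d_def by (simp add: algebra_simps)
  have "(w - 1) * (1 + w + w^2) = 0" using w by (simp add: algebra_simps power2_eq_square power3_eq_cube)
  then have s0: "1 + w + w^2 = 0" using w(2) by (metis mult_eq_0_iff right_minus_eq)
  have "w^2 = (1 + w + w^2) - 1 - w" by simp
  with s0 have w2: "w^2 = - 1 - w" by simp
  have w4: "(w^2)^2 = w" using w by (simp add: power2_eq_square power3_eq_cube mult_ac)
  have w6: "(w^2)^3 = 1" using w by (metis power_mult power_mult mult.commute power_one)
  have e0: "d 0 + d 1 + d 2 = 0" using d[of 1] by simp
  have e1: "d 0 + d 1 * w + d 2 * w^2 = 0" using d[OF w(1)] .
  have e2: "d 0 + d 1 * w^2 + d 2 * w = 0" using d[OF w6] unfolding w4 .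
  have "3 * d 0 = (d 0 + d 1 + d 2) + (d 0 + d 1 * w + d 2 * w^2) + (d 0 + d 1 * w^2 + d 2 * w)
      - (d 1 + d 2) * (1 + w + w^2)" by (simp add: algebra_simps)
  then have "3 * d 0 = 0" unfolding e0 e1 e2 s0 by simp
  then have d0: "d 0 = 0" by simp
  have d2: "d 2 = - d 1" using e0 unfolding d0 by (simp add: add_eq_0_iff)
  have "d 1 * (w * (1 - w)) = 0" using e1 unfolding d0 d2 by (simp add: algebra_simps power2_eq_square)
  then have d1: "d 1 = 0" using w by auto
  have "i = 0 \<or> i = 1 \<or> i = 2" using i by auto
  then have "d i = 0" using d0 d1 e0 by auto
  then show ?thesis by (simp add: d_def S_def)
qed

section \<open>Theta identities from sublattices of index 5\<close>

text \<open>For 0 < |t| < 1 and a > 0 this is j(t^b; t^a), and \<open>pos_theta t a b\<close> is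
  j(-t^b; t^a). With exponents as parameters, change of base and quasi-periodicity become integer
  arithmetic.\<close>

definition alt_theta :: "complex \<Rightarrow> int \<Rightarrow> int \<Rightarrow> complex" where
  "alt_theta t a b = (\<Sum>\<^sub>\<infinity>n. alt_sign n * t powi (a * tri n + b * n))"

definition pos_theta :: "complex \<Rightarrow> int \<Rightarrow> int \<Rightarrow> complex" where
  "pos_theta t a b = (\<Sum>\<^sub>\<infinity>n. t powi (a * tri n + b * n))"

lemma alt_theta_reflect: "alt_theta t a (a - b) = alt_theta t a b"
  unfolding alt_theta_def
  by (subst infsum_int_neg[symmetric]) (simp add: tri_minus algebra_simps)

lemma alt_theta_shift:
  assumes "t \<noteq> 0"
  shows "alt_theta t a (b + a) = - (t powi (- b)) * alt_theta t a b"
proof -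
  have "alt_theta t a b = (\<Sum>\<^sub>\<infinity>n. alt_sign (n + 1) * t powi (a * tri (n + 1) + b * (n + 1)))"
    unfolding alt_theta_def by (rule infsum_int_shift[symmetric])
  also have "\<dots> = (\<Sum>\<^sub>\<infinity>n. - (t powi b) * (alt_sign n * t powi (a * tri n + (b + a) * n)))"
  proof (rule infsum_cong)
    fix n
    have e: "a * tri (n + 1) + b * (n + 1) = b + (a * tri n + (b + a) * n)" by (simp add: tri_Suc algebra_simps)
    show "alt_sign (n + 1) * t powi (a * tri (n + 1) + b * (n + 1)) = - (t powi b) * (alt_sign n * t powi (a * tri n + (b + a) * n))"
      unfolding e using assms by (simp add: alt_sign_add power_int_add)
  qed
  also have "\<dots> = - (t powi b) * alt_theta t a (b + a)" unfolding alt_theta_def by (rule infsum_cmult_right')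
  finally show ?thesis using assms by (simp add: power_int_minus)
qed

lemma alt_theta_zero: "alt_theta t a 0 = 0"
  unfolding alt_theta_def by (rule infsum_int_antisym[of _ 1]) (simp add: tri_reflect alt_sign_def)

lemma alt_theta_power: "alt_theta (t ^ k) a b = alt_theta t (int k * a) (int k * b)"
  unfolding alt_theta_def by (rule infsum_cong) (simp add: power_int_power algebra_simps)

lemma pos_theta_power: "pos_theta (t ^ k) a b = pos_theta t (int k * a) (int k * b)"
  unfolding pos_theta_def by (rule infsum_cong) (simp add: power_int_power algebra_simps)

lemma infsum_partition:
  fixes F :: "'a \<Rightarrow> complex" and h :: "nat \<Rightarrow> 'b \<Rightarrow> 'a"
  assumes F: "F summable_on UNIV"
    and inj: "\<And>i. inj (h i)" and cover: "\<And>x. \<exists>i<k. \<exists>y. x = h i y"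
    and disj: "\<And>i j y z. i < k \<Longrightarrow> j < k \<Longrightarrow> h i y = h j z \<Longrightarrow> i = j"
  shows "infsum F UNIV = (\<Sum>i<k. \<Sum>\<^sub>\<infinity>y. F (h i y))"
proof -
  have "(\<Sum>i<k. infsum F (range (h i))) = infsum F (\<Union>i<k. range (h i))"
  proof (rule sum_infsum)
    show "F summable_on range (h i)" for i by (rule summable_on_subset_banach[OF F]) auto
    show "range (h i) \<inter> range (h j) = {}" if "i \<in> {..<k}" "j \<in> {..<k}" "i \<noteq> j" for i j
      using disj that by blast
  qed auto
  also have "(\<Union>i<k. range (h i)) = UNIV"
  proof (intro equalityI subsetI)
    fix x
    obtain i y where "i < k" "x = h i y" using cover by blast
    then show "x \<in> (\<Union>i<k. range (h i))" by blast
  qed simp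
  also have "(\<Sum>i<k. infsum F (range (h i))) = (\<Sum>i<k. \<Sum>\<^sub>\<infinity>y. F (h i y))"
    by (intro sum.cong refl, subst infsum_reindex) (use inj in \<open>auto simp: o_def\<close>)
  finally show ?thesis by simp
qed

text \<open>The two sublattices of index 5 in the plane on which the quadratic forms \<open>m\<^sup>2 + n\<^sup>2\<close> and
  \<open>2 m\<^sup>2 + 3 n\<^sup>2\<close> become diagonal again.\<close>

lemma infsum_lattice5_square:
  fixes F :: "int \<times> int \<Rightarrow> complex"
  assumes F: "F summable_on UNIV"
  shows "infsum F UNIV = (\<Sum>i<5. \<Sum>\<^sub>\<infinity>(a, b). F (2 * a + b + (int i - 2), 2 * b - a))"
proof -
  have "infsum F UNIV = (\<Sum>i<5. \<Sum>\<^sub>\<infinity>y. F ((\<lambda>i (a, b). (2 * a + b + (int i - 2), 2 * b - a)) i y))"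
  proof (rule infsum_partition[OF F])
    show "inj (\<lambda>(a, b). (2 * a + b + (int i - 2), 2 * b - a))" for i
    proof (rule injI)
      fix x y :: "int \<times> int"
      assume xy: "(case x of (a, b) \<Rightarrow> (2 * a + b + (int i - 2), 2 * b - a)) = (case y of (a, b) \<Rightarrow> (2 * a + b + (int i - 2), 2 * b - a))"
      obtain a b c d where "x = (a, b)" "y = (c, d)" by fastforce
      with xy show "x = y" by simp
    qed
    show "\<exists>i<5. \<exists>y. x = (case y of (a, b) \<Rightarrow> (2 * a + b + (int i - 2), 2 * b - a))" for x
    proof -
      obtain m n where x: "x = (m, n)" by force
      \<comment> \<open>On the i-th coset m + 2 n = 5 b + (i - 2), so m + 2 n mod 5 labels the coset
        and the quotient recovers b. Adding 2 centres the representatives around 0.\<close>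
      define k r where "k = (m + 2 * n + 2) div 5" and "r = (m + 2 * n + 2) mod 5"
      have s: "m + 2 * n + 2 = 5 * k + r" unfolding k_def r_def by simp
      have "nat r < 5" "int (nat r) = r" by (auto simp: r_def nat_less_iff)
      moreover have "x = (case (2 * k - n, k) of (a, b) \<Rightarrow> (2 * a + b + (r - 2), 2 * b - a))"
        using s by (simp add: x)
      ultimately show ?thesis
        by (intro exI[of _ "nat r"] conjI exI[of _ "(2 * k - n, k)"]) (simp_all only:)
    qed
    show "i = j" if "i < 5" "j < 5"
      "(case y of (a, b) \<Rightarrow> (2 * a + b + (int i - 2), 2 * b - a)) = (case z of (a, b) \<Rightarrow> (2 * a + b + (int j - 2), 2 * b - a))"
      for i j and y z :: "int \<times> int"
      using that by (cases y; cases z; clarsimp; presburger)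
  qed
  then show ?thesis by (simp add: case_prod_unfold)
qed

lemma infsum_lattice5_23:
  fixes F :: "int \<times> int \<Rightarrow> complex"
  assumes F: "F summable_on UNIV"
  shows "infsum F UNIV = (\<Sum>i<5. \<Sum>\<^sub>\<infinity>(a, b). F (a + 3 * b + (int i - 2), a - 2 * b))"
proof -
  have "infsum F UNIV = (\<Sum>i<5. \<Sum>\<^sub>\<infinity>y. F ((\<lambda>i (a, b). (a + 3 * b + (int i - 2), a - 2 * b)) i y))"
  proof (rule infsum_partition[OF F])
    show "inj (\<lambda>(a, b). (a + 3 * b + (int i - 2), a - 2 * b))" for i
    proof (rule injI)
      fix x y :: "int \<times> int"
      assume xy: "(case x of (a, b) \<Rightarrow> (a + 3 * b + (int i - 2), a - 2 * b)) = (case y of (a, b) \<Rightarrow> (a + 3 * b + (int i - 2), a - 2 * b))"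
      obtain a b c d where "x = (a, b)" "y = (c, d)" by fastforce
      with xy show "x = y" by simp
    qed
    show "\<exists>i<5. \<exists>y. x = (case y of (a, b) \<Rightarrow> (a + 3 * b + (int i - 2), a - 2 * b))" for x
    proof -
      obtain m n where x: "x = (m, n)" by force
      \<comment> \<open>Here the coset label is m - n = 5 b + (i - 2).\<close>
      define k r where "k = (m - n + 2) div 5" and "r = (m - n + 2) mod 5"
      have s: "m - n + 2 = 5 * k + r" unfolding k_def r_def by simp
      have "nat r < 5" "int (nat r) = r" by (auto simp: r_def nat_less_iff)
      moreover have "x = (case (n + 2 * k, k) of (a, b) \<Rightarrow> (a + 3 * b + (r - 2), a - 2 * b))"
        using s by (simp add: x)
      ultimately show ?thesis
        by (intro exI[of _ "nat r"] conjI exI[of _ "(n + 2 * k, k)"]) (simp_all only:)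
    qed
    show "i = j" if "i < 5" "j < 5"
      "(case y of (a, b) \<Rightarrow> (a + 3 * b + (int i - 2), a - 2 * b)) = (case z of (a, b) \<Rightarrow> (a + 3 * b + (int j - 2), a - 2 * b))"
      for i j and y z :: "int \<times> int"
      using that by (cases y; cases z; clarsimp; presburger)
  qed
  then show ?thesis by (simp add: case_prod_unfold)
qed

lemma sum_lessThan_5_shift: "(\<Sum>i<5. f (int i - 2)) = f (- 2) + f (- 1) + f 0 + f 1 + (f 2 :: complex)"
proof -
  have "{..<5::nat} = {0, 1, 2, 3, 4}" by auto
  then show ?thesis by (simp add: add_ac)
qed

context
  fixes t :: complex
  assumes t0: "t \<noteq> 0" and t1: "norm t < 1"
begin

lemma alt_theta_pos_theta_abs_summable:
  assumes "a > 0"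
  shows "(\<lambda>n. norm (t powi (a * tri n + b * n))) summable_on UNIV"
    and "(\<lambda>n. norm (alt_sign n * t powi (a * tri n + b * n))) summable_on UNIV"
  using theta_linear_abs_summable[OF t0 t1, of "nat a" b] assms by (simp_all add: norm_mult)

lemma theta_j_eq_alt_theta: "a > 0 \<Longrightarrow> theta_j (t powi b) (t ^ a) = alt_theta t (int a) b"
  using theta_series_linear[OF t0 t1] by (simp add: alt_theta_def)

lemma lattice_term:
  assumes "A > 0" "A' > 0" and "\<And>a b. G a b = alt_sign (a + b) * t powi (A * tri a + B * a + (A' * tri b + B' * b) + c) * s"
  shows "(\<Sum>\<^sub>\<infinity>(a, b). G a b) = s * t powi c * alt_theta t A B * alt_theta t A' B'"
proof -
  have "(\<Sum>\<^sub>\<infinity>(a, b). G a b) = infsum (\<lambda>x. s * t powi c * (case x of (a, b) \<Rightarrow>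
      (alt_sign a * t powi (A * tri a + B * a)) * (alt_sign b * t powi (A' * tri b + B' * b)))) (UNIV \<times> UNIV)"
    unfolding UNIV_Times_UNIV
    by (rule infsum_cong) (use t0 in \<open>auto simp: assms(3) power_int_add alt_sign_add\<close>)
  then show ?thesis
    unfolding infsum_cmult_right' infsum_times(2)[OF alt_theta_pos_theta_abs_summable(2)[OF assms(1)] alt_theta_pos_theta_abs_summable(2)[OF assms(2)]]
    by (simp add: alt_theta_def mult_ac)
qed

text \<open>With m = a + 3 b + i and n = a - 2 b the form 2 m^2 + 3 n^2 has leading part 5 a^2 + 30
  b^2, so each coset gives a product of two theta series; c affects only their linear parts.\<close>

lemma theta_product_lattice5:
  "alt_theta t 2 1 * pos_theta t 3 c
    = (let f = \<lambda>i. alt_sign i * t powi (i * i) * alt_theta t 5 (1 + c + 2 * i) * alt_theta t 30 (18 - 2 * c + 6 * i)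
       in f (- 2) + f (- 1) + f 0 + f 1 + f 2)"
proof -
  define F where "F = (\<lambda>(m, n). (alt_sign m * t powi (2 * tri m + 1 * m)) * t powi (3 * tri n + c * n))"
  note S = alt_theta_pos_theta_abs_summable(2)[of 2 1, OF zero_less_numeral] alt_theta_pos_theta_abs_summable(1)[of 3 c, OF zero_less_numeral]
  have "(\<lambda>x. norm (F x)) summable_on UNIV"
    using infsum_times(1)[OF S] by (simp add: F_def case_prod_unfold)
  then have s: "F summable_on UNIV" by (rule abs_summable_summable)
  have part: "(\<Sum>\<^sub>\<infinity>(a, b). F (a + 3 * b + i, a - 2 * b)) = alt_sign i * t powi (i * i) * alt_theta t 5 (1 + c + 2 * i) * alt_theta t 30 (18 - 2 * c + 6 * i)" for i
  proof (rule lattice_term)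
    fix a b :: int
    define m n where "m = a + 3 * b + i" and "n = a - 2 * b"
    have "2 * (2 * tri m + 1 * m + (3 * tri n + c * n)) = 2 * (5 * tri a + (1 + c + 2 * i) * a + (30 * tri b + (18 - 2 * c + 6 * i) * b) + i * i)"
      using two_tri[of m] two_tri[of n] two_tri[of a] two_tri[of b] unfolding m_def n_def by (simp add: algebra_simps)
    then have e: "2 * tri m + 1 * m + (3 * tri n + c * n) = 5 * tri a + (1 + c + 2 * i) * a + (30 * tri b + (18 - 2 * c + 6 * i) * b) + i * i"
      unfolding mult_cancel_left by simp
    have "F (m, n) = alt_sign m * t powi (2 * tri m + 1 * m + (3 * tri n + c * n))"
      using t0 by (simp add: F_def power_int_add)
    also have "alt_sign m = alt_sign (a + b) * alt_sign i" by (simp add: m_def alt_sign_def)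
    finally have "F (m, n) = alt_sign (a + b) * t powi (5 * tri a + (1 + c + 2 * i) * a + (30 * tri b + (18 - 2 * c + 6 * i) * b) + i * i) * alt_sign i"
      unfolding e by (simp only: mult_ac)
    then show "F (a + 3 * b + i, a - 2 * b) = alt_sign (a + b) * t powi (5 * tri a + (1 + c + 2 * i) * a + (30 * tri b + (18 - 2 * c + 6 * i) * b) + i * i) * alt_sign i"
      by (simp only: m_def n_def)
  qed auto
  have "alt_theta t 2 1 * pos_theta t 3 c = infsum F UNIV"
    using infsum_times(2)[OF S] by (simp add: F_def alt_theta_def pos_theta_def)
  then show ?thesis
    unfolding infsum_lattice5_23[OF s] part Let_def sum_lessThan_5_shift[of "\<lambda>i. alt_sign i * t powi (i * i) * alt_theta t 5 (1 + c + 2 * i) * alt_theta t 30 (18 - 2 * c + 6 * i)"] .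
qed

text \<open>One coset product contains \<open>alt_theta t 5 0\<close> and vanishes;
  quasi-periodicity and reflection bring the other four to \<open>alt_theta t 5 1\<close> and
  \<open>alt_theta t 5 2\<close>. Their cofactors are the coefficients of the first equation in
  \<open>class_system\<close>.\<close>

lemma theta_identity_1:
  "alt_theta t 2 1 * pos_theta t 3 1
    = alt_theta t 5 2 * (alt_theta t 30 14 - t^2 * alt_theta t 30 4) - t * alt_theta t 5 1 * (alt_theta t 30 8 + t^2 * alt_theta t 30 2)"
proof -
  have "alt_theta t 2 1 * pos_theta t 3 1 = t ^ 4 * alt_theta t 5 (- 2) * alt_theta t 30 4 - t * alt_theta t 5 0 * alt_theta t 30 10 + alt_theta t 5 2 * alt_theta t 30 16
      - t * alt_theta t 5 4 * alt_theta t 30 22 + t ^ 4 * alt_theta t 5 6 * alt_theta t 30 28"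
    using theta_product_lattice5[of 1] by (simp add: Let_def alt_sign_def)
  also have "alt_theta t 5 (- 2) = - (alt_theta t 5 2 / t^2)"
    using alt_theta_shift[OF t0, of 5 "-2"] alt_theta_reflect[of t 5 2] t0 by (simp add: field_simps) (metis add.inverse_inverse)
  also have "alt_theta t 5 6 = - (alt_theta t 5 1 / t)"
    using alt_theta_shift[OF t0, of 5 1] t0 by (simp add: power_int_minus divide_inverse)
  also have "alt_theta t 5 4 = alt_theta t 5 1" using alt_theta_reflect[of t 5 1] by simp
  also have "alt_theta t 30 16 = alt_theta t 30 14" using alt_theta_reflect[of t 30 14] by simp
  also have "alt_theta t 30 22 = alt_theta t 30 8" using alt_theta_reflect[of t 30 8] by simp
  also have "alt_theta t 30 28 = alt_theta t 30 2" using alt_theta_reflect[of t 30 2] by simp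
  finally show ?thesis using t0 by (simp add: alt_theta_zero field_simps eval_nat_numeral)
qed

lemma theta_identity_2:
  "alt_theta t 2 1 * pos_theta t 3 3 = 2 * (alt_theta t 5 1 * alt_theta t 30 12 - t * alt_theta t 5 2 * alt_theta t 30 6)"
proof -
  \<comment> \<open>At c = 0 the cosets are symmetric: one product vanishes and the other four form
    two equal pairs, whence the factor 2.\<close>
  have "pos_theta t 3 3 = pos_theta t 3 0"
    unfolding pos_theta_def by (subst infsum_int_neg[symmetric]) (simp add: tri_minus algebra_simps)
  then have "alt_theta t 2 1 * pos_theta t 3 3 = t ^ 4 * alt_theta t 5 (- 3) * alt_theta t 30 6 - t * alt_theta t 5 (- 1) * alt_theta t 30 12 + alt_theta t 5 1 * alt_theta t 30 18
      - t * alt_theta t 5 3 * alt_theta t 30 24 + t ^ 4 * alt_theta t 5 5 * alt_theta t 30 30"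
    using theta_product_lattice5[of 0] by (simp add: Let_def alt_sign_def)
  also have "alt_theta t 5 (- 3) = - (alt_theta t 5 2 / t^3)"
    using alt_theta_shift[OF t0, of 5 "-3"] t0 by (simp add: field_simps)
  also have "alt_theta t 5 (- 1) = - (alt_theta t 5 1 / t)"
    using alt_theta_shift[OF t0, of 5 "-1"] alt_theta_reflect[of t 5 1] t0 by (simp add: field_simps) (metis add.inverse_inverse)
  also have "alt_theta t 5 5 = 0" using alt_theta_reflect[of t 5 0] by (simp add: alt_theta_zero)
  also have "alt_theta t 5 3 = alt_theta t 5 2" using alt_theta_reflect[of t 5 2] by simp
  also have "alt_theta t 30 18 = alt_theta t 30 12" using alt_theta_reflect[of t 30 12] by simp
  also have "alt_theta t 30 24 = alt_theta t 30 6" using alt_theta_reflect[of t 30 6] by simp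
  finally show ?thesis using t0 by (simp add: field_simps eval_nat_numeral)
qed

text \<open>Serves with t^2 for t: the right side is then the determinant of
  \<open>class_system\<close> and the left side is (t^2;t^2)_inf^2.\<close>

lemma theta_identity_3:
  "alt_theta t 3 1 * alt_theta t 3 1
    = (alt_theta t 15 7 - t * alt_theta t 15 2) * alt_theta t 15 6 - t * alt_theta t 15 3 * (alt_theta t 15 4 + t * alt_theta t 15 1)"
proof -
  define F where "F = (\<lambda>(m, n). (alt_sign m * t powi (3 * tri m + 1 * m)) * (alt_sign n * t powi (3 * tri n + 1 * n)))"
  have "(\<lambda>x. norm (F x)) summable_on UNIV"
    using infsum_times(1)[OF alt_theta_pos_theta_abs_summable(2)[of 3 1, OF zero_less_numeral] alt_theta_pos_theta_abs_summable(2)[of 3 1, OF zero_less_numeral]]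
    by (simp add: F_def case_prod_unfold)
  then have s: "F summable_on UNIV" by (rule abs_summable_summable)
  have part: "(\<Sum>\<^sub>\<infinity>(a, b). F (2 * a + b + i, 2 * b - a)) = alt_sign i * t powi (3 * tri i + i) * alt_theta t 15 (7 + 6 * i) * alt_theta t 15 (6 + 3 * i)" for i
  proof (rule lattice_term)
    fix a b :: int
    define m n where "m = 2 * a + b + i" and "n = 2 * b - a"
    have "2 * (3 * tri m + 1 * m + (3 * tri n + 1 * n)) = 2 * (15 * tri a + (7 + 6 * i) * a + (15 * tri b + (6 + 3 * i) * b) + (3 * tri i + i))"
      using two_tri[of m] two_tri[of n] two_tri[of a] two_tri[of b] two_tri[of i] unfolding m_def n_def by (simp add: algebra_simps)
    then have e: "3 * tri m + 1 * m + (3 * tri n + 1 * n) = 15 * tri a + (7 + 6 * i) * a + (15 * tri b + (6 + 3 * i) * b) + (3 * tri i + i)"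
      unfolding mult_cancel_left by simp
    have "F (m, n) = alt_sign m * alt_sign n * t powi (3 * tri m + 1 * m + (3 * tri n + 1 * n))"
      using t0 by (simp add: F_def power_int_add)
    also have "alt_sign m * alt_sign n = alt_sign (a + b) * alt_sign i" by (simp add: m_def n_def alt_sign_def)
    finally have "F (m, n) = alt_sign (a + b) * t powi (15 * tri a + (7 + 6 * i) * a + (15 * tri b + (6 + 3 * i) * b) + (3 * tri i + i)) * alt_sign i"
      unfolding e by (simp only: mult_ac)
    then show "F (2 * a + b + i, 2 * b - a) = alt_sign (a + b) * t powi (15 * tri a + (7 + 6 * i) * a + (15 * tri b + (6 + 3 * i) * b) + (3 * tri i + i)) * alt_sign i"
      by (simp only: m_def n_def)
  qed auto
  have "alt_theta t 3 1 * alt_theta t 3 1 = infsum F UNIV"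
    using infsum_times(2)[OF alt_theta_pos_theta_abs_summable(2)[of 3 1, OF zero_less_numeral] alt_theta_pos_theta_abs_summable(2)[of 3 1, OF zero_less_numeral]]
    by (simp add: F_def alt_theta_def)
  also have "\<dots> = t ^ 7 * alt_theta t 15 (- 5) * alt_theta t 15 0 - t ^ 2 * alt_theta t 15 1 * alt_theta t 15 3 + alt_theta t 15 7 * alt_theta t 15 6
      - t * alt_theta t 15 13 * alt_theta t 15 9 + t ^ 5 * alt_theta t 15 19 * alt_theta t 15 12"
    unfolding infsum_lattice5_square[OF s] part
    by (subst sum_lessThan_5_shift[of "\<lambda>i. alt_sign i * t powi (3 * tri i + i) * alt_theta t 15 (7 + 6 * i) * alt_theta t 15 (6 + 3 * i)"]) (simp add: alt_sign_def tri_def)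
  also have "alt_theta t 15 19 = - (alt_theta t 15 4 / t^4)"
    using alt_theta_shift[OF t0, of 15 4] t0 by (simp add: power_int_minus divide_inverse)
  also have "alt_theta t 15 13 = alt_theta t 15 2" using alt_theta_reflect[of t 15 2] by simp
  also have "alt_theta t 15 9 = alt_theta t 15 6" using alt_theta_reflect[of t 15 6] by simp
  also have "alt_theta t 15 12 = alt_theta t 15 3" using alt_theta_reflect[of t 15 3] by simp
  finally show ?thesis using t0 by (simp add: alt_theta_zero field_simps eval_nat_numeral)
qed

end

section \<open>Residue classes of the Appell coefficients\<close>

lemma tri_3: "tri (3 * m) = 9 * tri m + 3 * m" "tri (3 * m + 1) = 9 * tri m + 6 * m" "tri (3 * m + 2) = 9 * tri m + 9 * m + 1"
  by (simp_all add: tri_add tri_mult)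

text \<open>The sum of q^(tri n) over all integers is computed twice. Splitting n mod 2 gives 2
  \<open>half_theta q\<close>; splitting mod 3 gives two equal classes and one class carrying a
  factor q.\<close>

lemma half_theta_dissection:
  assumes q0: "q \<noteq> 0" and q1: "norm q < 1"
  shows "half_theta q = pos_theta (q^3) 3 1 + q * pos_theta (q^3) 3 3 / 2"
    and "(\<Sum>\<^sub>\<infinity>m. q powi tri (3 * m)) = pos_theta (q^3) 3 1"
    and "(\<Sum>\<^sub>\<infinity>m. q powi tri (3 * m + 2)) = q * pos_theta (q^3) 3 3"
proof -
  have s: "(\<lambda>n. q powi tri n) summable_on UNIV"
    using theta_linear_summable(1)[OF q0 q1, of 1 0] by simp
  show T0: "(\<Sum>\<^sub>\<infinity>m. q powi tri (3 * m)) = pos_theta (q^3) 3 1"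
    unfolding pos_theta_power by (simp add: pos_theta_def tri_3)
  have "(\<Sum>\<^sub>\<infinity>m. q powi tri (3 * m + 1)) = (\<Sum>\<^sub>\<infinity>m. q powi (9 * tri (- m) + 6 * (- m)))"
    unfolding tri_3 by (rule infsum_int_neg[symmetric])
  also have "\<dots> = pos_theta (q^3) 3 1"
    unfolding pos_theta_power by (simp add: pos_theta_def tri_minus algebra_simps)
  finally have T1: "(\<Sum>\<^sub>\<infinity>m. q powi tri (3 * m + 1)) = pos_theta (q^3) 3 1" .
  show T2: "(\<Sum>\<^sub>\<infinity>m. q powi tri (3 * m + 2)) = q * pos_theta (q^3) 3 3"
    unfolding pos_theta_power unfolding pos_theta_def infsum_cmult_right'[symmetric]
    using q0 by (intro infsum_cong) (simp add: tri_3 power_int_add)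
  have "(\<Sum>\<^sub>\<infinity>n. q powi tri n) = (\<Sum>i<3. \<Sum>\<^sub>\<infinity>m. q powi tri (int 3 * m + int i))"
    by (rule infsum_int_mod[OF s]) simp
  also have "\<dots> = 2 * pos_theta (q^3) 3 1 + q * pos_theta (q^3) 3 3"
    using T0 T1 T2 by (simp add: eval_nat_numeral(2,3))
  finally have A: "(\<Sum>\<^sub>\<infinity>n. q powi tri n) = 2 * pos_theta (q^3) 3 1 + q * pos_theta (q^3) 3 3" .
  have t2: "tri (2 * j) = 2 * (j * j) - j" "tri (2 * j + 1) = 2 * (j * j) + j" for j
    using two_tri[of "2 * j"] two_tri[of "2 * j + 1"] by (simp_all add: algebra_simps)
  have "(\<Sum>\<^sub>\<infinity>n. q powi tri n) = (\<Sum>i<2. \<Sum>\<^sub>\<infinity>m. q powi tri (int 2 * m + int i))"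
    by (rule infsum_int_mod[OF s]) simp
  also have "\<dots> = (\<Sum>\<^sub>\<infinity>j. q powi (2 * (j * j) - j)) + half_theta q"
    by (simp add: eval_nat_numeral(2,3) t2 half_theta_def[OF q0 q1])
  also have "(\<Sum>\<^sub>\<infinity>j. q powi (2 * (j * j) - j)) = half_theta q"
    unfolding half_theta_def[OF q0 q1] by (subst infsum_int_neg[symmetric]) simp
  finally show "half_theta q = pos_theta (q^3) 3 1 + q * pos_theta (q^3) 3 3 / 2" using A by (simp add: field_simps)
qed

text \<open>J_{1,2} is the sum of (-1)^N q^(N^2), and squares are 0 or 1 mod 3. The classes N = 1
  and N = 2 mod 3 agree, which gives the factor 2.\<close>

lemma theta_J12_dissection:
  assumes q0: "q \<noteq> 0" and q1: "norm q < 1"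
  shows "theta_J12 q = alt_theta (q^3) 6 3 - 2 * q * alt_theta (q^3) 6 1"
proof -
  have J: "theta_J12 q = alt_theta q 2 1" using theta_j_eq_alt_theta[OF q0 q1, of 2 1] by simp
  have s: "(\<lambda>n. alt_sign n * q powi (2 * tri n + 1 * n)) summable_on UNIV"
    using theta_linear_summable(2)[OF q0 q1, of 2 1] by simp
  have "alt_theta q 2 1 = (\<Sum>i<3. \<Sum>\<^sub>\<infinity>m. alt_sign (int 3 * m + int i) * q powi (2 * tri (int 3 * m + int i) + 1 * (int 3 * m + int i)))"
    unfolding alt_theta_def by (rule infsum_int_mod[OF s]) simp
  also have "\<dots> = (\<Sum>\<^sub>\<infinity>m. alt_sign (3 * m) * q powi (2 * tri (3 * m) + 3 * m))
     + (\<Sum>\<^sub>\<infinity>m. alt_sign (3 * m + 1) * q powi (2 * tri (3 * m + 1) + (3 * m + 1)))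
     + (\<Sum>\<^sub>\<infinity>m. alt_sign (3 * m + 2) * q powi (2 * tri (3 * m + 2) + (3 * m + 2)))"
    by (simp add: eval_nat_numeral(2,3))
  also have "(\<Sum>\<^sub>\<infinity>m. alt_sign (3 * m) * q powi (2 * tri (3 * m) + 3 * m)) = alt_theta q 18 9"
    unfolding alt_theta_def
  proof (rule infsum_cong)
    fix m
    have e: "2 * tri (3 * m) + 3 * m = 18 * tri m + 9 * m" by (simp add: tri_3)
    show "alt_sign (3 * m) * q powi (2 * tri (3 * m) + 3 * m) = alt_sign m * q powi (18 * tri m + 9 * m)"
      unfolding e by (simp add: alt_sign_def)
  qed
  also have "(\<Sum>\<^sub>\<infinity>m. alt_sign (3 * m + 1) * q powi (2 * tri (3 * m + 1) + (3 * m + 1))) = - q * alt_theta q 18 15"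
    unfolding alt_theta_def infsum_cmult_right'[symmetric]
  proof (rule infsum_cong)
    fix m
    have e: "2 * tri (3 * m + 1) + (3 * m + 1) = 1 + (18 * tri m + 15 * m)" by (simp add: tri_3)
    show "alt_sign (3 * m + 1) * q powi (2 * tri (3 * m + 1) + (3 * m + 1)) = - q * (alt_sign m * q powi (18 * tri m + 15 * m))"
      unfolding e using q0 by (simp add: alt_sign_def power_int_add)
  qed
  also have "(\<Sum>\<^sub>\<infinity>m. alt_sign (3 * m + 2) * q powi (2 * tri (3 * m + 2) + (3 * m + 2))) = q ^ 4 * alt_theta q 18 21"
    unfolding alt_theta_def infsum_cmult_right'[symmetric]
  proof (rule infsum_cong)
    fix m
    have e: "2 * tri (3 * m + 2) + (3 * m + 2) = 4 + (18 * tri m + 21 * m)" by (simp add: tri_3)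
    show "alt_sign (3 * m + 2) * q powi (2 * tri (3 * m + 2) + (3 * m + 2)) = q ^ 4 * (alt_sign m * q powi (18 * tri m + 21 * m))"
      unfolding e using q0 by (simp add: alt_sign_def power_int_add)
  qed
  also have "q ^ 4 * alt_theta q 18 21 = - q * alt_theta q 18 3"
    using alt_theta_shift[OF q0, of 18 3] q0 by (simp add: power_int_minus field_simps eval_nat_numeral)
  also have "alt_theta q 18 15 = alt_theta q 18 3" using alt_theta_reflect[of q 18 3] by simp
  finally show ?thesis unfolding J alt_theta_power by simp
qed

text \<open>At t = q^3 this turns the final ratio of theta series into J_6 / J_3. Splitting
  (-t;t)_inf by index mod 3 isolates the factors of the left series; Euler's product at t^3 removes
  the rest.\<close>

lemma theta_J12_product_cube:
  assumes t0: "t \<noteq> 0" and t1: "norm t < 1"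
  shows "pos_theta t 3 1 * qpoch_inf t t = alt_theta t 6 3 * qpoch_inf (t^2) (t^2)"
proof -
  have t3: "t^3 \<noteq> 0" "norm (t^3) < 1" using t0 norm_power_less_1[OF t0 t1, of 3] by auto
  have "theta_j (- t) (t^3) = (\<Sum>\<^sub>\<infinity>n. alt_sign n * (t^3) powi tri n * (- t) powi n)"
    using t3 t0 by (intro jacobi_triple_product) auto
  also have "\<dots> = pos_theta t 3 1"
    unfolding pos_theta_def
  proof (rule infsum_cong)
    fix n
    have "(- t) powi n = alt_sign n * t powi n" using power_int_mult_distrib[of "-1" t n] by (simp add: alt_sign_eq_powi)
    then have "alt_sign n * (t^3) powi tri n * (- t) powi n = (alt_sign n * alt_sign n) * ((t^3) powi tri n * t powi n)" by (simp only: mult_ac)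
    then show "alt_sign n * (t^3) powi tri n * (- t) powi n = t powi (3 * tri n + 1 * n)"
      using t0 by (simp add: power_int_add power_int_power)
  qed
  finally have P: "pos_theta t 3 1 = qpoch_inf (- t) (t^3) * qpoch_inf (- (t^2)) (t^3) * qpoch_inf (t^3) (t^3)"
  proof -
    assume a: "theta_j (- t) (t^3) = pos_theta t 3 1"
    have "t^3 / (- t) = - (t^2)" using t0 by (simp add: power2_eq_square power3_eq_cube)
    then show ?thesis using a by (simp add: theta_j_def)
  qed
  have B: "alt_theta t 6 3 = theta_J12 (t^3)"
    using theta_j_eq_alt_theta[OF t3, of 2 1] alt_theta_power[of t 3 2 1] by simp
  have S: "qpoch_inf (t^2) (t^2) = qpoch_inf t t * qpoch_inf (- t) t" by (rule qpoch_inf_square[OF t1])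
  have M: "qpoch_inf (- t) t = qpoch_inf (- t) (t^3) * qpoch_inf (- (t^2)) (t^3) * qpoch_inf (- (t^3)) (t^3)"
    using qpoch_inf_split3[OF t1, of "- t"] by (simp add: power2_eq_square power3_eq_cube mult_ac)
  define e where "e = qpoch_inf (t^3) ((t^3)^2)"
  have E: "e * qpoch_inf (- (t^3)) (t^3) = 1" unfolding e_def by (rule euler_product[OF t3])
  have Q: "qpoch_inf (t^3) (t^3) = e * qpoch_inf ((t^3)^2) ((t^3)^2)" unfolding e_def by (rule qq_split[OF t3])
  have "alt_theta t 6 3 * qpoch_inf (t^2) (t^2) = (e * qpoch_inf (- (t^3)) (t^3)) * (e * qpoch_inf ((t^3)^2) ((t^3)^2))
      * (qpoch_inf t t * (qpoch_inf (- t) (t^3) * qpoch_inf (- (t^2)) (t^3)))"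
    unfolding B S M theta_J12_eq[OF t3] e_def[symmetric] by (simp only: power2_eq_square[of e] mult_ac)
  then show ?thesis unfolding E P Q by (simp only: mult_1_left mult_ac)
qed

section \<open>Projection onto residue classes of exponents mod 3\<close>

context
  fixes w :: complex
  assumes w3: "w ^ 3 = 1" and w1: "w \<noteq> 1"
begin

lemma w_quadratic: "w * w = - 1 - w" "w * (w * x) = - x - w * x"
proof -
  have "(w - 1) * (1 + w + w * w) = 0" using w3 by (simp add: algebra_simps power3_eq_cube)
  then have s0: "1 + w + w * w = 0" using w1 by (metis mult_eq_0_iff right_minus_eq)
  have "w * w = (1 + w + w * w) - 1 - w" by simp
  with s0 show ww: "w * w = - 1 - w" by simp
  have "w * (w * x) = (w * w) * x" by simp
  then show "w * (w * x) = - x - w * x" unfolding ww by (simp add: algebra_simps)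
qed

lemma w_powi: "w powi n = w powi (n mod 3)"
proof -
  have w0: "w \<noteq> 0" using w3 by auto
  have "w powi n = w powi (3 * (n div 3)) * w powi (n mod 3)"
    using w0 by (simp flip: power_int_add)
  also have "w powi (3 * (n div 3)) = 1" using w3 by (simp add: power_int_mult)
  finally show ?thesis by simp
qed

lemma w_powi_cases: "n mod 3 = 0 \<Longrightarrow> w powi n = 1" "n mod 3 = 1 \<Longrightarrow> w powi n = w" "n mod 3 = 2 \<Longrightarrow> w powi n = - 1 - w"
  using w_powi[of n] w_quadratic(1) by (simp_all add: power2_eq_square)

text \<open>For a power series f this is three times the part with exponents divisible by 3;
  \<open>class_sum1\<close> is three times the part with exponents congruent to 1.\<close>

definition class_sum0 :: "(complex \<Rightarrow> complex) \<Rightarrow> complex \<Rightarrow> complex" where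
  "class_sum0 f q = f q + f (w * q) + f (w^2 * q)"

definition class_sum1 :: "(complex \<Rightarrow> complex) \<Rightarrow> complex \<Rightarrow> complex" where
  "class_sum1 f q = f q + w^2 * f (w * q) + w * f (w^2 * q)"

context
  fixes q :: complex
  assumes q0: "q \<noteq> 0" and q1: "norm q < 1"
begin

lemma wq: "w * q \<noteq> 0" "norm (w * q) < 1" "w^2 * q \<noteq> 0" "norm (w^2 * q) < 1"
  "(w * q)^3 = q^3" "(w^2 * q)^3 = q^3"
proof -
  have n: "norm w = 1" by (rule norm_cube_root[OF w3])
  then have w0: "w \<noteq> 0" by auto
  show "w * q \<noteq> 0" "norm (w * q) < 1" "w^2 * q \<noteq> 0" "norm (w^2 * q) < 1"
    using q0 q1 n w0 by (auto simp: norm_mult norm_power)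
  show "(w * q)^3 = q^3" using w3 by (simp add: power_mult_distrib)
  have "(w^2)^3 = (w^3)^2" by (simp flip: power_mult)
  then show "(w^2 * q)^3 = q^3" using w3 by (simp add: power_mult_distrib)
qed

text \<open>In \<open>hecke_ratio_rec\<close> the term \<open>q powi (k + 3)\<close> lies outside the residue class of exponents selected
  here for \<open>k + 5\<close>, so that the projected recurrence becomes homogeneous.\<close>

definition class_coeff :: "int \<Rightarrow> complex" where
  "class_coeff k = (if k mod 3 = 2 then class_sum1 (\<lambda>q. hecke_ratio q k) q else class_sum0 (\<lambda>q. hecke_ratio q k) q)"

lemma wq_powi: "(w * q) powi n = w powi n * q powi n" "(w^2 * q) powi n = w powi n * w powi n * q powi n"
  by (simp_all add: power_int_mult_distrib power2_eq_square)

lemma class_coeff_rec: "class_coeff (k + 5) = - (q powi (2 * k + 4)) * class_coeff k"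
proof -
  note r = hecke_ratio_rec[OF q0 q1, of k] hecke_ratio_rec[OF wq(1,2), of k, unfolded wq_powi] hecke_ratio_rec[OF wq(3,4), of k, unfolded wq_powi]
  consider "k mod 3 = 0" | "k mod 3 = 1" | "k mod 3 = 2" by linarith
  then show ?thesis
  proof cases
    case 1
    then have m: "(k + 5) mod 3 = 2" "(2 * k + 4) mod 3 = 1" "(k + 3) mod 3 = 0" by presburger+
    show ?thesis unfolding class_coeff_def class_sum0_def class_sum1_def r w_powi_cases(2)[OF m(2)] w_powi_cases(1)[OF m(3)]
      using 1 m(1) by (simp add: power2_eq_square algebra_simps w_quadratic)
  next
    case 2
    then have m: "(k + 5) mod 3 = 0" "(2 * k + 4) mod 3 = 0" "(k + 3) mod 3 = 1" by presburger+
    show ?thesis unfolding class_coeff_def class_sum0_def class_sum1_def r w_powi_cases(1)[OF m(2)] w_powi_cases(2)[OF m(3)]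
      using 2 m(1) by (simp add: power2_eq_square algebra_simps w_quadratic)
  next
    case 3
    then have m: "(k + 5) mod 3 = 1" "(2 * k + 4) mod 3 = 2" "(k + 3) mod 3 = 2" by presburger+
    show ?thesis unfolding class_coeff_def class_sum0_def class_sum1_def r w_powi_cases(3)[OF m(2)] w_powi_cases(3)[OF m(3)]
      using 3 m(1) by (simp add: power2_eq_square algebra_simps w_quadratic)
  qed
qed

text \<open>The zero at 3 is what makes the system determinate: the explicit value -q has exponent 1
  while class 0 is selected there.\<close>

lemma class_coeff_values: "class_coeff 0 = class_sum0 mock_phi10 q" "class_coeff 1 = class_sum0 mock_phi10 q" "class_coeff 2 = class_sum1 mock_psi10 q"
  "class_coeff (- 1) = class_sum1 mock_psi10 q" "class_coeff 3 = 0"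
  using hecke_ratio_values[OF q0 q1] hecke_ratio_values[OF wq(1,2)] hecke_ratio_values[OF wq(3,4)]
  by (simp_all add: class_coeff_def class_sum0_def class_sum1_def power2_eq_square algebra_simps w_quadratic)

text \<open>The projected recurrence is homogeneous, so along steps of 5 the coefficients are theta
  terms in 10 tri n. Keeping every third n gives a theta series with leading constant 9 * 10 =
  90.\<close>

lemma class_coeff_progression:
  "(\<Sum>\<^sub>\<infinity>l. class_coeff (5 * (3 * l + j) + i)) = alt_sign j * q powi (10 * tri j + (2 * i + 4) * j) * alt_theta q 90 (42 + 30 * j + 6 * i) * class_coeff i"
proof -
  have c: "class_coeff (5 * n + i) = alt_sign n * q powi (10 * tri n + (2 * i + 4) * n) * class_coeff i" for n
  proof -
    have r: "class_coeff (5 * (n + 1) + i) = - (q powi (10 * n + (2 * i + 4))) * class_coeff (5 * n + i)" for n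
    proof -
      have e: "5 * (n + 1) + i = (5 * n + i) + 5" "10 * n + (2 * i + 4) = 2 * (5 * n + i) + 4" by simp_all
      show ?thesis unfolding e by (rule class_coeff_rec)
    qed
    show ?thesis using int_recurrence[OF q0, of "\<lambda>n. class_coeff (5 * n + i)" 10 "2 * i + 4" n, OF r] by simp
  qed
  have "(\<Sum>\<^sub>\<infinity>l. class_coeff (5 * (3 * l + j) + i))
      = (\<Sum>\<^sub>\<infinity>l. alt_sign j * q powi (10 * tri j + (2 * i + 4) * j) * class_coeff i * (alt_sign l * q powi (90 * tri l + (42 + 30 * j + 6 * i) * l)))"
  proof (rule infsum_cong)
    fix l
    have e: "10 * tri (3 * l + j) + (2 * i + 4) * (3 * l + j) = (10 * tri j + (2 * i + 4) * j) + (90 * tri l + (42 + 30 * j + 6 * i) * l)"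
      unfolding tri_add tri_3 by (simp add: algebra_simps)
    have "alt_sign (3 * l + j) = alt_sign j * alt_sign l" by (simp add: alt_sign_def)
    then show "class_coeff (5 * (3 * l + j) + i) = alt_sign j * q powi (10 * tri j + (2 * i + 4) * j) * class_coeff i * (alt_sign l * q powi (90 * tri l + (42 + 30 * j + 6 * i) * l))"
      unfolding c e using q0 by (simp add: power_int_add)
  qed
  then show ?thesis unfolding infsum_cmult_right' alt_theta_def by (simp add: mult_ac)
qed

lemma hecke_ratio_class:
  assumes p: "p \<noteq> 0" "norm p < 1"
  shows "(\<Sum>\<^sub>\<infinity>m. hecke_ratio p (3 * m)) = half_theta p * pos_theta (p^3) 3 1"
    and "(\<Sum>\<^sub>\<infinity>m. hecke_ratio p (3 * m + 2)) = half_theta p * (p * pos_theta (p^3) 3 3)"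
    and "(\<lambda>m. hecke_ratio p (3 * m + i)) summable_on UNIV"
proof -
  have g: "(\<lambda>n. norm (half_theta p * p powi tri n)) summable_on UNIV"
    using summable_on_cmult_right[OF theta_linear_abs_summable[OF p, of 1 0], of "norm (half_theta p)"] by (simp add: norm_mult)
  have *: "(\<Sum>\<^sub>\<infinity>m. hecke_ratio p (3 * m + int i)) = half_theta p * (\<Sum>\<^sub>\<infinity>m. p powi tri (3 * m + int i))" if "i < 3" for i
    unfolding infsum_cmult_right'[symmetric]
  proof (rule infsum_class_eqI[OF hecke_ratio_abs_summable[OF p] g w3 w1 _ that])
    fix u :: complex
    assume "u ^ 3 = 1"
    then show "(\<Sum>\<^sub>\<infinity>n. hecke_ratio p n * u powi n) = (\<Sum>\<^sub>\<infinity>n. half_theta p * p powi tri n * u powi n)"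
      using hecke_ratio_cube_root_sum[OF p] by (simp add: mult.assoc infsum_cmult_right')
  qed
  show "(\<Sum>\<^sub>\<infinity>m. hecke_ratio p (3 * m)) = half_theta p * pos_theta (p^3) 3 1"
    using *[of 0] half_theta_dissection(2)[OF p] by simp
  show "(\<Sum>\<^sub>\<infinity>m. hecke_ratio p (3 * m + 2)) = half_theta p * (p * pos_theta (p^3) 3 3)"
    using *[of 2] half_theta_dissection(3)[OF p] by simp
  show "(\<lambda>m. hecke_ratio p (3 * m + i)) summable_on UNIV"
    using summable_on_int_affine[OF abs_summable_summable[OF hecke_ratio_abs_summable[OF p]], of 3 i] by simp
qed

text \<open>The second part of \<open>half_theta_dissection\<close> is q times a function of q^3,
  hence of class 1, and averages to zero.\<close>

lemma half_theta_average: "half_theta q + half_theta (w * q) + half_theta (w^2 * q) = 3 * pos_theta (q^3) 3 1"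
  unfolding half_theta_dissection(1)[OF q0 q1] half_theta_dissection(1)[OF wq(1,2)] half_theta_dissection(1)[OF wq(3,4)] wq(5,6)
  by (simp add: algebra_simps power2_eq_square w_quadratic diff_divide_distrib)

text \<open>The factors \<open>pos_theta (p^3)\<close> agree at p = q, w q and w^2 q, so the
  projection acts on \<open>half_theta\<close> alone. For the indices 3 m + 2 the weights w^2 and w
  cancel against the explicit factor p.\<close>

lemma class_coeff_sums:
  "(\<Sum>\<^sub>\<infinity>m. class_coeff (3 * m)) = 3 * pos_theta (q^3) 3 1 ^ 2"
  "(\<Sum>\<^sub>\<infinity>m. class_coeff (3 * m + 2)) = 3 * q * pos_theta (q^3) 3 1 * pos_theta (q^3) 3 3"
  "(\<lambda>m. class_coeff (3 * m)) summable_on UNIV" "(\<lambda>m. class_coeff (3 * m + 2)) summable_on UNIV"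
proof -
  have e0: "class_coeff (3 * m) = hecke_ratio q (3 * m) + hecke_ratio (w * q) (3 * m) + hecke_ratio (w^2 * q) (3 * m)" for m
    by (simp add: class_coeff_def class_sum0_def)
  have "(3 * m + 2) mod 3 = 2" for m :: int by presburger
  then have e2: "class_coeff (3 * m + 2) = hecke_ratio q (3 * m + 2) + w^2 * hecke_ratio (w * q) (3 * m + 2) + w * hecke_ratio (w^2 * q) (3 * m + 2)" for m
    by (simp add: class_coeff_def class_sum1_def)
  note s0 = hecke_ratio_class(3)[OF q0 q1, of 0, unfolded add_0_right] hecke_ratio_class(3)[OF wq(1,2), of 0, unfolded add_0_right]
    hecke_ratio_class(3)[OF wq(3,4), of 0, unfolded add_0_right]
  note s2 = hecke_ratio_class(3)[OF q0 q1, of 2] summable_on_cmult_right[OF hecke_ratio_class(3)[OF wq(1,2), of 2], of "w^2"]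
    summable_on_cmult_right[OF hecke_ratio_class(3)[OF wq(3,4), of 2], of w]
  show "(\<lambda>m. class_coeff (3 * m)) summable_on UNIV" unfolding e0 by (intro summable_on_add s0)
  show "(\<lambda>m. class_coeff (3 * m + 2)) summable_on UNIV" unfolding e2 by (intro summable_on_add s2)
  have "(\<Sum>\<^sub>\<infinity>m. class_coeff (3 * m)) = (half_theta q + half_theta (w * q) + half_theta (w^2 * q)) * pos_theta (q^3) 3 1"
    unfolding e0 infsum_add[OF summable_on_add[OF s0(1,2)] s0(3)] infsum_add[OF s0(1,2)]
      hecke_ratio_class(1)[OF q0 q1] hecke_ratio_class(1)[OF wq(1,2)] hecke_ratio_class(1)[OF wq(3,4)] wq(5,6) by (simp add: algebra_simps)
  then show "(\<Sum>\<^sub>\<infinity>m. class_coeff (3 * m)) = 3 * pos_theta (q^3) 3 1 ^ 2"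
    unfolding half_theta_average by (simp add: power2_eq_square)
  have "(\<Sum>\<^sub>\<infinity>m. class_coeff (3 * m + 2)) = (half_theta q + half_theta (w * q) + half_theta (w^2 * q)) * (q * pos_theta (q^3) 3 3)"
    unfolding e2 infsum_add[OF summable_on_add[OF s2(1,2)] s2(3)] infsum_add[OF s2(1,2)] infsum_cmult_right'
      hecke_ratio_class(2)[OF q0 q1] hecke_ratio_class(2)[OF wq(1,2)] hecke_ratio_class(2)[OF wq(3,4)] wq(5,6)
    by (simp add: algebra_simps power2_eq_square w_quadratic)
  then show "(\<Sum>\<^sub>\<infinity>m. class_coeff (3 * m + 2)) = 3 * q * pos_theta (q^3) 3 1 * pos_theta (q^3) 3 3"
    unfolding half_theta_average by (simp add: mult_ac)
qed

lemma sum_lessThan_5: "(\<Sum>i<5. f (int i)) = f 0 + f 1 + f 2 + f 3 + (f 4 :: complex)"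
proof -
  have "{..<5::nat} = {0, 1, 2, 3, 4}" by auto
  then show ?thesis by (simp add: add_ac)
qed

text \<open>Each equation evaluates one sum over k mod 3 in two ways: by
  \<open>class_coeff_sums\<close>, and after splitting mod 15 into progressions 5 (3 l + j) + i with
  -1 <= i <= 3, whose initial values are the phi part, the psi part or 0. Dividing the class-1 part
  of psi by q makes \<open>y\<close>, like \<open>x\<close>, a series in t.\<close>

lemma class_system:
  defines "t \<equiv> q^3" and "x \<equiv> class_sum0 mock_phi10 q" and "y \<equiv> class_sum1 mock_psi10 q / q"
  shows "x * (alt_theta t 30 14 - t^2 * alt_theta t 30 4) - t * y * (alt_theta t 30 8 + t^2 * alt_theta t 30 2) = 3 * pos_theta t 3 1 ^ 2"
    and "2 * (y * alt_theta t 30 12 - t * x * alt_theta t 30 6) = 3 * pos_theta t 3 1 * pos_theta t 3 3"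
proof -
  have b: "alt_theta q 90 (3 * c) = alt_theta t 30 c" for c using alt_theta_power[of q 3 30 c] by (simp add: t_def)
  have t0: "t \<noteq> 0" using q0 by (simp add: t_def)
  have class_coeff: "class_coeff 0 = x" "class_coeff 1 = x" "class_coeff 2 = q * y" "class_coeff (- 1) = q * y" "class_coeff 3 = 0"
    unfolding class_coeff_values x_def y_def using q0 by simp_all
  have "3 * pos_theta t 3 1 ^ 2 = (\<Sum>i<5. \<Sum>\<^sub>\<infinity>l. class_coeff (3 * (int 5 * l + int i)))"
    unfolding t_def class_coeff_sums(1)[symmetric] by (rule infsum_int_mod[OF class_coeff_sums(3)]) simp
  also have "\<dots> = (\<Sum>\<^sub>\<infinity>l. class_coeff (5 * (3 * l + 0) + 0)) + (\<Sum>\<^sub>\<infinity>l. class_coeff (5 * (3 * l + 0) + 3)) + (\<Sum>\<^sub>\<infinity>l. class_coeff (5 * (3 * l + 1) + 1))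
     + (\<Sum>\<^sub>\<infinity>l. class_coeff (5 * (3 * l + 2) + - 1)) + (\<Sum>\<^sub>\<infinity>l. class_coeff (5 * (3 * l + 2) + 2))"
    by (subst sum_lessThan_5[of "\<lambda>i. \<Sum>\<^sub>\<infinity>l. class_coeff (3 * (int 5 * l + i))"]) (simp add: algebra_simps)
  also have "\<dots> = x * alt_theta q 90 (3 * 14) - q ^ 6 * x * alt_theta q 90 (3 * 26) + q ^ 14 * (q * y) * alt_theta q 90 (3 * 32) + q ^ 26 * (q * y) * alt_theta q 90 (3 * 38)"
    unfolding class_coeff_progression class_coeff by (simp add: alt_sign_def)
  also have "\<dots> = x * alt_theta t 30 14 - t^2 * x * alt_theta t 30 4 + q ^ 15 * y * alt_theta t 30 32 + q ^ 27 * y * alt_theta t 30 38"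
    unfolding b using alt_theta_reflect[of t 30 4] by (simp add: t_def mult_ac eval_nat_numeral)
  also have "alt_theta t 30 32 = - (alt_theta t 30 2 / t^2)"
    using alt_theta_shift[OF t0, of 30 2] by (simp add: power_int_minus divide_inverse)
  also have "alt_theta t 30 38 = - (alt_theta t 30 8 / t^8)"
    using alt_theta_shift[OF t0, of 30 8] by (simp add: power_int_minus divide_inverse)
  finally have E: "3 * pos_theta t 3 1 ^ 2 = x * alt_theta t 30 14 - t^2 * x * alt_theta t 30 4 + q ^ 15 * y * - (alt_theta t 30 2 / t^2) + q ^ 27 * y * - (alt_theta t 30 8 / t^8)" .
  have p: "q ^ 15 = t^5" "q ^ 27 = t^9" by (simp_all add: t_def flip: power_mult)
  have c: "t ^ 5 * y * - (alt_theta t 30 2 / t^2) = - (t^3 * y * alt_theta t 30 2)" "t ^ 9 * y * - (alt_theta t 30 8 / t^8) = - (t * y * alt_theta t 30 8)"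
    using t0 by (simp_all add: field_simps eval_nat_numeral)
  show "x * (alt_theta t 30 14 - t^2 * alt_theta t 30 4) - t * y * (alt_theta t 30 8 + t^2 * alt_theta t 30 2) = 3 * pos_theta t 3 1 ^ 2"
    unfolding E p c by (simp add: algebra_simps power2_eq_square power3_eq_cube)
  have "3 * q * pos_theta t 3 1 * pos_theta t 3 3 = (\<Sum>i<5. \<Sum>\<^sub>\<infinity>l. class_coeff (3 * (int 5 * l + int i) + 2))"
    unfolding t_def class_coeff_sums(2)[symmetric] by (rule infsum_int_mod[OF class_coeff_sums(4)]) simp
  also have "\<dots> = (\<Sum>\<^sub>\<infinity>l. class_coeff (5 * (3 * l + 0) + 2)) + (\<Sum>\<^sub>\<infinity>l. class_coeff (5 * (3 * l + 1) + 0)) + (\<Sum>\<^sub>\<infinity>l. class_coeff (5 * (3 * l + 1) + 3))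
     + (\<Sum>\<^sub>\<infinity>l. class_coeff (5 * (3 * l + 2) + 1)) + (\<Sum>\<^sub>\<infinity>l. class_coeff (5 * (3 * l + 3) + - 1))"
    by (subst sum_lessThan_5[of "\<lambda>i. \<Sum>\<^sub>\<infinity>l. class_coeff (3 * (int 5 * l + i) + 2)"]) (simp add: algebra_simps)
  also have "\<dots> = q * y * alt_theta q 90 (3 * 18) - q ^ 4 * x * alt_theta q 90 (3 * 24) + q ^ 22 * x * alt_theta q 90 (3 * 36) - q ^ 36 * (q * y) * alt_theta q 90 (3 * 42)"
    unfolding class_coeff_progression class_coeff by (simp add: alt_sign_def)
  also have "\<dots> = q * y * alt_theta t 30 12 - q * t * x * alt_theta t 30 6 + q * t^7 * x * alt_theta t 30 36 - q * t^12 * y * alt_theta t 30 42"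
    unfolding b using alt_theta_reflect[of t 30 12] alt_theta_reflect[of t 30 6] by (simp add: t_def mult_ac eval_nat_numeral)
  also have "alt_theta t 30 36 = - (alt_theta t 30 6 / t^6)"
    using alt_theta_shift[OF t0, of 30 6] by (simp add: power_int_minus divide_inverse)
  also have "alt_theta t 30 42 = - (alt_theta t 30 12 / t^12)"
    using alt_theta_shift[OF t0, of 30 12] by (simp add: power_int_minus divide_inverse)
  finally have "q * (3 * pos_theta t 3 1 * pos_theta t 3 3) = q * (2 * (y * alt_theta t 30 12 - t * x * alt_theta t 30 6))"
    using t0 by (simp add: field_simps eval_nat_numeral)
  then show "2 * (y * alt_theta t 30 12 - t * x * alt_theta t 30 6) = 3 * pos_theta t 3 1 * pos_theta t 3 3"
    using q0 by (simp only: mult_cancel_left) simp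
qed

end

end

section \<open>The residue class of the Hecke sum\<close>

lemma sum_residue_class:
  fixes f :: "nat \<Rightarrow> complex"
  assumes "\<And>r. r \<in> A \<Longrightarrow> r \<notin> g ` B \<Longrightarrow> f r = 0" "inj_on g B" "g ` B \<subseteq> A" "finite A"
  shows "(\<Sum>r\<in>A. f r) = (\<Sum>s\<in>B. f (g s))"
proof -
  have "(\<Sum>r\<in>A. f r) = (\<Sum>r\<in>g ` B. f r)"
    by (rule sum.mono_neutral_right) (use assms in auto)
  then show ?thesis using assms(2) by (simp add: sum.reindex)
qed

context
  fixes w :: complex
  assumes w3: "w ^ 3 = 1" and w1: "w \<noteq> 1"
begin

lemma w_power_cases: "n mod 3 = 0 \<Longrightarrow> w ^ n = 1" "n mod 3 = 1 \<Longrightarrow> w ^ n = w" "n mod 3 = 2 \<Longrightarrow> w ^ n = - 1 - w"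
proof -
  have e: "w ^ n = w powi int n" by simp
  have "n mod 3 = r \<Longrightarrow> int n mod 3 = int r" for r using of_nat_mod[of n 3, where 'a = int] by simp
  from this[of 0] this[of 1] this[of 2]
  show "n mod 3 = 0 \<Longrightarrow> w ^ n = 1" "n mod 3 = 1 \<Longrightarrow> w ^ n = w" "n mod 3 = 2 \<Longrightarrow> w ^ n = - 1 - w"
    unfolding e using w_powi_cases[OF w3 w1, of "int n"] by auto
qed

lemma power_class_1: "q ^ x + w^2 * (w * q) ^ x + w * (w^2 * q) ^ x = (if x mod 3 = 1 then 3 * q ^ x else 0)"
proof -
  have e: "(w * q) ^ x = w ^ x * q ^ x" "(w^2 * q) ^ x = w ^ x * w ^ x * q ^ x"
    by (simp_all add: power_mult_distrib power2_eq_square)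
  consider "x mod 3 = 0" | "x mod 3 = 1" | "x mod 3 = 2" by linarith
  then show ?thesis unfolding e
    by cases (simp_all add: w_power_cases power2_eq_square algebra_simps w_quadratic[OF w3 w1])
qed

lemma power_class_2: "q ^ x + w * (w * q) ^ x + w^2 * (w^2 * q) ^ x = (if x mod 3 = 2 then 3 * q ^ x else 0)"
proof -
  have e: "(w * q) ^ x = w ^ x * q ^ x" "(w^2 * q) ^ x = w ^ x * w ^ x * q ^ x"
    by (simp_all add: power_mult_distrib power2_eq_square)
  consider "x mod 3 = 0" | "x mod 3 = 1" | "x mod 3 = 2" by linarith
  then show ?thesis unfolding e
    by cases (simp_all add: w_power_cases power2_eq_square algebra_simps w_quadratic[OF w3 w1])
qed

text \<open>Three times the part of \<open>hecke_coeff q N\<close> with exponents congruent to 1 mod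
  3; \<open>class2_coeff\<close> does the same for 2.\<close>

definition class1_coeff :: "complex \<Rightarrow> int \<Rightarrow> complex" where
  "class1_coeff q N = hecke_coeff q N + w^2 * hecke_coeff (w * q) N + w * hecke_coeff (w^2 * q) N"

definition class2_coeff :: "complex \<Rightarrow> int \<Rightarrow> complex" where
  "class2_coeff q N = hecke_coeff q N + w * hecke_coeff (w * q) N + w^2 * hecke_coeff (w^2 * q) N"

lemma class1_coeff_sum:
  "class1_coeff q (int n) = (\<Sum>r\<le>n. if r * (n - r) mod 3 = 1 then 3 * q ^ (r * (n - r)) else 0)"
  "class1_coeff q (- int n) = - (\<Sum>r\<in>{1..<n}. if r * (n - r) mod 3 = 1 then 3 * q ^ (r * (n - r)) else 0)" if "n > 0"
proof -
  have "(\<Sum>r\<in>A. if r * (n - r) mod 3 = 1 then 3 * q ^ (r * (n - r)) else 0)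
      = (\<Sum>r\<in>A. q ^ (r * (n - r))) + w^2 * (\<Sum>r\<in>A. (w * q) ^ (r * (n - r))) + w * (\<Sum>r\<in>A. (w^2 * q) ^ (r * (n - r)))"
    for A unfolding power_class_1[symmetric] by (simp add: sum.distrib sum_distrib_left)
  note this[of "{..n}"] this[of "{1..<n}"]
  then show "class1_coeff q (int n) = (\<Sum>r\<le>n. if r * (n - r) mod 3 = 1 then 3 * q ^ (r * (n - r)) else 0)"
    "class1_coeff q (- int n) = - (\<Sum>r\<in>{1..<n}. if r * (n - r) mod 3 = 1 then 3 * q ^ (r * (n - r)) else 0)"
    using that by (simp_all add: class1_coeff_def hecke_coeff_def)
qed

lemma class2_coeff_sum:
  "class2_coeff q (int n) = (\<Sum>r\<le>n. if r * (n - r) mod 3 = 2 then 3 * q ^ (r * (n - r)) else 0)"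
  "class2_coeff q (- int n) = - (\<Sum>r\<in>{1..<n}. if r * (n - r) mod 3 = 2 then 3 * q ^ (r * (n - r)) else 0)" if "n > 0"
proof -
  have "(\<Sum>r\<in>A. if r * (n - r) mod 3 = 2 then 3 * q ^ (r * (n - r)) else 0)
      = (\<Sum>r\<in>A. q ^ (r * (n - r))) + w * (\<Sum>r\<in>A. (w * q) ^ (r * (n - r))) + w^2 * (\<Sum>r\<in>A. (w^2 * q) ^ (r * (n - r)))"
    for A unfolding power_class_2[symmetric] by (simp add: sum.distrib sum_distrib_left)
  note this[of "{..n}"] this[of "{1..<n}"]
  then show "class2_coeff q (int n) = (\<Sum>r\<le>n. if r * (n - r) mod 3 = 2 then 3 * q ^ (r * (n - r)) else 0)"
    "class2_coeff q (- int n) = - (\<Sum>r\<in>{1..<n}. if r * (n - r) mod 3 = 2 then 3 * q ^ (r * (n - r)) else 0)"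
    using that by (simp_all add: class2_coeff_def hecke_coeff_def)
qed

lemma product_mod_3:
  fixes r s :: nat
  shows "(r * s) mod 3 = (r mod 3) * (s mod 3) mod 3"
  by (simp add: mod_mult_eq)

lemma mod3_cases: "(r :: nat) mod 3 = 0 \<or> r mod 3 = 1 \<or> r mod 3 = 2" by linarith

text \<open>If r + s is divisible by 3, then r s is congruent to -r^2, which is 0 or 2 but never
  1.\<close>

lemma class1_coeff_0mod3: "class1_coeff q (3 * M) = 0"
proof -
  have ne: "r * (n - r) mod 3 \<noteq> 1" if "n mod 3 = 0" "r \<le> n" for r n :: nat
  proof -
    obtain s where s: "n = r + s" using le_Suc_ex[OF \<open>r \<le> n\<close>] by auto
    then have "(r mod 3 + s mod 3) mod 3 = 0" using that by (simp add: mod_add_eq)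
    then show ?thesis unfolding s using mod3_cases[of r] mod3_cases[of s] product_mod_3[of r s] by (auto simp del: One_nat_def)
  qed
  show ?thesis
  proof (cases "M = 0")
    case True
    then show ?thesis unfolding class1_coeff_def by (simp add: power2_eq_square w_quadratic[OF w3 w1])
  next
    case False
    define n where "n = 3 * nat \<bar>M\<bar>"
    have n: "n > 0" "3 * M = int n \<or> 3 * M = - int n" "n mod 3 = 0"
      using False by (auto simp: n_def)
    then show ?thesis using ne[OF n(3)] class1_coeff_sum[OF n(1), of q] by (auto intro!: sum.neutral)
  qed
qed

text \<open>A product r s congruent to 2 needs residues 1 and 2, so that r + s is divisible by
  3.\<close>

lemma class2_coeff_1mod3: "class2_coeff q (3 * M + 1) = 0"
proof -
  have ne1: "r * (n - r) mod 3 \<noteq> 2" if "n mod 3 \<noteq> 0" "r \<le> n" for r n :: nat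
  proof -
    obtain s where s: "n = r + s" using le_Suc_ex[OF \<open>r \<le> n\<close>] by auto
    then have "(r mod 3 + s mod 3) mod 3 \<noteq> 0" using that by (simp add: mod_add_eq)
    then show ?thesis unfolding s using mod3_cases[of r] mod3_cases[of s] product_mod_3[of r s] by (auto simp del: One_nat_def)
  qed
  define n where "n = nat \<bar>3 * M + 1\<bar>"
  have n: "n > 0" "3 * M + 1 = int n \<or> 3 * M + 1 = - int n" "n mod 3 \<noteq> 0"
  proof -
    have "3 * M + 1 \<noteq> 0" by presburger
    then show "n > 0" by (simp add: n_def)
    show "3 * M + 1 = int n \<or> 3 * M + 1 = - int n" by (auto simp: n_def)
    then show "n mod 3 \<noteq> 0" by presburger
  qed
  then show ?thesis using ne1[OF n(3)] class2_coeff_sum[OF n(1), of q] by (auto intro!: sum.neutral)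
qed

text \<open>For r + s = 3 M + 2 and r s = 1 mod 3, both r and s are 1 mod 3. With r = 3 u + 1 and s
  = 3 v + 1 this gives u + v = M and r s = 9 u v + 3 M + 1, a Hecke coefficient to the base q^9. For
  negative M the summation runs over positive r with the opposite sum, and both residues are
  2.\<close>

lemma class1_coeff_2mod3:
  assumes q0: "q \<noteq> 0"
  shows "class1_coeff q (3 * M + 2) = 3 * q powi (3 * M + 1) * hecke_coeff (q^9) M"
proof (cases "M \<ge> 0")
  case True
  then obtain m where m: "M = int m" using nonneg_int_cases by blast
  define n where "n = 3 * m + 2"
  have i: "3 * M + 2 = int n" "n > 0" by (simp_all add: n_def m)
  have "class1_coeff q (3 * M + 2) = (\<Sum>r\<le>n. if r * (n - r) mod 3 = 1 then 3 * q ^ (r * (n - r)) else 0)"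
    unfolding i(1) by (rule class1_coeff_sum(1)[OF i(2)])
  also have "\<dots> = (\<Sum>s\<le>m. if (3 * s + 1) * (n - (3 * s + 1)) mod 3 = 1 then 3 * q ^ ((3 * s + 1) * (n - (3 * s + 1))) else 0)"
  proof (rule sum_residue_class)
    fix r assume r: "r \<in> {..n}" "r \<notin> (\<lambda>s. 3 * s + 1) ` {..m}"
    obtain s where s: "n = r + s" using r le_Suc_ex[of r n] by auto
    have "r mod 3 \<noteq> 1"
    proof
      assume "r mod 3 = 1"
      then have "r = 3 * (r div 3) + 1" by presburger
      moreover have "r div 3 \<le> m" using r(1) by (simp add: n_def)
      ultimately show False using r(2) by blast
    qed
    moreover have "(r + s) mod 3 = 2" unfolding s[symmetric] n_def by presburger
    then have "(r mod 3 + s mod 3) mod 3 = 2" by (simp add: mod_add_eq)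
    ultimately have "r * s mod 3 \<noteq> 1" using mod3_cases[of r] mod3_cases[of s] product_mod_3[of r s] by (auto simp del: One_nat_def)
    then show "(if r * (n - r) mod 3 = 1 then 3 * q ^ (r * (n - r)) else 0) = 0" by (simp add: s)
  qed (auto simp: n_def inj_on_def)
  also have "\<dots> = (\<Sum>s\<le>m. 3 * q ^ (3 * m + 1) * (q^9) ^ (s * (m - s)))"
  proof (rule sum.cong)
    fix s assume "s \<in> {..m}"
    then obtain u where u: "m = s + u" using le_Suc_ex by auto
    have e: "(3 * s + 1) * (n - (3 * s + 1)) = 3 * m + 1 + 9 * (s * (m - s))"
      by (simp add: n_def u algebra_simps)
    have "(3 * m + 1 + 9 * (s * (m - s))) mod 3 = 1" by presburger
    then show "(if (3 * s + 1) * (n - (3 * s + 1)) mod 3 = 1 then 3 * q ^ ((3 * s + 1) * (n - (3 * s + 1))) else 0)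
        = 3 * q ^ (3 * m + 1) * (q^9) ^ (s * (m - s))"
      unfolding e by (simp add: power_add power_mult)
  qed simp
  also have "\<dots> = 3 * q ^ (3 * m + 1) * hecke_coeff (q^9) M"
    by (simp add: hecke_coeff_def m sum_distrib_left)
  also have "q ^ (3 * m + 1) = q powi (3 * M + 1)"
    using power_int_of_nat[of q "3 * m + 1"] by (simp add: m add.commute)
  finally show ?thesis .
next
  case False
  define k where "k = nat (- M)"
  have k: "M = - int k" "k > 0" using False by (auto simp: k_def)
  define n where "n = 3 * k - 2"
  have i: "3 * M + 2 = - int n" "n > 0" using k by (auto simp: n_def)
  have "class1_coeff q (3 * M + 2) = - (\<Sum>r\<in>{1..<n}. if r * (n - r) mod 3 = 1 then 3 * q ^ (r * (n - r)) else 0)"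
    unfolding i(1) by (rule class1_coeff_sum(2)[OF i(2)])
  also have "(\<Sum>r\<in>{1..<n}. if r * (n - r) mod 3 = 1 then 3 * q ^ (r * (n - r)) else 0)
      = (\<Sum>s\<in>{1..<k}. if (3 * s - 1) * (n - (3 * s - 1)) mod 3 = 1 then 3 * q ^ ((3 * s - 1) * (n - (3 * s - 1))) else 0)"
  proof (rule sum_residue_class)
    fix r assume r: "r \<in> {1..<n}" "r \<notin> (\<lambda>s. 3 * s - 1) ` {1..<k}"
    obtain s where s: "n = r + s" using r le_Suc_ex[of r n] by auto
    have "r mod 3 \<noteq> 2"
    proof
      assume "r mod 3 = 2"
      then have "r = 3 * (r div 3 + 1) - 1" by presburger
      moreover have "r div 3 + 1 \<in> {1..<k}" using r(1) \<open>r mod 3 = 2\<close> by (simp add: n_def) presburger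
      ultimately show False using r(2) by blast
    qed
    moreover have "n = 1 + 3 * (k - 1)" using k(2) by (simp add: n_def)
    then have "(r + s) mod 3 = 1" unfolding s[symmetric] by (simp only: mod_mult_self2) simp
    then have "(r mod 3 + s mod 3) mod 3 = 1" by (simp add: mod_add_eq)
    ultimately have "r * s mod 3 \<noteq> 1" using mod3_cases[of r] mod3_cases[of s] product_mod_3[of r s] by (auto simp del: One_nat_def)
    then show "(if r * (n - r) mod 3 = 1 then 3 * q ^ (r * (n - r)) else 0) = 0" by (simp add: s)
  qed (auto simp: n_def inj_on_def)
  also have "\<dots> = (\<Sum>s\<in>{1..<k}. 3 * q powi (3 * M + 1) * (q^9) ^ (s * (k - s)))"
  proof (rule sum.cong)
    fix s assume s: "s \<in> {1..<k}"
    \<comment> \<open>These variables turn all truncated differences into sums.\<close>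
    define a b where "a = s - 1" and "b = k - s - 1"
    have ab: "s = a + 1" "k = a + b + 2" using s by (auto simp: a_def b_def)
    have e: "(3 * s - 1) * (n - (3 * s - 1)) = (3 * a + 2) * (3 * b + 2)"
      by (simp add: n_def ab)
    have m: "(3 * a + 2) * (3 * b + 2) mod 3 = 1" 
    proof -
      have "(3 * a + 2) * (3 * b + 2) = 3 * (3 * a * b + 2 * a + 2 * b + 1) + 1" by (simp add: algebra_simps)
      then show ?thesis by presburger
    qed
    have "int ((3 * a + 2) * (3 * b + 2)) = (3 * M + 1) + int (9 * (s * (k - s)))"
      by (simp add: k ab algebra_simps)
    then have "q ^ ((3 * a + 2) * (3 * b + 2)) = q powi (3 * M + 1) * (q^9) ^ (s * (k - s))"
      using q0 power_int_of_nat[of q "(3 * a + 2) * (3 * b + 2)"] power_int_of_nat[of q "9 * (s * (k - s))"]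
      by (simp only: power_int_add power_mult simp_thms)
    then show "(if (3 * s - 1) * (n - (3 * s - 1)) mod 3 = 1 then 3 * q ^ ((3 * s - 1) * (n - (3 * s - 1))) else 0)
        = 3 * q powi (3 * M + 1) * (q^9) ^ (s * (k - s))"
      unfolding e using m by simp
  qed simp
  also have "- (\<Sum>s\<in>{1..<k}. 3 * q powi (3 * M + 1) * (q^9) ^ (s * (k - s))) = 3 * q powi (3 * M + 1) * hecke_coeff (q^9) M"
    using k by (simp add: hecke_coeff_def sum_distrib_left)
  finally show ?thesis .
qed

context
  fixes q :: complex
  assumes q0: "q \<noteq> 0" and q1: "norm q < 1"
begin

text \<open>For N = 0, 1, 2 mod 3 the exponent N^2 + N is 0, 2, 0, so the Hecke coefficient must
  supply class 1, 2, 1. Only N = 2 mod 3 can do so.\<close>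

lemma hecke_sum_class_1: "class_sum1 w (\<lambda>q. hecke_sum q 1) q = 3 * q^7 * hecke_sum (q^9) 2"
proof -
  note wq = wq[OF w3 w1 q0 q1]
  define f where "f p N = alt_sign N * p powi (N * N + 1 * N) * hecke_coeff p N" for p N
  have s: "f p summable_on UNIV" if "p \<noteq> 0" "norm p < 1" for p
    using hecke_sum_summable[OF that, of 1 0] by (simp add: f_def[abs_def])
  have F: "hecke_sum p 1 = infsum (f p) UNIV" if "p \<noteq> 0" "norm p < 1" for p
    unfolding hecke_sum_def[OF that] f_def[abs_def] ..
  note F = F[OF q0 q1] F[OF wq(1,2)] F[OF wq(3,4)]
  note S = s[OF q0 q1] summable_on_cmult_right[OF s[OF wq(1,2)], of "w^2"] summable_on_cmult_right[OF s[OF wq(3,4)], of w]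
  define g where "g N = f q N + w^2 * f (w * q) N + w * f (w^2 * q) N" for N
  have gs: "g summable_on UNIV" unfolding g_def[abs_def] by (intro summable_on_add S)
  have "class_sum1 w (\<lambda>q. hecke_sum q 1) q = (\<Sum>\<^sub>\<infinity>N. g N)"
    unfolding g_def infsum_add[OF summable_on_add[OF S(1,2)] S(3)] infsum_add[OF S(1,2)] infsum_cmult_right'
    by (simp add: class_sum1_def[OF w3 w1] F)
  also have "\<dots> = (\<Sum>i<3. \<Sum>\<^sub>\<infinity>M. g (int 3 * M + int i))" by (rule infsum_int_mod[OF gs]) simp
  also have "\<dots> = (\<Sum>\<^sub>\<infinity>M. g (3 * M)) + (\<Sum>\<^sub>\<infinity>M. g (3 * M + 1)) + (\<Sum>\<^sub>\<infinity>M. g (3 * M + 2))"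
    by (simp add: eval_nat_numeral(2,3))
  also have "(\<Sum>\<^sub>\<infinity>M. g (3 * M)) = 0"
  proof -
    have "g (3 * M) = alt_sign (3 * M) * q powi (3 * M * (3 * M) + 1 * (3 * M)) * class1_coeff q (3 * M)" for M
    proof -
      have m: "(3 * M * (3 * M) + 1 * (3 * M)) mod 3 = 0" by simp
      show ?thesis unfolding g_def f_def class1_coeff_def wq_powi[OF w3 w1 q0 q1] w_powi_cases(1)[OF w3 w1 m] by (simp add: algebra_simps)
    qed
    then show ?thesis by (simp add: class1_coeff_0mod3)
  qed
  also have "(\<Sum>\<^sub>\<infinity>M. g (3 * M + 1)) = 0"
  proof -
    have "g (3 * M + 1) = alt_sign (3 * M + 1) * q powi ((3 * M + 1) * (3 * M + 1) + 1 * (3 * M + 1)) * class2_coeff q (3 * M + 1)" for M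
    proof -
      have "(3 * M + 1) * (3 * M + 1) + 1 * (3 * M + 1) = 3 * (3 * M * M + 3 * M) + 2" by (simp add: algebra_simps)
      then have m: "((3 * M + 1) * (3 * M + 1) + 1 * (3 * M + 1)) mod 3 = 2" by presburger
      show ?thesis unfolding g_def f_def class2_coeff_def wq_powi[OF w3 w1 q0 q1] w_powi_cases(3)[OF w3 w1 m]
        by (simp add: algebra_simps power2_eq_square w_quadratic[OF w3 w1])
    qed
    then show ?thesis by (simp add: class2_coeff_1mod3)
  qed
  also have "(\<Sum>\<^sub>\<infinity>M. g (3 * M + 2)) = 3 * q^7 * hecke_sum (q^9) 2"
  proof -
    have q9: "q^9 \<noteq> 0" "norm (q^9) < 1" using q0 norm_power_less_1[OF q0 q1, of 9] by auto
    have "g (3 * M + 2) = 3 * q^7 * (alt_sign M * (q^9) powi (M * M + 2 * M) * hecke_coeff (q^9) M)" for M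
    proof -
      have e: "(3 * M + 2) * (3 * M + 2) + 1 * (3 * M + 2) = 3 * (3 * M * M + 5 * M + 2)" by (simp add: algebra_simps)
      then have m: "((3 * M + 2) * (3 * M + 2) + 1 * (3 * M + 2)) mod 3 = 0" by presburger
      have "g (3 * M + 2) = alt_sign (3 * M + 2) * q powi ((3 * M + 2) * (3 * M + 2) + 1 * (3 * M + 2)) * class1_coeff q (3 * M + 2)"
        unfolding g_def f_def class1_coeff_def wq_powi[OF w3 w1 q0 q1] w_powi_cases(1)[OF w3 w1 m] by (simp add: algebra_simps)
      also have "\<dots> = 3 * (alt_sign (3 * M + 2) * (q powi ((3 * M + 2) * (3 * M + 2) + 1 * (3 * M + 2)) * q powi (3 * M + 1)) * hecke_coeff (q^9) M)"
        unfolding class1_coeff_2mod3[OF q0] by (simp only: mult_ac)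
      also have "q powi ((3 * M + 2) * (3 * M + 2) + 1 * (3 * M + 2)) * q powi (3 * M + 1) = q^7 * (q^9) powi (M * M + 2 * M)"
      proof -
        have "(3 * M + 2) * (3 * M + 2) + 1 * (3 * M + 2) + (3 * M + 1) = 7 + 9 * (M * M + 2 * M)" by (simp add: algebra_simps)
        then have "q powi ((3 * M + 2) * (3 * M + 2) + 1 * (3 * M + 2)) * q powi (3 * M + 1) = q powi 7 * q powi (9 * (M * M + 2 * M))"
          using q0 by (simp only: power_int_add[symmetric] simp_thms)
        then show ?thesis by (simp add: power_int_power)
      qed
      also have "alt_sign (3 * M + 2) = alt_sign M" by (simp add: alt_sign_def)
      finally show ?thesis by (simp only: mult_ac)
    qed
    then show ?thesis unfolding hecke_sum_def[OF q9] by (simp add: infsum_cmult_right')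
  qed
  finally show ?thesis by simp
qed

text \<open>By \<open>theta_identity_1\<close> and \<open>theta_identity_2\<close>,
  \<open>alt_theta t 5 2\<close> and \<open>alt_theta t 5 1\<close> satisfy the equations of
  \<open>class_system\<close> with proportional right sides. The same elimination in both systems
  (\<open>D1\<close>, \<open>D2\<close>) gives the ratio of the first unknowns once the determinant
  \<open>D\<close> is cancelled.\<close>

lemma phi_class_0:
  defines "t \<equiv> q^3"
  shows "class_sum0 w mock_phi10 q * alt_theta t 2 1 = 3 * pos_theta t 3 1 * alt_theta t 5 2"
proof -
  have t: "t \<noteq> 0" "norm t < 1" using q0 norm_power_less_1[OF q0 q1, of 3] by (auto simp: t_def)
  have u: "t^2 \<noteq> 0" "norm (t^2) < 1" using t norm_power_less_1[OF t, of 2] by auto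
  define x where "x = class_sum0 w mock_phi10 q"
  define y where "y = class_sum1 w mock_psi10 q / q"
  define a where "a = alt_theta t 30 14 - t^2 * alt_theta t 30 4"
  define b where "b = alt_theta t 30 8 + t^2 * alt_theta t 30 2"
  define D where "D = a * alt_theta t 30 12 - t^2 * alt_theta t 30 6 * b"
  have I: "x * a - t * y * b = 3 * pos_theta t 3 1 ^ 2" "2 * (y * alt_theta t 30 12 - t * x * alt_theta t 30 6) = 3 * pos_theta t 3 1 * pos_theta t 3 3"
    using class_system[OF w3 w1 q0 q1] unfolding t_def[symmetric] x_def y_def a_def b_def by auto
  have L: "alt_theta t 2 1 * pos_theta t 3 1 = alt_theta t 5 2 * a - t * alt_theta t 5 1 * b"
    "alt_theta t 2 1 * pos_theta t 3 3 = 2 * (alt_theta t 5 1 * alt_theta t 30 12 - t * alt_theta t 5 2 * alt_theta t 30 6)"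
    using theta_identity_1[OF t] theta_identity_2[OF t] unfolding a_def b_def .
  have D1: "2 * (x * D) = 3 * pos_theta t 3 1 * (2 * pos_theta t 3 1 * alt_theta t 30 12 + t * pos_theta t 3 3 * b)"
  proof -
    have "2 * (x * D) = 2 * alt_theta t 30 12 * (x * a - t * y * b) + t * b * (2 * (y * alt_theta t 30 12 - t * x * alt_theta t 30 6))"
      by (simp add: D_def algebra_simps power2_eq_square)
    then show ?thesis unfolding I by (simp add: algebra_simps power2_eq_square)
  qed
  have D2: "2 * (alt_theta t 5 2 * D) = alt_theta t 2 1 * (2 * pos_theta t 3 1 * alt_theta t 30 12 + t * pos_theta t 3 3 * b)"
  proof -
    have "2 * (alt_theta t 5 2 * D) = 2 * alt_theta t 30 12 * (alt_theta t 5 2 * a - t * alt_theta t 5 1 * b)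
        + t * b * (2 * (alt_theta t 5 1 * alt_theta t 30 12 - t * alt_theta t 5 2 * alt_theta t 30 6))"
      by (simp add: D_def algebra_simps power2_eq_square)
    then show ?thesis unfolding L[symmetric] by (simp add: algebra_simps)
  qed
  \<comment> \<open>The determinant is literally \<open>theta_identity_3\<close> at t^2, hence the
    square of a nonvanishing product.\<close>
  have "D = alt_theta (t^2) 3 1 * alt_theta (t^2) 3 1"
    unfolding theta_identity_3[OF u] unfolding alt_theta_power D_def a_def b_def by simp
  also have "alt_theta (t^2) 3 1 = qpoch_inf (t^2) (t^2)"
    using theta_j_eq_alt_theta[OF u, of 3 1] qq_cube_base(1)[OF u] by simp
  finally have D0: "D \<noteq> 0" using qpoch_inf_nonzero'[OF u(2) u(2)] by simp
  have "(2 * D) * (x * alt_theta t 2 1) = (2 * (x * D)) * alt_theta t 2 1" by (simp only: mult_ac)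
  also have "\<dots> = 3 * pos_theta t 3 1 * (2 * (alt_theta t 5 2 * D))" unfolding D1 D2 by (simp only: mult_ac)
  also have "\<dots> = (2 * D) * (3 * pos_theta t 3 1 * alt_theta t 5 2)" by (simp only: mult_ac)
  finally show ?thesis using D0 by (simp add: x_def)
qed

lemma mock_phi_psi_identity:
  "q powi (-2) * mock_psi10 (q ^ 9)
           + (w * mock_phi10 (w * q) - w ^ 2 * mock_phi10 (w ^ 2 * q)) / (w - w ^ 2)
         = theta_J q 1 2 / theta_J q 3 6 * (theta_J q 6 15 * theta_J1 q 6 / theta_J1 q 3)"
proof -
  note wq = wq[OF w3 w1 q0 q1]
  define t where "t = q^3"
  have t: "t \<noteq> 0" "norm t < 1" using q0 norm_power_less_1[OF q0 q1, of 3] by (auto simp: t_def)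
  have u: "t^2 \<noteq> 0" "norm (t^2) < 1" using t norm_power_less_1[OF t, of 2] by auto
  have q9: "q^9 \<noteq> 0" "norm (q^9) < 1" "q^9 = t^3"
    using q0 norm_power_less_1[OF q0 q1, of 9] by (auto simp: t_def simp flip: power_mult)
  define a where "a = alt_theta t 6 3"
  define b where "b = alt_theta t 6 1"
  have aJ: "a = theta_J12 (q^9)"
    using theta_j_eq_alt_theta[OF q9(1,2), of 2 1] alt_theta_power[of t 3 2 1] by (simp add: a_def q9(3))
  have a0: "a \<noteq> 0" unfolding aJ by (rule theta_J12_nonzero[OF q9(1,2)])
  have J: "theta_J12 q = a - 2 * q * b" "theta_J12 (w * q) = a - 2 * (w * q) * b" "theta_J12 (w^2 * q) = a - 2 * (w^2 * q) * b"
    using theta_J12_dissection[OF q0 q1] theta_J12_dissection[OF wq(1,2)] theta_J12_dissection[OF wq(3,4)]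
    unfolding wq(5,6) t_def[symmetric] a_def b_def by auto
  define \<Phi> where "\<Phi> = class_sum0 w mock_phi10 q"
  define \<Phi>' where "\<Phi>' = class_sum1 w mock_phi10 q"
  \<comment> \<open>Here \<open>a\<close> and \<open>b\<close> depend on q^3 only, so class 1 of
    J_{1,2} phi combines \<open>a\<close> with class 1 of phi and -2 q \<open>b\<close> with class
    0.\<close>
  have "a * \<Phi>' - 2 * q * b * \<Phi> = class_sum1 w (\<lambda>q. hecke_sum q 1) q"
    unfolding class_sum1_def[OF w3 w1] mock_phi10_hecke[OF q0 q1, symmetric] mock_phi10_hecke[OF wq(1,2), symmetric]
      mock_phi10_hecke[OF wq(3,4), symmetric] J \<Phi>_def \<Phi>'_def class_sum0_def[OF w3 w1]
    by (simp add: algebra_simps power2_eq_square w_quadratic[OF w3 w1])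
  also have "\<dots> = 3 * q^7 * hecke_sum (q^9) 2" by (rule hecke_sum_class_1)
  also have "\<dots> = 3 * (a * mock_psi10 (q^9)) / q^2"
    unfolding aJ mock_psi10_hecke[OF q9(1,2)] using q0 by (simp add: field_simps flip: power_add)
  finally have M: "\<Phi>' = 2 * q * b * \<Phi> / a + 3 * mock_psi10 (q^9) / q^2"
    using a0 by (simp add: field_simps)
  have "w - w^2 \<noteq> 0"
  proof
    assume "w - w^2 = 0"
    then have "w * (1 - w) = 0" by (simp add: algebra_simps power2_eq_square)
    then show False using w1 w3 by auto
  qed
  \<comment> \<open>On q^n both sides carry the weight 3 (w - w^2) times 1, -1 or 0 for n = 0, 1 or
    2 mod 3.\<close>
  moreover have "3 * (w * mock_phi10 (w * q) - w ^ 2 * mock_phi10 (w ^ 2 * q)) = (\<Phi> - \<Phi>') * (w - w^2)"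
    unfolding \<Phi>_def \<Phi>'_def class_sum0_def[OF w3 w1] class_sum1_def[OF w3 w1]
    by (simp add: algebra_simps power2_eq_square w_quadratic[OF w3 w1])
  ultimately have frac: "(w * mock_phi10 (w * q) - w ^ 2 * mock_phi10 (w ^ 2 * q)) / (w - w ^ 2) = (\<Phi> - \<Phi>') / 3"
    by (simp add: divide_simps mult_ac)
  have q2: "q powi (-2) = 1 / q^2" by (simp add: power_int_minus inverse_eq_divide)
  have "q powi (-2) * mock_psi10 (q ^ 9)
           + (w * mock_phi10 (w * q) - w ^ 2 * mock_phi10 (w ^ 2 * q)) / (w - w ^ 2)
      = mock_psi10 (q^9) / q^2 + (\<Phi> - \<Phi>') / 3"
    unfolding q2 frac by simp
  \<comment> \<open>The two terms with psi(q^9) cancel, and a - 2 q b recombines to J_{1,2}.\<close>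
  also have "\<dots> = \<Phi> / 3 * (theta_J12 q / a)"
    unfolding M J(1) using a0 q0 by (simp add: field_simps)
  also have "\<Phi> / 3 = pos_theta t 3 1 * alt_theta t 5 2 / alt_theta t 2 1"
  proof -
    have "alt_theta t 2 1 = theta_J12 t" using theta_j_eq_alt_theta[OF t, of 2 1] by simp
    then have "alt_theta t 2 1 \<noteq> 0" using theta_J12_nonzero[OF t] by simp
    then show ?thesis using phi_class_0 unfolding t_def[symmetric] \<Phi>_def[symmetric] by (simp add: field_simps)
  qed
  also have "pos_theta t 3 1 * alt_theta t 5 2 / alt_theta t 2 1 * (theta_J12 q / a) = theta_J12 q / alt_theta t 2 1 * (alt_theta t 5 2 * (pos_theta t 3 1 / a))"
    by (simp add: mult_ac)
  also have "pos_theta t 3 1 / a = qpoch_inf (t^2) (t^2) / qpoch_inf t t"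
    using theta_J12_product_cube[OF t] a0 qpoch_inf_nonzero'[OF t(2) t(2)] unfolding a_def by (simp add: field_simps)
  finally have main: "q powi (-2) * mock_psi10 (q ^ 9)
           + (w * mock_phi10 (w * q) - w ^ 2 * mock_phi10 (w ^ 2 * q)) / (w - w ^ 2)
      = theta_J12 q / alt_theta t 2 1 * (alt_theta t 5 2 * (qpoch_inf (t^2) (t^2) / qpoch_inf t t))" .
  have e: "q ^ 6 = t^2" "q ^ 15 = t ^ 5" "q ^ 18 = (t^2)^3" "q ^ 9 = t^3" "q^3 = t"
    by (simp_all add: t_def flip: power_mult)
  have "theta_J q 1 2 = theta_J12 q" by (simp add: theta_J_def)
  moreover have "theta_J q 3 6 = alt_theta t 2 1"
    using theta_j_eq_alt_theta[OF t, of 2 1] by (simp add: theta_J_def e)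
  moreover have "theta_J q 6 15 = alt_theta t 5 2"
    using theta_j_eq_alt_theta[OF t, of 5 2] by (simp add: theta_J_def e)
  moreover have "theta_J1 q 6 = qpoch_inf (t^2) (t^2)"
    using qq_cube_base(1)[OF u] by (simp add: theta_J1_def theta_J_def e)
  moreover have "theta_J1 q 3 = qpoch_inf t t"
    using qq_cube_base(1)[OF t] by (simp add: theta_J1_def theta_J_def e)
  ultimately show ?thesis unfolding main by simp
qed

end

end

theorem mainTheorem2:
  fixes q \<omega> :: complex
  assumes "0 < norm q" and "norm q < 1"
    and "primitive_root_of_unity 3 \<omega>"
  shows "q powi (-2) * mock_psi10 (q ^ 9)
           + (\<omega> * mock_phi10 (\<omega> * q) - \<omega> ^ 2 * mock_phi10 (\<omega> ^ 2 * q)) / (\<omega> - \<omega> ^ 2)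
         = theta_J q 1 2 / theta_J q 3 6 * (theta_J q 6 15 * theta_J1 q 6 / theta_J1 q 3)"
proof (rule mock_phi_psi_identity)
  show "\<omega> ^ 3 = 1" using assms(3) by (simp add: primitive_root_of_unity_def)
  show "\<omega> \<noteq> 1" using assms(3) unfolding primitive_root_of_unity_def by (metis one_less_numeral_iff power_one_right semiring_norm(77) zero_less_one)
qed (use assms in auto)

end
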